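(* Let $\mathsf{k}$ be a field and let $\delta,r,s$ be positive integers. For a finite simple graph $G$ write $S=\mathsf{k}[V(G)]$. Then: (a) There exists a finite simple graph $G$ such that $\operatorname{depth}(S/I(G))=\delta$ and $\operatorname{reg}(S/I(G))=r$. (b) There exists a finite simple graph $G$ such that $\operatorname{depth}(S/I(G))=\delta$ and $\deg(h_{S/I(G)}(t))=s$.
   Context: For a finite simple graph $G$ with vertex set $V(G)$ and edge set $E(G)$, the vertices are regarded as variables, $S=\mathsf{k}[V(G)]$ is the standard graded polynomial ring, and the edge ideal is $I(G)=(xy:\{x,y\}\in E(G))\subseteq S$. For a homogeneous ideal $I\subsetneq S$ with $\dim(S/I)=d$, the Hilbert series is $H(S/I,t)=h_{S/I}(t)/(1-t)^d$ with $h_{S/I}(t)=h_0+h_1t+\cdots+h_st^s\in\mathbb Z[t]$, $h_s\neq0$; $h_{S/I}(t)$ is the $h$-polynomial of $S/I$. The (Castelnuovo-Mumford) regularity is $\operatorname{reg}(S/I)=\max\{j:\operatorname{Tor}_i^S(S/I,\mathsf{k})_{i+j}\neq0\text{ for some }i\ge0\}$. *)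

theory Defs
  imports
    "HOL-Library.Poly_Mapping"
    "HOL-Algebra.QuotRing"
    "HOL-Algebra.Embedded_Algebras"
    "HOL-Computational_Algebra.Polynomial_FPS"
    "Jordan_Normal_Form.Matrix"
begin

no_notation fps_nth (infixl "$" 75)

section \<open>Polynomial rings on a set of variables\<close>

text \<open>Monomials are finitely supported exponent functions, polynomials are finitely supported
  coefficient functions on monomials; \<open>(+)\<close> and \<open>(*)\<close> of \<open>HOL-Library.Poly_Mapping\<close> are addition and
  convolution.\<close>

type_synonym ('v, 'k) mpoly = "('v \<Rightarrow>\<^sub>0 nat) \<Rightarrow>\<^sub>0 'k"

definition Var :: "'v \<Rightarrow> ('v, 'k::comm_ring_1) mpoly" where
  "Var v = Poly_Mapping.single (Poly_Mapping.single v 1) 1"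

definition Const :: "'k \<Rightarrow> ('v, 'k::comm_ring_1) mpoly" where
  "Const c = Poly_Mapping.single 0 c"

definition poly_ring :: "'v set \<Rightarrow> ('v, 'k::comm_ring_1) mpoly ring" where
  "poly_ring V =
    \<lparr>carrier = {p. \<forall>m\<in>Poly_Mapping.keys p. Poly_Mapping.keys m \<subseteq> V}, monoid.mult = (*), one = 1, zero = 0, add = (+)\<rparr>"

definition mdeg :: "('v \<Rightarrow>\<^sub>0 nat) \<Rightarrow> nat" where
  "mdeg m = (\<Sum>v\<in>Poly_Mapping.keys m. Poly_Mapping.lookup m v)"

text \<open>The zero polynomial is homogeneous of every degree, and it is the only polynomial that is
  homogeneous of a negative degree.\<close>

definition homogeneous :: "int \<Rightarrow> ('v, 'k::comm_ring_1) mpoly \<Rightarrow> bool" where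
  "homogeneous d p \<longleftrightarrow> (\<forall>m\<in>Poly_Mapping.keys p. int (mdeg m) = d)"

lemma poly_ring_cring: "cring (poly_ring V :: ('v, 'k::comm_ring_1) mpoly ring)"
proof -
  let ?C = "{p :: ('v, 'k) mpoly. \<forall>m\<in>Poly_Mapping.keys p. Poly_Mapping.keys m \<subseteq> V}"
  have add: "p + q \<in> ?C" if "p \<in> ?C" "q \<in> ?C" for p q
    using that Poly_Mapping.keys_add[of p q] by blast
  have mult: "p * q \<in> ?C" if "p \<in> ?C" "q \<in> ?C" for p q
  proof (intro CollectI ballI)
    fix m assume "m \<in> Poly_Mapping.keys (p * q)"
    then obtain a b where ab: "a \<in> Poly_Mapping.keys p" "b \<in> Poly_Mapping.keys q" "m = a + b"
      using keys_mult[of p q] by blast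
    then have "Poly_Mapping.keys m \<subseteq> Poly_Mapping.keys a \<union> Poly_Mapping.keys b"
      using Poly_Mapping.keys_add[of a b] by simp
    with ab that show "Poly_Mapping.keys m \<subseteq> V" by blast
  qed
  have neg: "\<exists>q\<in>?C. q + p = 0" if "p \<in> ?C" for p
    using that by (intro bexI[of _ "- p"]) auto
  have zero: "0 \<in> ?C" and one: "1 \<in> ?C"
    by auto
  show ?thesis
    unfolding poly_ring_def
    by (rule cringI; (rule abelian_groupI comm_monoidI)?;
        simp only: ring.simps monoid.simps partial_object.simps)
      (assumption | rule add mult neg zero one add.assoc mult.assoc add.commute mult.commute
        distrib_right add_0_left mult_1_left)+
qed


section \<open>Simple graphs and edge ideals\<close>

definition simple_graph :: "'v set \<Rightarrow> 'v set set \<Rightarrow> bool" where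
  "simple_graph V E \<longleftrightarrow> finite V \<and> E \<subseteq> {e. e \<subseteq> V \<and> card e = 2}"

definition edge_ideal :: "'v set \<Rightarrow> 'v set set \<Rightarrow> ('v, 'k::comm_ring_1) mpoly set" where
  "edge_ideal V E = Idl\<^bsub>poly_ring V\<^esub> {Var x * Var y | x y. {x, y} \<in> E}"


section \<open>Depth\<close>

definition irrelevant_ideal :: "'v set \<Rightarrow> ('v, 'k::comm_ring_1) mpoly set" where
  "irrelevant_ideal V = Idl\<^bsub>poly_ring V\<^esub> (Var ` V)"

text \<open>Regular sequences on the \<open>S\<close>-module \<open>S/I\<close>, where \<open>S = k[V]\<close>: the submodule
  \<open>(f\<^sub>1, \<dots>, f\<^sub>i) (S/I)\<close> is the image of the ideal \<open>I + (f\<^sub>1, \<dots>, f\<^sub>i)\<close> of \<open>S\<close>.\<close>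

definition regular_sequence ::
    "'v set \<Rightarrow> ('v, 'k::comm_ring_1) mpoly set \<Rightarrow> ('v, 'k) mpoly list \<Rightarrow> bool" where
  "regular_sequence V I fs \<longleftrightarrow>
    set fs \<subseteq> carrier (poly_ring V) \<and>
    Idl\<^bsub>poly_ring V\<^esub> (I \<union> set fs) \<noteq> carrier (poly_ring V) \<and>
    (\<forall>i<length fs. \<forall>g\<in>carrier (poly_ring V).
      fs ! i * g \<in> Idl\<^bsub>poly_ring V\<^esub> (I \<union> set (take i fs)) \<longrightarrow>
      g \<in> Idl\<^bsub>poly_ring V\<^esub> (I \<union> set (take i fs)))"

text \<open>For finite \<open>V\<close> and a homogeneous ideal \<open>I \<noteq> S\<close>, the sets whose \<open>Max\<close> is taken here and in the
  definitions of Krull dimension and regularity below are finite and nonempty.\<close>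

definition depth_quot :: "'v set \<Rightarrow> ('v, 'k::field) mpoly set \<Rightarrow> nat" where
  "depth_quot V I =
    Max {length fs | fs. set fs \<subseteq> irrelevant_ideal V \<and> regular_sequence V I fs}"


section \<open>Krull dimension, Hilbert series and \<open>h\<close>-polynomial\<close>

definition krull_dim :: "('a, 'b) ring_scheme \<Rightarrow> nat" where
  "krull_dim R =
    Max {n. \<exists>P :: nat \<Rightarrow> 'a set. (\<forall>i\<le>n. primeideal (P i) R) \<and> (\<forall>i<n. P i \<subset> P (Suc i))}"

text \<open>The dimension over \<open>k\<close> of the degree \<open>j\<close> component of \<open>S/I\<close>; \<open>k\<close> and the component are
  represented by their images in the quotient ring.\<close>

definition hilbert_function :: "'v set \<Rightarrow> ('v, 'k::field) mpoly set \<Rightarrow> nat \<Rightarrow> nat" where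
  "hilbert_function V I j =
    ring.dim (poly_ring V Quot I)
      {I +>\<^bsub>poly_ring V\<^esub> Const c | c. True}
      {I +>\<^bsub>poly_ring V\<^esub> f | f. f \<in> carrier (poly_ring V) \<and> homogeneous (int j) f}"

definition hilbert_series :: "'v set \<Rightarrow> ('v, 'k::field) mpoly set \<Rightarrow> int fps" where
  "hilbert_series V I = Abs_fps (\<lambda>j. int (hilbert_function V I j))"

definition h_polynomial :: "'v set \<Rightarrow> ('v, 'k::field) mpoly set \<Rightarrow> int poly" where
  "h_polynomial V I =
    (THE h. fps_of_poly h = hilbert_series V I * (1 - fps_X) ^ krull_dim (poly_ring V Quot I))"


section \<open>Tor and regularity\<close>

definition poly_vecs :: "'v set \<Rightarrow> nat \<Rightarrow> ('v, 'k::comm_ring_1) mpoly vec set" where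
  "poly_vecs V n = {v \<in> carrier_vec n. \<forall>b<n. v $ b \<in> carrier (poly_ring V)}"

text \<open>Graded free resolutions \<open>\<dots> \<rightarrow> F\<^sub>1 \<rightarrow> F\<^sub>0 \<rightarrow> S/I \<rightarrow> 0\<close> with all \<open>F\<^sub>i\<close> of finite rank. The entries of
  the list \<open>ds i\<close> are the degrees of the basis elements of \<open>F\<^sub>i\<close>, that is,
  \<open>F\<^sub>i = \<Oplus>\<^sub>b S(-(ds i ! b))\<close>. The matrix \<open>D i\<close> is the differential from \<open>F\<^bsub>i+1\<^esub>\<close> to \<open>F\<^sub>i\<close>, and the entries of
  the vector \<open>e\<close> represent the images in \<open>S/I\<close> of the basis elements of \<open>F\<^sub>0\<close>. Maps preserve degrees.
  The resolution need not be minimal.\<close>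

definition graded_free_resolution ::
    "'v set \<Rightarrow> ('v, 'k::field) mpoly set \<Rightarrow> (nat \<Rightarrow> int list) \<Rightarrow> ('v, 'k) mpoly vec \<Rightarrow>
     (nat \<Rightarrow> ('v, 'k) mpoly mat) \<Rightarrow> bool" where
  "graded_free_resolution V I ds e D \<longleftrightarrow>
    e \<in> poly_vecs V (length (ds 0)) \<and>
    (\<forall>b<length (ds 0). homogeneous (ds 0 ! b) (e $ b)) \<and>
    (\<forall>i. D i \<in> carrier_mat (length (ds i)) (length (ds (Suc i))) \<and>
      (\<forall>a<length (ds i). \<forall>b<length (ds (Suc i)).
        D i $$ (a, b) \<in> carrier (poly_ring V) \<and>
        homogeneous (ds (Suc i) ! b - ds i ! a) (D i $$ (a, b)))) \<and>
    (\<forall>f\<in>carrier (poly_ring V). \<exists>v\<in>poly_vecs V (length (ds 0)). f - e \<bullet> v \<in> I) \<and>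
    (\<forall>v\<in>poly_vecs V (length (ds 0)).
      e \<bullet> v \<in> I \<longleftrightarrow> (\<exists>w\<in>poly_vecs V (length (ds 1)). v = D 0 *\<^sub>v w)) \<and>
    (\<forall>i. \<forall>v\<in>poly_vecs V (length (ds (Suc i))).
      D i *\<^sub>v v = 0\<^sub>v (length (ds i)) \<longleftrightarrow>
      (\<exists>w\<in>poly_vecs V (length (ds (Suc (Suc i)))). v = D (Suc i) *\<^sub>v w))"

text \<open>The complex \<open>F \<otimes>\<^sub>S k\<close> with \<open>k = S/(V)\<close> in degree 0: its \<open>i\<close>-th term is the \<open>k\<close>-space on the basis
  of \<open>F\<^sub>i\<close>, and its differentials are obtained by taking constant coefficients.\<close>

definition const_mat :: "('v, 'k::comm_ring_1) mpoly mat \<Rightarrow> 'k mat" where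
  "const_mat A = map_mat (\<lambda>p. Poly_Mapping.lookup p 0) A"

definition degree_part :: "int list \<Rightarrow> int \<Rightarrow> 'k::comm_ring_1 vec set" where
  "degree_part d j = {v \<in> carrier_vec (length d). \<forall>b<length d. v $ b \<noteq> 0 \<longrightarrow> d ! b = j}"

definition tensor_cycles ::
    "(nat \<Rightarrow> int list) \<Rightarrow> (nat \<Rightarrow> ('v, 'k::comm_ring_1) mpoly mat) \<Rightarrow> nat \<Rightarrow> int \<Rightarrow> 'k vec set" where
  "tensor_cycles ds D i j =
    {v \<in> degree_part (ds i) j.
      \<forall>l. i = Suc l \<longrightarrow> const_mat (D l) *\<^sub>v v = 0\<^sub>v (length (ds l))}"

definition tensor_boundaries ::
    "(nat \<Rightarrow> int list) \<Rightarrow> (nat \<Rightarrow> ('v, 'k::comm_ring_1) mpoly mat) \<Rightarrow> nat \<Rightarrow> int \<Rightarrow> 'k vec set" where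
  "tensor_boundaries ds D i j = (\<lambda>w. const_mat (D i) *\<^sub>v w) ` degree_part (ds (Suc i)) j"

text \<open>\<open>tor_nonzero V I i j\<close> says that the degree \<open>j\<close> component of \<open>Tor\<^sub>i(S/I, k)\<close>, the homology of
  \<open>F \<otimes>\<^sub>S k\<close>, is nonzero. Up to isomorphism this homology does not depend on the graded free
  resolution \<open>F\<close> of \<open>S/I\<close>.\<close>

definition tor_nonzero :: "'v set \<Rightarrow> ('v, 'k::field) mpoly set \<Rightarrow> nat \<Rightarrow> int \<Rightarrow> bool" where
  "tor_nonzero V I i j \<longleftrightarrow>
    (\<exists>ds e D. graded_free_resolution V I ds e D \<and>
      tensor_cycles ds D i j \<noteq> tensor_boundaries ds D i j)"

definition regularity :: "'v set \<Rightarrow> ('v, 'k::field) mpoly set \<Rightarrow> int" where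
  "regularity V I = Max {j. \<exists>i. tor_nonzero V I i (int i + j)}"

end

theory Submission
  imports Defs
begin

text \<open>Both graphs have a vertex \<open>x\<close> adjacent to every other non-isolated vertex, and \<open>\<delta> - 1\<close> isolated
  vertices \<open>Z\<close>. For (a), the neighbours of \<open>x\<close> span \<open>r\<close> disjoint edges; for (b), the graph is a star with
  \<open>s\<close> leaves.

  The depth is \<open>\<delta>\<close>: the variables in \<open>Z\<close> followed by the sum of the other variables form a regular
  sequence, since the sum of all variables lies in no minimal prime of a squarefree monomial ideal of positive
  dimension. Conversely, a regular sequence of length \<open>n\<close> in the irrelevant ideal makes the Koszul
  cohomology of \<open>S/I\<close> vanish below degree \<open>n\<close>, whereas \<open>x\<close> on the face \<open>{x} \<union> Z\<close> is a nonzero class in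
  degree \<open>\<delta>\<close>.

  The Taylor resolution has a generator of homological degree \<open>i\<close> and internal degree \<open>|\<Union>W|\<close> for every set
  \<open>W\<close> of \<open>i\<close> edges. As \<open>|\<Union>W| \<le> min (2 i) (2 r + 1)\<close>, the regularity is at most \<open>r\<close>, and the induced
  matching contributes to \<open>Tor\<^sub>r\<close> in degree \<open>2 r\<close>. That \<open>Tor\<close> does not depend on the resolution follows by
  comparing resolutions through chain maps and homotopies.

  For the star, counting standard monomials gives the Hilbert series
  \<open>1 / (1 - t)\<^bsup>s + \<delta> - 1\<^esup> + t / (1 - t)\<^bsup>\<delta>\<^esup>\<close>, and the Krull dimension is \<open>s + \<delta> - 1\<close>, so
  \<open>h(t) = 1 + t (1 - t)\<^bsup>s - 1\<^esup>\<close>.\<close>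

text \<open>Without its isolated vertices the graph has a disconnected independence complex, because
  x is a point by itself; this is why the depth is 1 there. An isolated vertex is a free variable:
  it raises the depth by one and changes neither the regularity nor the h-polynomial, so \<delta>
  can be prescribed independently of r and s. \<open>tor_nonzero\<close> accepts every graded free
  resolution as a witness. A lower bound on the regularity therefore needs a single resolution, but
  an upper bound has to speak about all of them, and this is what forces the comparison theorem. The
  Krull dimension is defined by chains of primes in the quotient. Its upper bound rests on a count:
  one polynomial more than there are variables gives an algebraic dependence, while a chain of
  primes that is too long would produce polynomials without one. As the edge ideal is nonzero, the
  zero ideal prolongs every chain pulled back to the polynomial ring, which turns
  \<open>card V\<close> into \<open>card V - 1\<close>. All coefficients that matter are signs, so
  the characteristic of the field never enters.\<close>

abbreviation keys where "keys \<equiv> Poly_Mapping.keys"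
abbreviation lookup where "lookup \<equiv> Poly_Mapping.lookup"
abbreviation single where "single \<equiv> Poly_Mapping.single"
abbreviation polys where "polys V \<equiv> carrier (poly_ring V)"
abbreviation coset where "coset V I \<equiv> a_r_coset (poly_ring V) I"

section \<open>The polynomial ring and its ideals\<close>

lemma poly_ring_simps [simp]:
  "\<zero>\<^bsub>poly_ring V\<^esub> = 0" "\<one>\<^bsub>poly_ring V\<^esub> = 1"
  "x \<oplus>\<^bsub>poly_ring V\<^esub> y = x + y" "x \<otimes>\<^bsub>poly_ring V\<^esub> y = x * y"
  by (simp_all add: poly_ring_def)

lemma carrier_poly_ring_iff:
  "p \<in> polys V \<longleftrightarrow> (\<forall>m\<in>keys p. keys m \<subseteq> V)"
  by (simp add: poly_ring_def)

lemma poly_ring_ring: "ring (poly_ring V)"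
  using poly_ring_cring cring.axioms(1) by blast

lemmas poly_ring_genideal_ideal = ring.genideal_ideal[OF poly_ring_ring]
lemmas poly_ring_genideal_self = ring.genideal_self[OF poly_ring_ring]
lemmas poly_ring_genideal_minimal = ring.genideal_minimal[OF poly_ring_ring]

lemma poly_ring_zero [simp]: "0 \<in> polys V"
  using ring.ring_simprules(2)[OF poly_ring_ring] by simp

lemma poly_ring_one [simp]: "1 \<in> polys V"
  using ring.ring_simprules(6)[OF poly_ring_ring] by simp

lemma poly_ring_add:
  "p \<in> polys V \<Longrightarrow> q \<in> polys V \<Longrightarrow> p + q \<in> polys V"
  using ring.ring_simprules(1)[OF poly_ring_ring, of p V q] by simp

lemma poly_ring_mult:
  "p \<in> polys V \<Longrightarrow> q \<in> polys V \<Longrightarrow> p * q \<in> polys V"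
  using ring.ring_simprules(5)[OF poly_ring_ring, of p V q] by simp

lemma poly_ring_uminus:
  "p \<in> polys V \<Longrightarrow> - p \<in> polys V"
  by (simp add: carrier_poly_ring_iff)

lemma poly_ring_diff:
  "p \<in> polys V \<Longrightarrow> q \<in> polys V \<Longrightarrow> p - q \<in> polys V"
  using poly_ring_add[of p V "- q"] poly_ring_uminus[of q V] by simp

lemma poly_ring_sum:
  "(\<And>i. i \<in> A \<Longrightarrow> f i \<in> polys V) \<Longrightarrow> sum f A \<in> polys V"
  by (induction A rule: infinite_finite_induct) (auto intro: poly_ring_add)

lemma poly_ring_neg_one_power: "(-1) ^ n \<in> polys V"
  by (cases "even n") (auto intro: poly_ring_uminus)

lemma poly_ring_single: "keys m \<subseteq> V \<Longrightarrow> single m c \<in> polys V"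
  by (cases "c = 0") (auto simp: carrier_poly_ring_iff)

lemma poly_ring_Var: "v \<in> V \<Longrightarrow> Var v \<in> polys V"
  unfolding Var_def by (rule poly_ring_single) auto

lemma poly_ring_Const: "Const c \<in> polys V"
  unfolding Const_def by (rule poly_ring_single) auto

lemmas poly_ring_closed =
  poly_ring_add poly_ring_mult poly_ring_zero poly_ring_one
  poly_ring_uminus poly_ring_diff poly_ring_sum poly_ring_neg_one_power poly_ring_Var poly_ring_Const

lemma ideal_poly_ringI:
  assumes "J \<subseteq> polys V" "0 \<in> J" "\<And>a b. a \<in> J \<Longrightarrow> b \<in> J \<Longrightarrow> a + b \<in> J"
    "\<And>a p. a \<in> J \<Longrightarrow> p \<in> polys V \<Longrightarrow> p * a \<in> J"
  shows "ideal J (poly_ring V)"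
proof (rule idealI)
  show "ring (poly_ring V)" using poly_ring_cring cring.axioms(1) by blast
  have neg: "- a \<in> J" if "a \<in> J" for a
    using assms(4)[OF that poly_ring_uminus[OF poly_ring_one]] by simp
  have inv: "inv\<^bsub>add_monoid (poly_ring V)\<^esub> a = - a" if "a \<in> J" for a
  proof -
    have "\<ominus>\<^bsub>poly_ring V\<^esub> a = - a"
      using that assms(1) by (intro abelian_group.minus_equality[OF ring.is_abelian_group[OF poly_ring_ring]]) (auto intro: poly_ring_closed)
    then show ?thesis by (simp add: a_inv_def)
  qed
  show "subgroup J (add_monoid (poly_ring V))"
    by (rule subgroup.intro) (use assms(1-3) inv neg in auto)
qed (use assms(4) in \<open>auto simp: mult.commute\<close>)

context
  fixes J and V :: "'v set" assumes J: "ideal J (poly_ring V)"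
begin

lemma ideal_subset: "J \<subseteq> polys V"
  using additive_subgroup.a_subset ideal_def J by blast

lemma ideal_zero: "0 \<in> J"
  using additive_subgroup.zero_closed[OF ideal.axioms(1)[OF J]] by simp

lemma ideal_add: "a \<in> J \<Longrightarrow> b \<in> J \<Longrightarrow> a + b \<in> J"
  using additive_subgroup.a_closed[OF ideal.axioms(1)[OF J], of a b] by simp

lemma ideal_mult: "a \<in> J \<Longrightarrow> p \<in> polys V \<Longrightarrow> p * a \<in> J"
  using ideal.I_l_closed[OF J, of a p] by simp

lemma ideal_uminus: "a \<in> J \<Longrightarrow> - a \<in> J"
  using ideal_mult[of a "- 1"] poly_ring_uminus[OF poly_ring_one, of V] by simp

lemma ideal_diff: "a \<in> J \<Longrightarrow> b \<in> J \<Longrightarrow> a - b \<in> J"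
  using ideal_add[of a "- b"] ideal_uminus by simp

lemma ideal_sum: "(\<And>i. i \<in> A \<Longrightarrow> f i \<in> J) \<Longrightarrow> sum f A \<in> J"
  by (induction A rule: infinite_finite_induct) (auto intro: ideal_zero ideal_add)

lemma Idl_insert_ideal:
  assumes f: "f \<in> polys V"
  shows "Idl\<^bsub>poly_ring V\<^esub> (insert f J) = {j + f * t | j t. j \<in> J \<and> t \<in> polys V}"
    (is "_ = ?R")
proof
  have "ideal ?R (poly_ring V)"
  proof (rule ideal_poly_ringI)
    show "?R \<subseteq> polys V" using ideal_subset f by (auto intro!: poly_ring_closed)
    show "0 \<in> ?R" by (rule CollectI, rule exI[of _ 0], rule exI[of _ 0])
        (auto simp: ideal_zero intro: poly_ring_closed)
    show "a + b \<in> ?R" if ab: "a \<in> ?R" "b \<in> ?R" for a b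
    proof -
      obtain j t j' t' where "a = j + f * t" "b = j' + f * t'" "j \<in> J" "j' \<in> J"
        "t \<in> polys V" "t' \<in> polys V" using ab by blast
      then show ?thesis
        by (intro CollectI exI[of _ "j + j'"] exI[of _ "t + t'"])
          (auto intro: ideal_add poly_ring_closed simp: algebra_simps)
    qed
    show "p * a \<in> ?R" if a: "a \<in> ?R" and p: "p \<in> polys V" for a p
    proof -
      obtain j t where "a = j + f * t" "j \<in> J" "t \<in> polys V" using a by blast
      then show ?thesis using p
        by (intro CollectI exI[of _ "p * j"] exI[of _ "p * t"])
          (auto intro: ideal_mult poly_ring_mult simp: distrib_left mult.left_commute)
    qed
  qed
  moreover have "insert f J \<subseteq> ?R"
  proof
    fix a assume "a \<in> insert f J"
    then show "a \<in> ?R"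
    proof
      assume "a = f" then show ?thesis
        by (intro CollectI exI[of _ 0] exI[of _ 1]) (auto intro: ideal_zero poly_ring_closed)
    next
      assume "a \<in> J" then show ?thesis
        by (intro CollectI exI[of _ a] exI[of _ 0]) (auto intro: ideal_zero poly_ring_closed)
    qed
  qed
  ultimately show "Idl\<^bsub>poly_ring V\<^esub> (insert f J) \<subseteq> ?R" by (rule poly_ring_genideal_minimal)
next
  have c: "insert f J \<subseteq> polys V" using f ideal_subset by auto
  have i: "ideal (Idl\<^bsub>poly_ring V\<^esub> (insert f J)) (poly_ring V)" by (rule poly_ring_genideal_ideal[OF c])
  have s: "insert f J \<subseteq> Idl\<^bsub>poly_ring V\<^esub> (insert f J)" by (rule poly_ring_genideal_self[OF c])
  show "?R \<subseteq> Idl\<^bsub>poly_ring V\<^esub> (insert f J)"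
  proof
    fix a assume "a \<in> ?R"
    then obtain j t where a: "a = j + f * t" "j \<in> J" "t \<in> polys V" by blast
    have "f * t \<in> Idl\<^bsub>poly_ring V\<^esub> (insert f J)"
      using ideal.I_r_closed[OF i, of f t] s a by simp
    moreover have "j \<in> Idl\<^bsub>poly_ring V\<^esub> (insert f J)" using s a by auto
    ultimately show "a \<in> Idl\<^bsub>poly_ring V\<^esub> (insert f J)"
      using additive_subgroup.a_closed[OF ideal.axioms(1)[OF i]] a by simp
  qed
qed

end

text \<open>Lets the successive quotients of a regular sequence be formed one element at a time, and
  lets an ideal be replaced by its monomial generators.\<close>

lemma Idl_Idl_Un:
  assumes "A \<subseteq> polys V" "B \<subseteq> polys V"
  shows "Idl\<^bsub>poly_ring V\<^esub> (Idl\<^bsub>poly_ring V\<^esub> A \<union> B) = Idl\<^bsub>poly_ring V\<^esub> (A \<union> B)"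
proof
  have AB: "A \<union> B \<subseteq> Idl\<^bsub>poly_ring V\<^esub> (A \<union> B)" using assms by (intro poly_ring_genideal_self) auto
  have i: "ideal (Idl\<^bsub>poly_ring V\<^esub> (A \<union> B)) (poly_ring V)"
    using assms by (intro poly_ring_genideal_ideal) auto
  show "Idl\<^bsub>poly_ring V\<^esub> (Idl\<^bsub>poly_ring V\<^esub> A \<union> B) \<subseteq> Idl\<^bsub>poly_ring V\<^esub> (A \<union> B)"
    using AB i by (intro poly_ring_genideal_minimal) (auto intro: poly_ring_genideal_minimal[THEN subsetD])
  have A: "ideal (Idl\<^bsub>poly_ring V\<^esub> A) (poly_ring V)" using assms by (intro poly_ring_genideal_ideal)
  have c: "Idl\<^bsub>poly_ring V\<^esub> A \<union> B \<subseteq> polys V" using assms ideal_subset[OF A] by auto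
  show "Idl\<^bsub>poly_ring V\<^esub> (A \<union> B) \<subseteq> Idl\<^bsub>poly_ring V\<^esub> (Idl\<^bsub>poly_ring V\<^esub> A \<union> B)"
    using poly_ring_genideal_self[OF c] poly_ring_genideal_self[OF assms(1)]
    by (intro poly_ring_genideal_minimal poly_ring_genideal_ideal c) auto
qed

lemma Idl_ideal:
  assumes "ideal J (poly_ring V)" shows "Idl\<^bsub>poly_ring V\<^esub> J = J"
  using poly_ring_genideal_minimal[OF assms, of J] poly_ring_genideal_self[OF ideal_subset[OF assms]] by auto

section \<open>Monomials\<close>

lemma keys_add_nat: "keys (a + b :: 'v \<Rightarrow>\<^sub>0 nat) = keys a \<union> keys b"
  by (auto simp: in_keys_iff lookup_add)

lemma mdeg_add: "mdeg (a + b) = mdeg a + mdeg b"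
  unfolding mdeg_def by (rule setsum_keys_plus_distrib) auto

lemma mdeg_zero [simp]: "mdeg 0 = 0"
  by (simp add: mdeg_def)

lemma mdeg_eq_0_iff: "mdeg m = 0 \<longleftrightarrow> m = 0"
  by (auto simp: mdeg_def in_keys_iff poly_mapping_eq_iff fun_eq_iff)

lemma mdeg_single [simp]: "mdeg (single v n) = n"
  by (simp add: mdeg_def)

lemma lookup_single_mult:
  fixes p :: "('v \<Rightarrow>\<^sub>0 nat) \<Rightarrow>\<^sub>0 'k::comm_ring_1"
  shows "lookup (single a c * p) (a + m) = c * lookup p m"
proof -
  have "lookup (single a c * p) (a + m) = (\<Sum>k. (c * (\<Sum>q. lookup p q when a + m = k + q)) when a = k)"
    by (simp only: lookup_mult lookup_single when_mult)
  also have "\<dots> = c * (\<Sum>q. lookup p q when m = q)"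
    by (simp only: Sum_any_when_equal' add_left_cancel)
  finally show ?thesis by (simp only: Sum_any_when_equal')
qed

lemma keys_single_mult:
  fixes p :: "('v \<Rightarrow>\<^sub>0 nat) \<Rightarrow>\<^sub>0 'k::comm_ring_1"
  assumes "k \<in> keys (single a c * p)" shows "\<exists>m\<in>keys p. k = a + m"
  using subsetD[OF keys_mult assms] by (auto split: if_splits)

text \<open>A sum of exponent vectors is 0 only if both summands are. Taking constant coefficients
  is thus multiplicative, which makes \<open>const_mat\<close>, the tensor product with k,
  compatible with composition.\<close>

lemma lookup_mult_0:
  fixes p q :: "('v \<Rightarrow>\<^sub>0 nat) \<Rightarrow>\<^sub>0 'k::comm_ring_1"
  shows "lookup (p * q) 0 = lookup p 0 * lookup q 0"
proof -
  have 0: "(0 = a + b) = (a = 0 \<and> b = 0)" for a b :: "'v \<Rightarrow>\<^sub>0 nat"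
    by (metis mdeg_add mdeg_eq_0_iff add_eq_0_iff_both_eq_0 add_0)
  have *: "(\<Sum>b. lookup q b when a = 0 \<and> b = 0) = (lookup q 0 when a = 0)" for a
    by (cases "a = 0") simp_all
  show ?thesis
    by (simp add: lookup_mult 0 * mult_when)
qed

lemma lookup_neg_one_power_mult:
  fixes p :: "('v \<Rightarrow>\<^sub>0 nat) \<Rightarrow>\<^sub>0 'k::comm_ring_1"
  shows "lookup ((-1) ^ n * p) m = (-1) ^ n * lookup p m"
  by (cases "even n") auto

definition sqf :: "'v set \<Rightarrow> 'v \<Rightarrow>\<^sub>0 nat" where
  "sqf U = (\<Sum>v\<in>U. single v 1)"

lemma lookup_sqf: "finite U \<Longrightarrow> lookup (sqf U) v = (if v \<in> U then 1 else 0)"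
  by (simp add: sqf_def lookup_sum lookup_single when_def)

lemma keys_sqf: "finite U \<Longrightarrow> keys (sqf U) = U"
  by (auto simp: in_keys_iff lookup_sqf split: if_splits)

lemma mdeg_sqf: "finite U \<Longrightarrow> mdeg (sqf U) = card U"
  by (simp add: mdeg_def keys_sqf lookup_sqf)

lemma sqf_Un_disjoint: "finite U \<Longrightarrow> finite W \<Longrightarrow> U \<inter> W = {} \<Longrightarrow> sqf (U \<union> W) = sqf U + sqf W"
  by (simp add: sqf_def sum.union_disjoint)

lemma sqf_add_diff: "finite U \<Longrightarrow> U \<subseteq> keys m \<Longrightarrow> sqf U + (m - sqf U) = m"
  by (rule poly_mapping_eqI) (auto simp: lookup_add lookup_minus lookup_sqf in_keys_iff)

lemma sqf_adds_iff: "finite U \<Longrightarrow> (\<exists>a. m = sqf U + a) \<longleftrightarrow> U \<subseteq> keys m"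
  by (metis keys_add_nat keys_sqf sqf_add_diff Un_upper1)

definition sqf_monom :: "'v set \<Rightarrow> ('v, 'k::comm_ring_1) mpoly" where
  "sqf_monom U = single (sqf U) 1"

lemma poly_ring_monom: "finite U \<Longrightarrow> U \<subseteq> V \<Longrightarrow> sqf_monom U \<in> polys V"
  unfolding sqf_monom_def by (intro poly_ring_single) (simp add: keys_sqf)

lemma Var_eq_monom: "Var v = sqf_monom {v}"
  by (simp add: Var_def sqf_monom_def sqf_def)

lemma monom_mult_disjoint:
  "finite U \<Longrightarrow> finite W \<Longrightarrow> U \<inter> W = {} \<Longrightarrow> sqf_monom U * sqf_monom W = sqf_monom (U \<union> W)"
  by (simp add: sqf_monom_def mult_single sqf_Un_disjoint)

section \<open>Squarefree monomial ideals\<close>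

text \<open>For squarefree generators, divisibility of a monomial depends only on its support.
  Membership thus becomes a condition on the single terms, and it is in this form that the ideal is
  used throughout; \<open>Idl_monoms\<close> ties it to the generated ideal.\<close>

definition sqf_ideal :: "'v set \<Rightarrow> 'v set set \<Rightarrow> ('v, 'k::comm_ring_1) mpoly set" where
  "sqf_ideal V E = {p \<in> polys V. \<forall>m\<in>keys p. \<exists>e\<in>E. e \<subseteq> keys m}"

lemma sqf_ideal_lookup:
  "p \<in> sqf_ideal V E \<Longrightarrow> lookup p m \<noteq> 0 \<Longrightarrow> \<exists>e\<in>E. e \<subseteq> keys m"
  by (simp add: sqf_ideal_def in_keys_iff)

lemma ideal_sqf_ideal: "ideal (sqf_ideal V E) (poly_ring V)"
proof (rule ideal_poly_ringI)
  show "sqf_ideal V E \<subseteq> polys V" unfolding sqf_ideal_def by (rule Collect_restrict)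
  show "0 \<in> sqf_ideal V E" by (simp add: sqf_ideal_def poly_ring_zero)
  show "a + b \<in> sqf_ideal V E" if "a \<in> sqf_ideal V E" "b \<in> sqf_ideal V E" for a b :: "('a, 'b) mpoly"
    using that subsetD[OF Poly_Mapping.keys_add[of a b]]
    unfolding sqf_ideal_def mem_Collect_eq by (metis Un_iff poly_ring_add)
  show "p * a \<in> sqf_ideal V E" if a: "a \<in> sqf_ideal V E" and p: "p \<in> polys V" for a p :: "('a, 'b) mpoly"
    unfolding sqf_ideal_def mem_Collect_eq
  proof (intro conjI ballI)
    show "p * a \<in> polys V"
      using a p unfolding sqf_ideal_def by (blast intro: poly_ring_mult)
    fix m assume "m \<in> keys (p * a)"
    then obtain u v where uv: "u \<in> keys p" "v \<in> keys a" "m = u + v" using keys_mult[of p a] by blast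
    then obtain e where "e \<in> E" "e \<subseteq> keys v" using a unfolding sqf_ideal_def by blast
    then show "\<exists>e\<in>E. e \<subseteq> keys m" using uv keys_add_nat[of u v] by blast
  qed
qed

lemma poly_mapping_sum_singles: "p = (\<Sum>m\<in>keys p. single m (lookup p m))"
proof (rule poly_mapping_eqI)
  fix k
  have "lookup (\<Sum>m\<in>keys p. single m (lookup p m)) k = (\<Sum>m\<in>keys p. if m = k then lookup p m else 0)"
    by (simp only: lookup_sum lookup_single when_def)
  then show "lookup p k = lookup (\<Sum>m\<in>keys p. single m (lookup p m)) k"
    by (cases "k \<in> keys p") (simp_all add: in_keys_iff)
qed

lemma monom_in_sqf_ideal:
  "finite e \<Longrightarrow> e \<subseteq> V \<Longrightarrow> f \<in> E \<Longrightarrow> f \<subseteq> e \<Longrightarrow> sqf_monom e \<in> sqf_ideal V E"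
  by (auto simp: sqf_ideal_def poly_ring_monom) (auto simp: sqf_monom_def keys_sqf)

text \<open>Each single term of a member is a multiple of a generator, so the member, being the sum
  of its terms, lies in the generated ideal.\<close>

lemma Idl_monoms:
  assumes "\<And>e. e \<in> E \<Longrightarrow> finite e \<and> e \<subseteq> V"
  shows "Idl\<^bsub>poly_ring V\<^esub> (sqf_monom ` E) = (sqf_ideal V E :: ('a, 'b::comm_ring_1) mpoly set)"
proof
  show "Idl\<^bsub>poly_ring V\<^esub> (sqf_monom ` E) \<subseteq> sqf_ideal V E"
    by (rule poly_ring_genideal_minimal[OF ideal_sqf_ideal]) (use assms in \<open>auto intro: monom_in_sqf_ideal\<close>)
  have c: "(sqf_monom ` E :: ('a,'b) mpoly set) \<subseteq> polys V" using assms by (auto intro: poly_ring_monom)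
  let ?I = "Idl\<^bsub>poly_ring V\<^esub> (sqf_monom ` E) :: ('a,'b) mpoly set"
  have I: "ideal ?I (poly_ring V)" using c by (rule poly_ring_genideal_ideal)
  show "sqf_ideal V E \<subseteq> ?I"
  proof
    fix p :: "('a,'b) mpoly" assume p: "p \<in> sqf_ideal V E"
    have "single m (lookup p m) \<in> ?I" if m: "m \<in> keys p" for m
    proof -
      obtain e where e: "e \<in> E" "e \<subseteq> keys m" using p m by (auto simp: sqf_ideal_def)
      have "keys m \<subseteq> V" using p m by (auto simp: sqf_ideal_def carrier_poly_ring_iff)
      moreover have "keys (m - sqf e) \<subseteq> keys m" by (auto simp: in_keys_iff lookup_minus)
      ultimately have "single (m - sqf e) (lookup p m) \<in> polys V" by (intro poly_ring_single) auto
      moreover have "sqf_monom e \<in> ?I" using poly_ring_genideal_self[OF c] e by auto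
      ultimately have "single (m - sqf e) (lookup p m) * sqf_monom e \<in> ?I" by (intro ideal_mult[OF I])
      then show ?thesis using sqf_add_diff[of e m] e assms by (simp add: sqf_monom_def mult_single add.commute)
    qed
    then have "(\<Sum>m\<in>keys p. single m (lookup p m)) \<in> ?I" by (rule ideal_sum[OF I])
    then show "p \<in> ?I" using poly_mapping_sum_singles[of p] by simp
  qed
qed

lemma edge_ideal_eq_sqf_ideal:
  assumes "simple_graph V E" shows "edge_ideal V E = sqf_ideal V E"
proof -
  have e: "finite e \<and> e \<subseteq> V \<and> card e = 2" if "e \<in> E" for e
    using that assms finite_subset unfolding simple_graph_def by blast
  have "{Var x * Var y | x y. {x, y} \<in> E} = (sqf_monom ` E :: ('a,'b) mpoly set)"
  proof safe
    fix x y assume xy: "{x, y} \<in> E"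
    \<comment> \<open>An edge has two elements, so no generator is the square of a variable.\<close>
    then have "x \<noteq> y" using e[of "{x, y}"] by auto
    then have "Var x * Var y = (sqf_monom {x, y} :: ('a,'b) mpoly)"
      by (simp add: Var_eq_monom monom_mult_disjoint insert_commute)
    then show "Var x * Var y \<in> (sqf_monom ` E :: ('a,'b) mpoly set)" using xy by auto
  next
    fix f assume f: "f \<in> E"
    then obtain x y where xy: "f = {x, y}" "x \<noteq> y" using e card_2_iff by metis
    then have "sqf_monom f = (Var x * Var y :: ('a,'b) mpoly)"
      by (simp add: Var_eq_monom monom_mult_disjoint insert_commute)
    then show "\<exists>x y. (sqf_monom f :: ('a,'b) mpoly) = Var x * Var y \<and> {x, y} \<in> E" using xy f by blast
  qed
  then show ?thesis using Idl_monoms[of E V] e by (simp add: edge_ideal_def)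
qed

lemma irrelevant_ideal_eq:
  "irrelevant_ideal V = (sqf_ideal V ((\<lambda>v. {v}) ` V) :: ('a, 'b::comm_ring_1) mpoly set)"
proof -
  have "(Var ` V :: ('a,'b) mpoly set) = sqf_monom ` (\<lambda>v. {v}) ` V" by (auto simp: Var_eq_monom)
  moreover have "Idl\<^bsub>poly_ring V\<^esub> (sqf_monom ` (\<lambda>v. {v}) ` V)
      = (sqf_ideal V ((\<lambda>v. {v}) ` V) :: ('a, 'b) mpoly set)"
    by (rule Idl_monoms) auto
  ultimately show ?thesis unfolding irrelevant_ideal_def by simp
qed

lemma irrelevant_ideal_iff:
  "p \<in> irrelevant_ideal V \<longleftrightarrow> p \<in> polys V \<and> lookup p 0 = 0"
proof -
  have "(\<exists>v\<in>V. v \<in> keys m) \<longleftrightarrow> m \<noteq> 0" if "keys m \<subseteq> V" for m :: "'a \<Rightarrow>\<^sub>0 nat"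
  proof -
    have "keys m = {} \<longleftrightarrow> m = 0" by (auto simp: in_keys_iff poly_mapping_eq_iff fun_eq_iff)
    then show ?thesis using that by blast
  qed
  then show ?thesis unfolding irrelevant_ideal_eq sqf_ideal_def carrier_poly_ring_iff
    by (auto simp del: Poly_Mapping.lookup_not_eq_zero_eq_in_keys simp: in_keys_iff) (metis in_keys_iff)
qed

text \<open>Dividing out variables stays within the class of squarefree monomial ideals: a variable
  is a generator with one-element support. The partial quotients by isolated vertices are treated
  this way.\<close>

lemma Idl_sqf_ideal_Un_Vars:
  assumes E: "\<And>e. e \<in> E \<Longrightarrow> finite e \<and> e \<subseteq> V" and Z: "Z \<subseteq> V"
  shows "Idl\<^bsub>poly_ring V\<^esub> (sqf_ideal V E \<union> Var ` Z)
    = (sqf_ideal V (E \<union> (\<lambda>z. {z}) ` Z) :: ('a, 'b::comm_ring_1) mpoly set)"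
proof -
  have c: "(sqf_monom ` E :: ('a, 'b) mpoly set) \<subseteq> polys V"
    "(Var ` Z :: ('a, 'b) mpoly set) \<subseteq> polys V"
    using assms by (blast intro: poly_ring_monom poly_ring_Var)+
  have "Idl\<^bsub>poly_ring V\<^esub> (sqf_monom ` E) = (sqf_ideal V E :: ('a, 'b) mpoly set)"
    by (rule Idl_monoms[OF E])
  then have "Idl\<^bsub>poly_ring V\<^esub> (sqf_ideal V E \<union> Var ` Z)
      = Idl\<^bsub>poly_ring V\<^esub> (sqf_monom ` E \<union> Var ` Z :: ('a, 'b) mpoly set)"
    using Idl_Idl_Un[OF c] by simp
  also have "sqf_monom ` E \<union> Var ` Z = sqf_monom ` (E \<union> (\<lambda>z. {z}) ` Z)"
    by (auto simp: Var_eq_monom)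
  also have "Idl\<^bsub>poly_ring V\<^esub> \<dots> = sqf_ideal V (E \<union> (\<lambda>z. {z}) ` Z)"
    by (rule Idl_monoms) (use assms in auto)
  finally show ?thesis .
qed

section \<open>Selecting terms of a polynomial\<close>

text \<open>One operation serves several purposes: homogeneous components, setting variables to
  zero, and discarding the terms that lie in a monomial ideal.\<close>

definition part :: "('a \<Rightarrow> bool) \<Rightarrow> ('a \<Rightarrow>\<^sub>0 'k::zero) \<Rightarrow> 'a \<Rightarrow>\<^sub>0 'k" where
  "part P p = Abs_poly_mapping (\<lambda>m. if P m then lookup p m else 0)"

lemma lookup_part: "lookup (part P p) m = (if P m then lookup p m else 0)"
proof -
  have "finite {m. (if P m then lookup p m else 0) \<noteq> 0}"
    by (rule finite_subset[OF _ finite_keys[of p]]) (auto simp: in_keys_iff split: if_splits)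
  then show ?thesis by (simp add: part_def)
qed

lemma keys_part: "keys (part P p) = {m \<in> keys p. P m}"
  by (auto simp: in_keys_iff lookup_part split: if_splits)

lemma part_add: "part P (p + q) = part P p + part P (q :: 'a \<Rightarrow>\<^sub>0 'k::comm_monoid_add)"
  by (rule poly_mapping_eqI) (simp add: lookup_part lookup_add)

lemma part_diff: "part P (p - q) = part P p - part P (q :: 'a \<Rightarrow>\<^sub>0 'k::ab_group_add)"
  by (rule poly_mapping_eqI) (simp add: lookup_part lookup_minus)

lemma part_zero [simp]: "part P 0 = 0"
  by (rule poly_mapping_eqI) (simp add: lookup_part)

lemma part_sum: "part P (\<Sum>i\<in>A. f i) = (\<Sum>i\<in>A. part P (f i :: 'a \<Rightarrow>\<^sub>0 'k::comm_monoid_add))"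
  by (induction A rule: infinite_finite_induct) (auto simp: part_add)

lemma poly_ring_part: "p \<in> polys V \<Longrightarrow> part P p \<in> polys V"
  by (auto simp: carrier_poly_ring_iff keys_part)

lemma part_eq_self: "(\<And>m. m \<in> keys p \<Longrightarrow> P m) \<Longrightarrow> part P p = p"
  by (rule poly_mapping_eqI) (auto simp: lookup_part in_keys_iff)

lemma part_eq_0: "(\<And>m. m \<in> keys p \<Longrightarrow> \<not> P m) \<Longrightarrow> part P p = 0"
  by (rule poly_mapping_eqI) (auto simp: lookup_part in_keys_iff)

section \<open>Signs of the Koszul and Taylor differentials\<close>

definition ksign :: "nat \<Rightarrow> nat set \<Rightarrow> 'k::comm_ring_1" where
  "ksign g \<sigma> = (- 1) ^ card {h \<in> \<sigma>. h < g}"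

lemma ksign_square [simp]: "ksign g \<sigma> * ksign g \<sigma> = 1" "ksign g \<sigma> * (ksign g \<sigma> * x) = x"
  unfolding ksign_def by (simp_all add: power_mult_distrib[symmetric] mult.assoc[symmetric])

text \<open>Inserting the smaller element moves the position of the larger one by one, while
  inserting the larger leaves the position of the smaller unchanged. Exactly one of the two orders
  picks up a sign.\<close>

lemma ksign_swap:
  assumes "finite \<sigma>" "g \<noteq> h" "g \<notin> \<sigma>" "h \<notin> \<sigma>"
  shows "ksign g \<sigma> * ksign h (insert g \<sigma>) = - (ksign h \<sigma> * ksign g (insert h \<sigma>))"
proof -
  have *: "ksign g \<sigma> * ksign h (insert g \<sigma>) = - (ksign h \<sigma> * ksign g (insert h \<sigma>) :: 'a)"
    if "g < h" "g \<notin> \<sigma>" "h \<notin> \<sigma>" for g h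
  proof -
    have "{u \<in> insert g \<sigma>. u < h} = insert g {u \<in> \<sigma>. u < h}" "{u \<in> insert h \<sigma>. u < g} = {u \<in> \<sigma>. u < g}"
      using that by auto
    then show ?thesis using assms(1) that by (simp add: ksign_def)
  qed
  show ?thesis using *[of g h] *[of h g] assms by (cases "g < h") (simp_all add: algebra_simps)
qed

lemma ksign_swap':
  assumes "finite \<sigma>" "g \<noteq> h" "g \<notin> \<sigma>" "h \<notin> \<sigma>"
  shows "ksign h (insert g \<sigma>) * ksign g (insert h \<sigma>) = - (ksign g \<sigma> * ksign h \<sigma> :: 'k::comm_ring_1)"
proof -
  have "ksign h (insert g \<sigma>) * ksign g (insert h \<sigma>)
      = ksign g \<sigma> * (ksign g \<sigma> * ksign h (insert g \<sigma>)) * ksign g (insert h \<sigma> :: nat set)"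
    by simp
  also have "\<dots> = - (ksign g \<sigma> * ksign h \<sigma> * (ksign g (insert h \<sigma>) * ksign g (insert h \<sigma>)) :: 'k)"
    unfolding ksign_swap[OF assms] by (simp only: minus_mult_left[symmetric] minus_mult_right[symmetric] ac_simps)
  finally show ?thesis by simp
qed

lemma poly_ring_ksign: "ksign g \<sigma> \<in> polys V"
  unfolding ksign_def by (rule poly_ring_neg_one_power)

section \<open>Koszul cochains and an upper bound for the depth\<close>

text \<open>The Koszul cochain differential of the sequence of variables. A cochain is a function on
  all sets at once; its degree enters only where a statement restricts
  \<open>card \<sigma>\<close>.\<close>

definition kdiff :: "(nat set \<Rightarrow> (nat, 'k::comm_ring_1) mpoly) \<Rightarrow> nat set \<Rightarrow> (nat, 'k) mpoly" where
  "kdiff z \<sigma> = (\<Sum>v\<in>\<sigma>. ksign v (\<sigma> - {v}) * Var v * z (\<sigma> - {v}))"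

definition kcontr :: "nat \<Rightarrow> (nat set \<Rightarrow> (nat, 'k::comm_ring_1) mpoly) \<Rightarrow> nat set \<Rightarrow> (nat, 'k) mpoly" where
  "kcontr v z \<tau> = (if v \<in> \<tau> then 0 else ksign v \<tau> * z (insert v \<tau>))"

text \<open>The terms at (u, v) and (v, u) cancel. The diagonal is left out of the sum because
  antisymmetry does not force it to vanish in characteristic 2.\<close>

lemma sum_antisym_eq_0:
  fixes f :: "'a \<Rightarrow> 'a \<Rightarrow> 'b::ab_group_add"
  assumes "finite A" "\<And>u v. u \<in> A \<Longrightarrow> v \<in> A \<Longrightarrow> u \<noteq> v \<Longrightarrow> f u v = - f v u"
  shows "(\<Sum>v\<in>A. \<Sum>u\<in>A - {v}. f v u) = 0"
  using assms
proof (induction A rule: finite_induct)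
  case (insert x A)
  have "(\<Sum>v\<in>A. \<Sum>u\<in>insert x A - {v}. f v u) = (\<Sum>v\<in>A. f v x + (\<Sum>u\<in>A - {v}. f v u))"
  proof (rule sum.cong[OF refl])
    fix v assume "v \<in> A"
    then have "insert x A - {v} = insert x (A - {v})" using insert.hyps by auto
    then show "(\<Sum>u\<in>insert x A - {v}. f v u) = f v x + (\<Sum>u\<in>A - {v}. f v u)"
      using insert.hyps by simp
  qed
  also have "\<dots> = (\<Sum>v\<in>A. f v x)"
  proof -
    have "(\<Sum>v\<in>A. \<Sum>u\<in>A - {v}. f v u) = 0"
      by (rule insert.IH) (use insert.prems in blast)
    then show ?thesis by (simp add: sum.distrib)
  qed
  also have "\<dots> = (\<Sum>v\<in>A. - f x v)"
    by (rule sum.cong[OF refl], rule insert.prems) (use insert.hyps in auto)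
  finally show ?case using insert.hyps by (simp add: sum_negf insert_Diff_if)
qed simp

lemma kdiff_kdiff:
  assumes "finite \<sigma>" shows "kdiff (kdiff z) \<sigma> = 0"
proof -
  define f where "f = (\<lambda>v u. ksign v (\<sigma> - {v}) * Var v * (ksign u (\<sigma> - {v} - {u}) * Var u * z (\<sigma> - {v} - {u})))"
  have "f u v = - f v u" if "u \<in> \<sigma>" "v \<in> \<sigma>" "u \<noteq> v" for u v
  proof -
    define \<rho> where "\<rho> = \<sigma> - {u} - {v}"
    have eq: "\<sigma> - {v} = insert u \<rho>" "\<sigma> - {u} = insert v \<rho>"
      "insert u \<rho> - {u} = \<rho>" "insert v \<rho> - {v} = \<rho>" using that by (auto simp: \<rho>_def)
    have s: "ksign v \<rho> * ksign u (insert v \<rho>) = - (ksign u \<rho> * ksign v (insert u \<rho>))"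
      using that assms by (intro ksign_swap) (auto simp: \<rho>_def)
    have "f u v = (ksign v \<rho> * ksign u (insert v \<rho>)) * (Var u * Var v * z \<rho>)"
      unfolding f_def eq by (simp only: ac_simps)
    also have "\<dots> = - ((ksign u \<rho> * ksign v (insert u \<rho>)) * (Var u * Var v * z \<rho>))"
      unfolding s by simp
    also have "\<dots> = - f v u"
      unfolding f_def eq by (simp only: ac_simps)
    finally show ?thesis .
  qed
  then have "(\<Sum>v\<in>\<sigma>. \<Sum>u\<in>\<sigma> - {v}. f v u) = 0" by (intro sum_antisym_eq_0 assms)
  then show ?thesis by (simp add: kdiff_def f_def sum_distrib_left)
qed

text \<open>The contraction by v is a homotopy between multiplication by \<open>Var v\<close> and
  zero. For v in \<sigma> only the summand at v of the first term survives; otherwise the second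
  term contributes \<open>Var v * z \<sigma>\<close>, and its remaining summands cancel the first
  term.\<close>

lemma kdiff_homotopy:
  assumes "finite \<sigma>"
  shows "kdiff (kcontr v z) \<sigma> + kcontr v (kdiff z) \<sigma> = Var v * z \<sigma>"
proof (cases "v \<in> \<sigma>")
  case True
  have "kdiff (kcontr v z) \<sigma> = (\<Sum>u\<in>\<sigma>. if u = v then Var v * z \<sigma> else 0)"
    unfolding kdiff_def
  proof (rule sum.cong[OF refl])
    fix u assume "u \<in> \<sigma>"
    have "insert v (\<sigma> - {v}) = \<sigma>" using True by auto
    then show "ksign u (\<sigma> - {u}) * Var u * kcontr v z (\<sigma> - {u}) = (if u = v then Var v * z \<sigma> else 0)"
      using True by (auto simp: kcontr_def mult.left_commute mult.assoc)
  qed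
  then show ?thesis using True assms by (simp add: kcontr_def)
next
  case False
  have "kcontr v (kdiff z) \<sigma> = ksign v \<sigma> * (\<Sum>u\<in>insert v \<sigma>. ksign u (insert v \<sigma> - {u}) * Var u * z (insert v \<sigma> - {u}))"
    using False by (simp add: kcontr_def kdiff_def)
  also have "\<dots> = Var v * z \<sigma> + (\<Sum>u\<in>\<sigma>. ksign v \<sigma> * (ksign u (insert v \<sigma> - {u}) * Var u * z (insert v \<sigma> - {u})))"
    using False assms by (simp add: distrib_left sum_distrib_left mult.assoc)
  also have "(\<Sum>u\<in>\<sigma>. ksign v \<sigma> * (ksign u (insert v \<sigma> - {u}) * Var u * z (insert v \<sigma> - {u})))
      = - kdiff (kcontr v z) \<sigma>"
    unfolding kdiff_def sum_negf[symmetric]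
  proof (rule sum.cong[OF refl])
    fix u assume u: "u \<in> \<sigma>"
    let ?\<rho> = "\<sigma> - {u}"
    have eq: "insert v \<sigma> - {u} = insert v ?\<rho>" using u False by auto
    have "ksign v (insert u ?\<rho>) * ksign u (insert v ?\<rho>) = - (ksign u ?\<rho> * ksign v ?\<rho> :: (nat, 'a) mpoly)"
      using u False assms by (intro ksign_swap') auto
    then have "ksign v \<sigma> * ksign u (insert v ?\<rho>) = - (ksign v ?\<rho> * ksign u ?\<rho> :: (nat, 'a) mpoly)"
      using u by (simp add: insert_absorb mult.commute)
    then have "ksign v \<sigma> * ksign u (insert v ?\<rho>) * (Var u * z (insert v ?\<rho>))
        = - (ksign v ?\<rho> * ksign u ?\<rho>) * (Var u * z (insert v ?\<rho>))" by simp
    then show "ksign v \<sigma> * (ksign u (insert v \<sigma> - {u}) * Var u * z (insert v \<sigma> - {u})) =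
        - (ksign u (\<sigma> - {u}) * Var u * kcontr v z (\<sigma> - {u}))"
      using False by (simp add: eq kcontr_def mult.assoc mult.left_commute)
  qed
  finally show ?thesis by simp
qed

lemma kdiff_lincomb:
  "kdiff (\<lambda>\<tau>. \<Sum>v\<in>A. g v * h v \<tau>) \<sigma> = (\<Sum>v\<in>A. g v * kdiff (h v) \<sigma>)"
proof -
  have "kdiff (\<lambda>\<tau>. \<Sum>v\<in>A. g v * h v \<tau>) \<sigma>
      = (\<Sum>u\<in>\<sigma>. \<Sum>v\<in>A. g v * (ksign u (\<sigma> - {u}) * Var u * h v (\<sigma> - {u})))"
    unfolding kdiff_def by (simp only: sum_distrib_left mult.left_commute)
  also have "\<dots> = (\<Sum>v\<in>A. \<Sum>u\<in>\<sigma>. g v * (ksign u (\<sigma> - {u}) * Var u * h v (\<sigma> - {u})))"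
    by (rule sum.swap)
  finally show ?thesis unfolding kdiff_def by (simp only: sum_distrib_left)
qed

lemma kdiff_diff: "kdiff (\<lambda>\<tau>. a \<tau> - b \<tau>) \<sigma> = kdiff a \<sigma> - kdiff b \<sigma>"
  by (simp add: kdiff_def right_diff_distrib sum_subtractf)

lemma kdiff_mult: "kdiff (\<lambda>\<tau>. f * a \<tau>) \<sigma> = f * kdiff a \<sigma>"
  unfolding kdiff_def by (simp only: sum_distrib_left mult.left_commute)

lemma kdiff_closed:
  assumes "\<sigma> \<subseteq> V" "\<And>\<tau>. z \<tau> \<in> polys V"
  shows "kdiff z \<sigma> \<in> polys V"
  unfolding kdiff_def
  by (intro poly_ring_sum poly_ring_mult poly_ring_ksign poly_ring_Var assms(2)) (use assms(1) in auto)

lemma kdiff_ideal: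
  assumes J: "ideal J (poly_ring V)" and \<sigma>: "\<sigma> \<subseteq> V"
    and z: "\<And>v. v \<in> \<sigma> \<Longrightarrow> z (\<sigma> - {v}) \<in> J"
  shows "kdiff z \<sigma> \<in> J"
  unfolding kdiff_def
  by (intro ideal_sum[OF J] ideal_mult[OF J] poly_ring_mult poly_ring_ksign poly_ring_Var z) (use \<sigma> in auto)

lemma irrelevant_ideal_lincomb:
  assumes "finite V" "f \<in> irrelevant_ideal V"
  shows "\<exists>g. (\<forall>v. g v \<in> polys V) \<and> f = (\<Sum>v\<in>V. g v * Var v)"
proof -
  let ?R = "{\<Sum>v\<in>V. g v * Var v | g. \<forall>v. g v \<in> polys V}"
  have "ideal ?R (poly_ring V)"
  proof (rule ideal_poly_ringI)
    show "?R \<subseteq> polys V" by (auto intro!: poly_ring_closed)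
    show "0 \<in> ?R" by (rule CollectI, rule exI[of _ "\<lambda>_. 0"]) (auto intro: poly_ring_closed)
    show "a + b \<in> ?R" if ab: "a \<in> ?R" "b \<in> ?R" for a b
    proof -
      obtain g h where "a = (\<Sum>v\<in>V. g v * Var v)" "b = (\<Sum>v\<in>V. h v * Var v)"
        "\<forall>v. g v \<in> polys V" "\<forall>v. h v \<in> polys V" using ab by blast
      then show ?thesis
        by (intro CollectI exI[of _ "\<lambda>v. g v + h v"]) (auto simp: distrib_right sum.distrib intro: poly_ring_closed)
    qed
    show "p * a \<in> ?R" if a: "a \<in> ?R" and p: "p \<in> polys V" for a p
    proof -
      obtain g where "a = (\<Sum>v\<in>V. g v * Var v)" "\<forall>v. g v \<in> polys V" using a by blast
      then show ?thesis using p
        by (intro CollectI exI[of _ "\<lambda>v. p * g v"]) (auto simp: sum_distrib_left mult.assoc intro: poly_ring_closed)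
    qed
  qed
  moreover have "Var ` V \<subseteq> ?R"
  proof
    fix a assume "a \<in> Var ` V"
    then obtain u where u: "u \<in> V" "a = Var u" by auto
    then have "a = (\<Sum>v\<in>V. (if v = u then 1 else 0) * Var v)"
      using assms(1) by (simp add: if_distrib[of "\<lambda>x. x * _"] cong: if_cong)
    then show "a \<in> ?R"
      by (intro CollectI exI[of _ "\<lambda>v. if v = u then 1 else 0"]) (auto intro: poly_ring_closed)
  qed
  ultimately have "irrelevant_ideal V \<subseteq> ?R" unfolding irrelevant_ideal_def by (rule poly_ring_genideal_minimal)
  then have "f \<in> ?R" using assms(2) by (rule subsetD)
  then show ?thesis by blast
qed

text \<open>Vanishing of the \<open>i\<close>-th Koszul cohomology of \<open>S/J\<close> with respect to all variables.\<close>

definition koszul_vanishes :: "nat set \<Rightarrow> nat \<Rightarrow> (nat, 'k::comm_ring_1) mpoly set \<Rightarrow> bool" where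
  "koszul_vanishes V i J \<longleftrightarrow>
    (\<forall>z. (\<forall>\<sigma>. z \<sigma> \<in> polys V) \<longrightarrow> (\<forall>\<sigma>\<subseteq>V. card \<sigma> = Suc i \<longrightarrow> kdiff z \<sigma> \<in> J) \<longrightarrow>
      (\<exists>w. (\<forall>\<sigma>. w \<sigma> \<in> polys V) \<and> (\<forall>\<sigma>\<subseteq>V. card \<sigma> = i \<longrightarrow> z \<sigma> - kdiff w \<sigma> \<in> J)))"

lemma kcontr_closed:
  "(\<And>\<tau>. z \<tau> \<in> polys V) \<Longrightarrow> kcontr v z \<tau> \<in> polys V"
  by (simp add: kcontr_def poly_ring_mult poly_ring_ksign poly_ring_zero)

text \<open>The irrelevant ideal annihilates Koszul cohomology: if f is a combination of the
  variables, the same combination of the contractions is a primitive of f times the cocycle.\<close>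

lemma irrelevant_times_cocycle:
  assumes V: "finite V" and J: "ideal J (poly_ring V)" and f: "f \<in> irrelevant_ideal V"
    and z: "\<And>\<sigma>. z \<sigma> \<in> polys V"
    and cocycle: "\<And>\<sigma>. \<sigma> \<subseteq> V \<Longrightarrow> card \<sigma> = Suc i \<Longrightarrow> kdiff z \<sigma> \<in> J"
  obtains w where "\<And>\<sigma>. w \<sigma> \<in> polys V"
    "\<And>\<sigma>. \<sigma> \<subseteq> V \<Longrightarrow> card \<sigma> = i \<Longrightarrow> f * z \<sigma> - kdiff w \<sigma> \<in> J"
proof -
  obtain g where g: "\<And>v. g v \<in> polys V" "f = (\<Sum>v\<in>V. g v * Var v)"
    using irrelevant_ideal_lincomb[OF V f] by blast
  define w where "w = (\<lambda>\<tau>. \<Sum>v\<in>V. g v * kcontr v z \<tau>)"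
  have "w \<sigma> \<in> polys V" for \<sigma>
    unfolding w_def using g z by (intro poly_ring_sum poly_ring_mult kcontr_closed)
  moreover have "f * z \<sigma> - kdiff w \<sigma> \<in> J" if \<sigma>: "\<sigma> \<subseteq> V" "card \<sigma> = i" for \<sigma>
  proof -
    have fin: "finite \<sigma>" using \<sigma> V finite_subset by blast
    have eq: "Var v * z \<sigma> - kdiff (kcontr v z) \<sigma> = kcontr v (kdiff z) \<sigma>" for v
      using kdiff_homotopy[OF fin, of v z] by (metis add_diff_cancel_left')
    have "f * z \<sigma> - kdiff w \<sigma> = (\<Sum>v\<in>V. g v * (Var v * z \<sigma> - kdiff (kcontr v z) \<sigma>))"
      unfolding w_def kdiff_lincomb g(2)
      by (simp add: sum_distrib_right right_diff_distrib sum_subtractf mult.assoc)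
    also have "\<dots> \<in> J"
      unfolding eq
    proof (intro ideal_sum[OF J] ideal_mult[OF J] g)
      fix v assume "v \<in> V"
      show "kcontr v (kdiff z) \<sigma> \<in> J"
      proof (cases "v \<in> \<sigma>")
        case False
        then have "kdiff z (insert v \<sigma>) \<in> J" using \<sigma> fin \<open>v \<in> V\<close> by (intro cocycle) auto
        then show ?thesis using False by (simp add: kcontr_def ideal_mult[OF J] poly_ring_ksign)
      qed (simp add: kcontr_def ideal_zero[OF J])
    qed
    finally show ?thesis .
  qed
  ultimately show ?thesis by (rule that)
qed

text \<open>There are no coboundaries in degree 0, as \<open>kdiff w {}\<close> is an empty sum. So
  f times the value at the empty face already lies in J, and f can be cancelled.\<close>

lemma koszul_vanishes_0:
  assumes "finite V" "ideal J (poly_ring V)" "f \<in> irrelevant_ideal V"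
    and reg: "\<And>g. g \<in> polys V \<Longrightarrow> f * g \<in> J \<Longrightarrow> g \<in> J"
  shows "koszul_vanishes V 0 J"
  unfolding koszul_vanishes_def
proof (intro allI impI)
  fix z assume z: "\<forall>\<sigma>. z \<sigma> \<in> polys V"
    and c: "\<forall>\<sigma>\<subseteq>V. card \<sigma> = Suc 0 \<longrightarrow> kdiff z \<sigma> \<in> J"
  obtain w where "\<And>\<sigma>. \<sigma> \<subseteq> V \<Longrightarrow> card \<sigma> = 0 \<Longrightarrow> f * z \<sigma> - kdiff w \<sigma> \<in> J"
    by (rule irrelevant_times_cocycle[OF assms(1-3), of z 0]) (use z c in blast)+
  from this[of "{}"] have "f * z {} \<in> J" by (simp add: kdiff_def)
  then have z0: "z {} \<in> J" using z reg[of "z {}"] by blast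
  have "z \<sigma> - kdiff (\<lambda>_. 0) \<sigma> \<in> J" if "\<sigma> \<subseteq> V" "card \<sigma> = 0" for \<sigma>
  proof -
    have "\<sigma> = {}" using that assms(1) finite_subset[of \<sigma> V] card_0_eq by blast
    then show ?thesis using z0 by (simp add: kdiff_def)
  qed
  then show "\<exists>w. (\<forall>\<sigma>. w \<sigma> \<in> polys V) \<and> (\<forall>\<sigma>\<subseteq>V. card \<sigma> = 0 \<longrightarrow> z \<sigma> - kdiff w \<sigma> \<in> J)"
    by (intro exI[of _ "\<lambda>_. 0"] conjI allI impI poly_ring_zero)
qed

text \<open>The long exact sequence of multiplication by f on S/J, made explicit. Modulo J, f z is
  the differential of some w; then w is a cocycle modulo J and f, so w = d u + f t modulo J.
  Applying the differential gives f z = f d t modulo J, and f cancels, leaving t as a primitive of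
  z.\<close>

lemma koszul_vanishes_Suc:
  assumes V: "finite V" and J: "ideal J (poly_ring V)" and f: "f \<in> irrelevant_ideal V"
    and reg: "\<And>g. g \<in> polys V \<Longrightarrow> f * g \<in> J \<Longrightarrow> g \<in> J"
    and van: "koszul_vanishes V i (Idl\<^bsub>poly_ring V\<^esub> (insert f J))"
  shows "koszul_vanishes V (Suc i) J"
  unfolding koszul_vanishes_def
proof (intro allI impI)
  fix z assume z: "\<forall>\<sigma>. z \<sigma> \<in> polys V"
    and c: "\<forall>\<sigma>\<subseteq>V. card \<sigma> = Suc (Suc i) \<longrightarrow> kdiff z \<sigma> \<in> J"
  have fc: "f \<in> polys V" using f by (simp add: irrelevant_ideal_iff)
  obtain w where w: "\<And>\<sigma>. w \<sigma> \<in> polys V"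
    "\<And>\<sigma>. \<sigma> \<subseteq> V \<Longrightarrow> card \<sigma> = Suc i \<Longrightarrow> f * z \<sigma> - kdiff w \<sigma> \<in> J"
    by (rule irrelevant_times_cocycle[OF V J f, of z "Suc i"]) (use z c in blast)+
  have J': "Idl\<^bsub>poly_ring V\<^esub> (insert f J) = {j + f * t | j t. j \<in> J \<and> t \<in> polys V}"
    by (rule Idl_insert_ideal[OF J fc])
  have "kdiff w \<sigma> \<in> Idl\<^bsub>poly_ring V\<^esub> (insert f J)" if "\<sigma> \<subseteq> V" "card \<sigma> = Suc i" for \<sigma>
  proof -
    have "kdiff w \<sigma> = - (f * z \<sigma> - kdiff w \<sigma>) + f * z \<sigma>" by simp
    then show ?thesis unfolding J' using w(2)[OF that] ideal_uminus[OF J] z by blast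
  qed
  then obtain u where u: "\<forall>\<sigma>. u \<sigma> \<in> polys V"
    "\<forall>\<sigma>\<subseteq>V. card \<sigma> = i \<longrightarrow> w \<sigma> - kdiff u \<sigma> \<in> Idl\<^bsub>poly_ring V\<^esub> (insert f J)"
    using van w(1) unfolding koszul_vanishes_def by metis
  have "\<exists>t \<in> polys V. \<sigma> \<subseteq> V \<longrightarrow> card \<sigma> = i \<longrightarrow> w \<sigma> - kdiff u \<sigma> - f * t \<in> J" for \<sigma>
  proof (cases "\<sigma> \<subseteq> V \<and> card \<sigma> = i")
    case True
    then obtain j t where "w \<sigma> - kdiff u \<sigma> = j + f * t" "j \<in> J" "t \<in> polys V"
      using u(2) unfolding J' by blast
    then show ?thesis by (intro bexI[of _ t]) auto
  qed (auto intro: poly_ring_zero)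
  then obtain t where t: "\<And>\<sigma>. t \<sigma> \<in> polys V"
    "\<And>\<sigma>. \<sigma> \<subseteq> V \<Longrightarrow> card \<sigma> = i \<Longrightarrow> w \<sigma> - kdiff u \<sigma> - f * t \<sigma> \<in> J" by metis
  have "z \<sigma> - kdiff t \<sigma> \<in> J" if \<sigma>: "\<sigma> \<subseteq> V" "card \<sigma> = Suc i" for \<sigma>
  proof (rule reg)
    have fin: "finite \<sigma>" using \<sigma> V finite_subset by blast
    show "z \<sigma> - kdiff t \<sigma> \<in> polys V"
      using z t \<sigma> by (intro poly_ring_diff kdiff_closed) auto
    have "kdiff (\<lambda>\<tau>. w \<tau> - kdiff u \<tau> - f * t \<tau>) \<sigma> \<in> J"
    proof (rule kdiff_ideal[OF J \<sigma>(1)])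
      fix v assume "v \<in> \<sigma>"
      then show "w (\<sigma> - {v}) - kdiff u (\<sigma> - {v}) - f * t (\<sigma> - {v}) \<in> J"
        using \<sigma> fin by (intro t(2)) auto
    qed
    then have "kdiff w \<sigma> - f * kdiff t \<sigma> \<in> J"
      by (simp add: kdiff_diff kdiff_mult kdiff_kdiff[OF fin])
    from ideal_add[OF J w(2)[OF \<sigma>] this] show "f * (z \<sigma> - kdiff t \<sigma>) \<in> J"
      by (simp add: right_diff_distrib)
  qed
  then show "\<exists>w. (\<forall>\<sigma>. w \<sigma> \<in> polys V) \<and> (\<forall>\<sigma>\<subseteq>V. card \<sigma> = Suc i \<longrightarrow> z \<sigma> - kdiff w \<sigma> \<in> J)"
    by (intro exI[of _ t] conjI allI impI t(1))
qed

text \<open>Vanishing in degree m consumes m + 1 elements of the sequence. The starting point k is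
  kept general because each step enlarges the ideal by the next element.\<close>

lemma regular_sequence_koszul_vanishes:
  assumes V: "finite V" and I: "ideal I (poly_ring V)" and fs: "set fs \<subseteq> irrelevant_ideal V"
    and reg: "regular_sequence V I fs"
  shows "k + Suc m \<le> length fs \<Longrightarrow> koszul_vanishes V m (Idl\<^bsub>poly_ring V\<^esub> (I \<union> set (take k fs)))"
proof (induction m arbitrary: k)
  let ?J = "\<lambda>k. Idl\<^bsub>poly_ring V\<^esub> (I \<union> set (take k fs))"
  have sub: "I \<union> set (take k fs) \<subseteq> polys V" for k
    using ideal_subset[OF I] reg set_take_subset[of k fs] unfolding regular_sequence_def by blast
  have J: "ideal (?J k) (poly_ring V)" for k by (rule poly_ring_genideal_ideal[OF sub])
  have nzd: "g \<in> ?J k" if "k < length fs" "g \<in> polys V" "fs ! k * g \<in> ?J k" for k g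
    using reg that unfolding regular_sequence_def by blast
  have irr: "fs ! k \<in> irrelevant_ideal V" if "k < length fs" for k
    using fs that nth_mem by blast
  {
    case 0
    then have "k < length fs" by simp
    then show ?case using nzd[of k] irr[of k] by (intro koszul_vanishes_0[OF V J]) auto
  next
    case (Suc m)
    then have k: "k < length fs" by simp
    have "?J (Suc k) = Idl\<^bsub>poly_ring V\<^esub> (?J k \<union> {fs ! k})"
      using Idl_Idl_Un[OF sub[of k], of "{fs ! k}"] sub[of "Suc k"] k by (simp add: take_Suc_conv_app_nth)
    moreover have "koszul_vanishes V m (?J (Suc k))" using Suc by (intro Suc.IH) auto
    ultimately have "koszul_vanishes V m (Idl\<^bsub>poly_ring V\<^esub> (insert (fs ! k) (?J k)))" by simp
    then show ?case using nzd[of k] irr[of k] k by (intro koszul_vanishes_Suc[OF V J]) auto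
  }
qed

lemma lookup_Var_mult_single:
  "lookup (Var u * p) (single x 1) = (if u = x then lookup p 0 else 0)"
proof (cases "u = x")
  case True
  then show ?thesis using lookup_single_mult[of "single x 1" 1 p 0] by (simp add: Var_def)
next
  case False
  have "single x 1 \<notin> keys (Var u * p)"
  proof
    assume "single x 1 \<in> keys (Var u * p)"
    then obtain m where "single x 1 = single u (1::nat) + m"
      unfolding Var_def by (auto dest: keys_single_mult)
    then have "lookup (single x (1::nat)) u = lookup (single u 1) u + lookup m u" by (simp add: lookup_add)
    then show False using False by (simp add: lookup_single)
  qed
  then show ?thesis using False by (simp add: in_keys_iff)
qed

lemma lookup_kdiff_single:
  assumes "finite \<sigma>" "x \<in> \<sigma>"
  shows "lookup (kdiff w \<sigma>) (single x 1) = ksign x (\<sigma> - {x}) * lookup (w (\<sigma> - {x})) 0"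
proof -
  have "lookup (ksign v (\<sigma> - {v}) * Var v * w (\<sigma> - {v})) (single x 1)
    = (if v = x then ksign x (\<sigma> - {x}) * lookup (w (\<sigma> - {x})) 0 else 0)" for v
    using lookup_Var_mult_single[of v "w (\<sigma> - {v})" x]
    by (simp add: ksign_def mult.assoc lookup_neg_one_power_mult)
  then show ?thesis unfolding kdiff_def using assms by (simp add: lookup_sum)
qed

text \<open>The nonzero class is \<open>x\<close> on the face \<open>{x} \<union> Z\<close>: the constant coefficient of a primitive on the face \<open>Z\<close>
  would be \<open>\<plusminus>1\<close> by the \<open>x\<close>-coefficient and \<open>0\<close> by the \<open>y\<close>-coefficient.\<close>

lemma cone_koszul_nonvanishing:
  assumes G: "simple_graph V E" and x: "x \<in> V" "x \<notin> Z" and Z: "Z \<subseteq> V"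
    and adj: "\<And>y. y \<in> V - Z - {x} \<Longrightarrow> {x, y} \<in> E" and ne: "V - Z - {x} \<noteq> {}"
  shows "\<not> koszul_vanishes V (Suc (card Z)) (sqf_ideal V E :: (nat, 'k::field) mpoly set)"
proof
  let ?I = "sqf_ideal V E :: (nat, 'k) mpoly set"
  have fin: "finite V" using G by (simp add: simple_graph_def)
  then have finZ: "finite Z" using Z finite_subset by blast
  define z :: "nat set \<Rightarrow> (nat, 'k) mpoly" where "z = (\<lambda>\<tau>. if \<tau> = insert x Z then Var x else 0)"
  assume van: "koszul_vanishes V (Suc (card Z)) ?I"
  have zc: "\<forall>\<sigma>. z \<sigma> \<in> polys V"
    using x by (simp add: z_def poly_ring_Var poly_ring_zero)
  have dz: "kdiff z \<sigma> \<in> ?I" if \<sigma>: "\<sigma> \<subseteq> V" "card \<sigma> = Suc (Suc (card Z))" for \<sigma>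
    unfolding kdiff_def
  proof (rule ideal_sum[OF ideal_sqf_ideal])
    fix v assume v: "v \<in> \<sigma>"
    show "ksign v (\<sigma> - {v}) * Var v * z (\<sigma> - {v}) \<in> ?I"
    proof (cases "\<sigma> - {v} = insert x Z")
      case True
      \<comment> \<open>The additional vertex of the face lies outside Z and differs from x, so it
        is adjacent to x.\<close>
      then have v': "v \<in> V - Z - {x}" using v \<sigma> by auto
      have "Var v * Var x = (sqf_monom {x, v} :: (nat, 'k) mpoly)"
        using v' by (simp add: Var_eq_monom monom_mult_disjoint insert_commute)
      also have "\<dots> \<in> ?I" using v' x adj[OF v'] by (intro monom_in_sqf_ideal) auto
      finally show ?thesis using True ideal_mult[OF ideal_sqf_ideal _ poly_ring_ksign]
        by (simp add: z_def mult.assoc)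
    next
      case False
      then show ?thesis using ideal_zero[OF ideal_sqf_ideal] by (simp add: z_def)
    qed
  qed
  have "\<exists>w. (\<forall>\<sigma>. w \<sigma> \<in> polys V) \<and>
      (\<forall>\<sigma>\<subseteq>V. card \<sigma> = Suc (card Z) \<longrightarrow> z \<sigma> - kdiff w \<sigma> \<in> ?I)"
    by (rule van[unfolded koszul_vanishes_def, THEN spec, THEN mp, THEN mp])
      (intro allI impI zc[rule_format] dz; assumption)+
  then obtain w where "\<forall>\<sigma>\<subseteq>V. card \<sigma> = Suc (card Z) \<longrightarrow> z \<sigma> - kdiff w \<sigma> \<in> ?I"
    by (elim exE conjE)
  note w = this[rule_format]
  \<comment> \<open>Generators have degree two, so a congruence modulo the ideal is an equality of
    linear coefficients.\<close>
  have lin: "lookup p (single v 1) = 0" if p: "p \<in> ?I" for p v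
  proof (rule ccontr)
    assume "lookup p (single v 1) \<noteq> 0"
    then obtain e where e: "e \<in> E" "e \<subseteq> keys (single v (1::nat))"
      using sqf_ideal_lookup[OF p] by blast
    then have "card e \<le> card {v}" by (intro card_mono) auto
    then show False using e G unfolding simple_graph_def by auto
  qed
  have *: "lookup (z (insert v Z)) (single v 1) = ksign v Z * lookup (w Z) 0" if v: "v \<in> V - Z" for v
  proof -
    have "z (insert v Z) - kdiff w (insert v Z) \<in> ?I" using v Z finZ by (intro w) auto
    from lin[OF this, of v] show ?thesis
      using v finZ lookup_kdiff_single[of "insert v Z" v w] by (simp add: lookup_minus)
  qed
  obtain y where y: "y \<in> V - Z - {x}" using ne by blast
  have "insert y Z \<noteq> insert x Z" using y by blast
  then have "ksign y Z * lookup (w Z) 0 = 0" using *[of y] y by (simp add: z_def)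
  then have "lookup (w Z) 0 = 0" by (simp add: ksign_def)
  then show False using *[of x] x by (simp add: z_def Var_def)
qed

section \<open>Nonzerodivisors and the depth of a cone\<close>

text \<open>Monomials that fail P absorb multiplication and those that satisfy P are closed under
  it. Discarding the former is therefore a quotient map onto the subring spanned by the
  latter.\<close>

lemma part_mult:
  fixes p q :: "('v \<Rightarrow>\<^sub>0 nat) \<Rightarrow>\<^sub>0 'k::comm_ring_1"
  assumes P: "\<And>a b. P (a + b) \<longleftrightarrow> P a \<and> P b"
  shows "part P (p * q) = part P p * part P q"
proof -
  have keys': "\<not> P m" if "m \<in> keys (p - part P p)" for m and p :: "('v \<Rightarrow>\<^sub>0 nat) \<Rightarrow>\<^sub>0 'k"
  proof
    assume "P m"
    then have "lookup (p - part P p) m = 0" by (simp add: lookup_minus lookup_part)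
    then show False using that unfolding in_keys_iff by blast
  qed
  have zero: "part P (a * b) = 0" if a: "\<And>m. m \<in> keys a \<Longrightarrow> \<not> P m" for a b :: "('v \<Rightarrow>\<^sub>0 nat) \<Rightarrow>\<^sub>0 'k"
  proof (rule part_eq_0)
    fix m assume "m \<in> keys (a * b)"
    then obtain u v where "u \<in> keys a" "m = u + v" using keys_mult[of a b] by blast
    then show "\<not> P m" using a P by blast
  qed
  have self: "part P (part P p * part P q) = part P p * part P q"
  proof (rule part_eq_self)
    fix m assume "m \<in> keys (part P p * part P q)"
    then obtain u v where "u \<in> keys (part P p)" "v \<in> keys (part P q)" "m = u + v"
      using keys_mult[of "part P p" "part P q"] by blast
    then show "P m" using P by (simp add: keys_part)
  qed
  have "p * q = part P p * part P q + ((p - part P p) * q + (q - part P q) * part P p)"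
    by (simp add: algebra_simps)
  then have "part P (p * q) = part P (part P p * part P q)
      + (part P ((p - part P p) * q) + part P ((q - part P q) * part P p))"
    by (simp only: part_add)
  also have "\<dots> = part P p * part P q"
    using zero[OF keys'] by (simp add: self)
  finally show ?thesis .
qed

text \<open>Restriction of the support to an independent set \<open>F\<close> is a ring homomorphism to a domain that kills
  the ideal.\<close>

lemma sqf_ideal_nonzerodivisor:
  fixes f g :: "(nat, 'k::field) mpoly"
  assumes fg: "f * g \<in> sqf_ideal V E" and g: "g \<in> polys V"
    and ext: "\<And>F. F \<subseteq> V \<Longrightarrow> \<forall>e\<in>E. \<not> e \<subseteq> F \<Longrightarrow>
      \<exists>F'. F \<subseteq> F' \<and> (\<forall>e\<in>E. \<not> e \<subseteq> F') \<and> part (\<lambda>m. keys m \<subseteq> F') f \<noteq> 0"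
  shows "g \<in> sqf_ideal V E"
proof (rule ccontr)
  assume "g \<notin> sqf_ideal V E"
  then obtain m where m: "m \<in> keys g" "\<forall>e\<in>E. \<not> e \<subseteq> keys m" using g unfolding sqf_ideal_def by blast
  then have "keys m \<subseteq> V" using g unfolding carrier_poly_ring_iff by blast
  \<comment> \<open>The support of a term of g outside the ideal contains no generator. It is
    enlarged to a set F on which f survives, so that the restriction of f can be cancelled in a
    domain.\<close>
  with m obtain F where F: "keys m \<subseteq> F" "\<forall>e\<in>E. \<not> e \<subseteq> F" "part (\<lambda>m. keys m \<subseteq> F) f \<noteq> 0"
    using ext[of "keys m"] by blast
  have "part (\<lambda>m. keys m \<subseteq> F) (f * g) = 0"
  proof (rule part_eq_0)
    fix m assume "m \<in> keys (f * g)"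
    then obtain e where "e \<in> E" "e \<subseteq> keys m" using sqf_ideal_lookup[OF fg, of m] unfolding in_keys_iff by blast
    then show "\<not> keys m \<subseteq> F" using F(2) by blast
  qed
  then have "part (\<lambda>m. keys m \<subseteq> F) f * part (\<lambda>m. keys m \<subseteq> F) g = 0"
    by (simp add: part_mult keys_add_nat)
  then have "part (\<lambda>m. keys m \<subseteq> F) g = 0" using F by simp
  then have "lookup g m = 0" using F lookup_part[of "\<lambda>m. keys m \<subseteq> F" g m] by simp
  then show False using m by (simp add: in_keys_iff)
qed

lemma lookup_Var:
  "lookup (Var u :: ('v, 'k::comm_ring_1) mpoly) (single v 1) = (if u = v then 1 else 0)"
  using lookup_Var_mult_single[of u "1 :: ('v, 'k) mpoly" v] by simp

lemma part_Var_sum_neq_0: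
  assumes "finite A" "v \<in> A" "v \<in> F"
  shows "part (\<lambda>m. keys m \<subseteq> F) (\<Sum>u\<in>A. Var u) \<noteq> 0"
proof
  assume "part (\<lambda>m. keys m \<subseteq> F) (\<Sum>u\<in>A. Var u :: ('a, 'b) mpoly) = 0"
  then have "lookup (part (\<lambda>m. keys m \<subseteq> F) (\<Sum>u\<in>A. Var u :: ('a, 'b) mpoly)) (single v 1) = 0" by simp
  moreover have "lookup (\<Sum>u\<in>A. Var u :: ('a, 'b) mpoly) (single v 1) = 1"
    using assms unfolding lookup_sum lookup_Var by simp
  ultimately show False using assms by (simp add: lookup_part)
qed

text \<open>Modulo some of the isolated variables the ideal is still squarefree monomial, so
  \<open>sqf_ideal_nonzerodivisor\<close> applies at every stage. It remains to enlarge a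
  generator-free set to one that contains a variable of the next element of the sequence.\<close>

lemma cone_regular_sequence:
  assumes G: "simple_graph V E" and x: "x \<in> V" "x \<notin> Z" and Z: "Z \<subseteq> V"
    and isolated: "\<And>e. e \<in> E \<Longrightarrow> e \<inter> Z = {}"
  obtains fs where "set fs \<subseteq> irrelevant_ideal V" "length fs = Suc (card Z)"
    "regular_sequence V (sqf_ideal V E :: (nat, 'k::field) mpoly set) fs"
proof
  let ?I = "sqf_ideal V E :: (nat, 'k) mpoly set"
  have fin: "finite V" using G by (simp add: simple_graph_def)
  then have finZ: "finite Z" using Z finite_subset by blast
  have e: "e \<subseteq> V" "finite e" "card e = 2" if "e \<in> E" for e
    using that G finite_subset[OF _ fin] unfolding simple_graph_def by auto
  define zs where "zs = sorted_list_of_set Z"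
  have zs: "set zs = Z" "distinct zs" "length zs = card Z" using finZ by (auto simp: zs_def)
  define f :: "(nat, 'k) mpoly" where "f = (\<Sum>v\<in>V - Z. Var v)"
  define fs where "fs = map Var zs @ [f]"
  have irr: "f \<in> irrelevant_ideal V" "\<And>v. v \<in> V \<Longrightarrow> Var v \<in> (irrelevant_ideal V :: (nat, 'k) mpoly set)"
  proof -
    show v: "Var v \<in> (irrelevant_ideal V :: (nat, 'k) mpoly set)" if "v \<in> V" for v
      unfolding irrelevant_ideal_eq Var_eq_monom using that by (intro monom_in_sqf_ideal) auto
    then show "f \<in> irrelevant_ideal V"
      unfolding f_def irrelevant_ideal_eq by (intro ideal_sum[OF ideal_sqf_ideal]) auto
  qed
  show set_fs: "set fs \<subseteq> irrelevant_ideal V" using zs Z irr by (auto simp: fs_def)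
  show "length fs = Suc (card Z)" by (simp add: fs_def zs)
  have carr: "irrelevant_ideal V \<subseteq> (polys V :: (nat, 'k) mpoly set)"
    by (auto simp: irrelevant_ideal_iff)
  have "?I \<subseteq> irrelevant_ideal V"
  proof
    fix p assume p: "p \<in> ?I"
    have "lookup p 0 = 0"
    proof (rule ccontr)
      assume "lookup p 0 \<noteq> 0"
      then obtain e' where "e' \<in> E" "e' = {}" using sqf_ideal_lookup[OF p, of 0] by auto
      then show False using e[of e'] by simp
    qed
    then show "p \<in> irrelevant_ideal V" using p by (simp add: irrelevant_ideal_iff sqf_ideal_def)
  qed
  then have "Idl\<^bsub>poly_ring V\<^esub> (?I \<union> set fs) \<subseteq> irrelevant_ideal V"
    using set_fs ideal_sqf_ideal unfolding irrelevant_ideal_eq by (intro poly_ring_genideal_minimal) auto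
  moreover have "1 \<notin> (irrelevant_ideal V :: (nat, 'k) mpoly set)" by (simp add: irrelevant_ideal_iff)
  ultimately have proper: "Idl\<^bsub>poly_ring V\<^esub> (?I \<union> set fs) \<noteq> polys V"
    using poly_ring_one[of V, where ?'b = 'k] by blast
  have "g \<in> Idl\<^bsub>poly_ring V\<^esub> (?I \<union> set (take i fs))"
    if i: "i < length fs" and g: "g \<in> polys V"
      and fg: "fs ! i * g \<in> Idl\<^bsub>poly_ring V\<^esub> (?I \<union> set (take i fs))" for i g
  proof -
    define A where "A = set (take i zs)"
    have A: "A \<subseteq> Z" using zs set_take_subset[of i zs] by (auto simp: A_def)
    have "set (take i fs) = Var ` A" using i by (auto simp: fs_def A_def take_map)
    then have J: "Idl\<^bsub>poly_ring V\<^esub> (?I \<union> set (take i fs)) = sqf_ideal V (E \<union> (\<lambda>z. {z}) ` A)"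
      using Idl_sqf_ideal_Un_Vars[of E V A, where ?'b = 'k] e A Z by auto
    show ?thesis
      unfolding J
    proof (rule sqf_ideal_nonzerodivisor[OF fg[unfolded J] g])
      fix F assume F: "F \<subseteq> V" "\<forall>e\<in>E \<union> (\<lambda>z. {z}) ` A. \<not> e \<subseteq> F"
      show "\<exists>F'. F \<subseteq> F' \<and> (\<forall>e\<in>E \<union> (\<lambda>z. {z}) ` A. \<not> e \<subseteq> F') \<and> part (\<lambda>m. keys m \<subseteq> F') (fs ! i) \<noteq> 0"
      proof (cases "i < length zs")
        case True
        have z: "zs ! i \<in> Z" "zs ! i \<notin> A"
        proof -
          show "zs ! i \<in> Z" using True zs nth_mem by blast
          show "zs ! i \<notin> A"
          proof
            assume "zs ! i \<in> A"
            then obtain j where j: "j < i" "zs ! j = zs ! i" by (auto simp: A_def in_set_conv_nth)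
            then show False using zs(2) True nth_eq_iff_index_eq[of zs i j] by simp
          qed
        qed
        \<comment> \<open>The new variable occurs in no edge and is not yet divided out, so
          inserting it completes no generator.\<close>
        have "\<not> e' \<subseteq> insert (zs ! i) F" if "e' \<in> E \<union> (\<lambda>z. {z}) ` A" for e'
        proof -
          have "zs ! i \<notin> e'"
            using that
          proof
            assume "e' \<in> E" then show ?thesis using isolated[of e'] z(1) by blast
          next
            assume "e' \<in> (\<lambda>z. {z}) ` A" then show ?thesis using z(2) by blast
          qed
          moreover have "\<not> e' \<subseteq> F" using F(2) that by (rule bspec)
          ultimately show ?thesis by (simp add: subset_insert)
        qed
        moreover have "part (\<lambda>m. keys m \<subseteq> insert (zs ! i) F) (fs ! i) \<noteq> 0"
        proof -
          have "fs ! i = (\<Sum>u\<in>{zs ! i}. Var u)" using True by (simp add: fs_def nth_append)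
          then show ?thesis using part_Var_sum_neq_0[of "{zs ! i}" "zs ! i" "insert (zs ! i) F", where ?'b = 'k]
            by (simp del: sum.insert)
        qed
        ultimately show ?thesis by (intro exI[of _ "insert (zs ! i) F"]) auto
      next
        case False
        then have iz: "i = length zs" using i by (simp add: fs_def)
        then have AZ: "A = Z" "fs ! i = f" by (simp_all add: A_def zs(1) fs_def nth_append)
        then have FZ: "F \<inter> Z = {}" using F(2) by blast
        \<comment> \<open>All of Z has been divided out, so F avoids Z and each of its vertices
          occurs in \<open>f\<close>. If F is empty, \<open>{x}\<close> takes its place; a single
          vertex contains no edge.\<close>
        define v where "v = (if F = {} then x else SOME v. v \<in> F)"
        have vF: "v \<in> F" if "F \<noteq> {}" using that some_in_eq[of F] by (simp add: v_def)
        have v: "v \<in> V - Z" "insert v F = (if F = {} then {x} else F)"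
        proof -
          show "v \<in> V - Z" using vF x F(1) FZ by (cases "F = {}") (auto simp: v_def)
          show "insert v F = (if F = {} then {x} else F)"
            using vF by (cases "F = {}") (simp_all add: v_def insert_absorb)
        qed
        have "\<not> e' \<subseteq> insert v F" if "e' \<in> E \<union> (\<lambda>z. {z}) ` A" for e'
        proof (cases "F = {}")
          case True
          have "\<not> e' \<subseteq> {x}"
            using that
          proof
            assume "e' \<in> E"
            then have "card e' = 2" by (rule e)
            then show ?thesis using card_mono[of "{x}" e'] by auto
          next
            assume "e' \<in> (\<lambda>z. {z}) ` A" then show ?thesis using x AZ by blast
          qed
          then show ?thesis using v True by simp
        next
          case False
          then have "insert v F = F" using v(2) by simp
          moreover have "\<not> e' \<subseteq> F" using F(2) that by (rule bspec)
          ultimately show ?thesis by simp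
        qed
        moreover have "part (\<lambda>m. keys m \<subseteq> insert v F) (fs ! i) \<noteq> 0"
          unfolding AZ f_def using v(1) fin by (intro part_Var_sum_neq_0[of _ v] insertI1) auto
        ultimately show ?thesis by (intro exI[of _ "insert v F"]) auto
      qed
    qed
  qed
  then show "regular_sequence V ?I fs"
    unfolding regular_sequence_def using set_fs carr proper by blast
qed

lemma cone_depth:
  assumes G: "simple_graph V E" and x: "x \<in> V" "x \<notin> Z" and Z: "Z \<subseteq> V"
    and isolated: "\<And>e. e \<in> E \<Longrightarrow> e \<inter> Z = {}"
    and adj: "\<And>y. y \<in> V - Z - {x} \<Longrightarrow> {x, y} \<in> E" and ne: "V - Z - {x} \<noteq> {}"
  shows "depth_quot V (edge_ideal V E :: (nat, 'k::field) mpoly set) = Suc (card Z)"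
proof -
  let ?I = "sqf_ideal V E :: (nat, 'k) mpoly set"
  let ?L = "{length fs | fs. set fs \<subseteq> irrelevant_ideal V \<and> regular_sequence V ?I fs}"
  have fin: "finite V" using G by (simp add: simple_graph_def)
  have le: "n \<le> Suc (card Z)" if "n \<in> ?L" for n
  proof (rule ccontr)
    obtain fs where fs: "n = length fs" "set fs \<subseteq> irrelevant_ideal V" "regular_sequence V ?I fs"
      using \<open>n \<in> ?L\<close> by blast
    assume "\<not> n \<le> Suc (card Z)"
    \<comment> \<open>A sequence longer than \<open>Suc (card Z)\<close> is just long enough, since
      degree m takes m + 1 elements.\<close>
    then have "koszul_vanishes V (Suc (card Z)) (Idl\<^bsub>poly_ring V\<^esub> (?I \<union> set (take 0 fs)))"
      using fs by (intro regular_sequence_koszul_vanishes[OF fin ideal_sqf_ideal]) auto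
    then show False
      using cone_koszul_nonvanishing[OF G x Z adj ne, where ?'k = 'k] by (simp add: Idl_ideal[OF ideal_sqf_ideal])
  qed
  then have "finite ?L" using finite_subset[of ?L "{..Suc (card Z)}"] by auto
  moreover obtain fs where "set fs \<subseteq> irrelevant_ideal V" "length fs = Suc (card Z)" "regular_sequence V ?I fs"
    by (rule cone_regular_sequence[OF G x Z isolated])
  then have "Suc (card Z) \<in> ?L" by force
  ultimately show ?thesis
    unfolding depth_quot_def edge_ideal_eq_sqf_ideal[OF G] using le by (intro Max_eqI)
qed

section \<open>Homogeneous components\<close>

text \<open>The degree is an integer because the degree shifts between basis elements of free
  modules can be negative; the component is then 0.\<close>

definition hcomp :: "int \<Rightarrow> ('v, 'k::comm_ring_1) mpoly \<Rightarrow> ('v, 'k) mpoly" where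
  "hcomp d = part (\<lambda>m. int (mdeg m) = d)"

lemma homogeneousD: "homogeneous d p \<Longrightarrow> m \<in> keys p \<Longrightarrow> int (mdeg m) = d"
  by (simp add: homogeneous_def)

lemma homogeneous_0: "homogeneous d 0"
  by (simp add: homogeneous_def)

lemma homogeneous_1: "homogeneous 0 1"
  by (simp add: homogeneous_def)

lemma homogeneous_add: "homogeneous d p \<Longrightarrow> homogeneous d q \<Longrightarrow> homogeneous d (p + q)"
  using Poly_Mapping.keys_add[of p q] by (auto simp: homogeneous_def)

lemma homogeneous_uminus: "homogeneous d p \<Longrightarrow> homogeneous d (- p)"
  by (simp add: homogeneous_def)

lemma homogeneous_diff: "homogeneous d p \<Longrightarrow> homogeneous d q \<Longrightarrow> homogeneous d (p - q)"
  using homogeneous_add[of d p "- q"] homogeneous_uminus[of d q] by simp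

lemma homogeneous_sum: "(\<And>i. i \<in> A \<Longrightarrow> homogeneous d (f i)) \<Longrightarrow> homogeneous d (sum f A)"
  by (induction A rule: infinite_finite_induct) (auto intro: homogeneous_0 homogeneous_add)

lemma homogeneous_mult:
  assumes "homogeneous d p" "homogeneous e q" shows "homogeneous (d + e) (p * q)"
  unfolding homogeneous_def
proof
  fix m assume "m \<in> keys (p * q)"
  then obtain a b where "a \<in> keys p" "b \<in> keys q" "m = a + b" using keys_mult[of p q] by blast
  then show "int (mdeg m) = d + e" using assms by (simp add: mdeg_add homogeneousD)
qed

lemma homogeneous_hcomp: "homogeneous d (hcomp d p)"
  by (simp add: homogeneous_def hcomp_def keys_part)

lemma hcomp_eq_self: "homogeneous d p \<Longrightarrow> hcomp d p = p"
  unfolding hcomp_def by (rule part_eq_self) (rule homogeneousD)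

lemma hcomp_sum: "hcomp d (\<Sum>i\<in>A. f i) = (\<Sum>i\<in>A. hcomp d (f i))"
  unfolding hcomp_def by (rule part_sum)

lemma hcomp_diff: "hcomp d (p - q) = hcomp d p - hcomp d q"
  unfolding hcomp_def by (rule part_diff)

lemma hcomp_mult:
  assumes q: "homogeneous k q" shows "hcomp d (q * p) = q * hcomp (d - k) p"
proof -
  have "hcomp d (q * (p - hcomp (d - k) p)) = 0"
    unfolding hcomp_def
  proof (rule part_eq_0)
    fix m assume "m \<in> keys (q * (p - part (\<lambda>m. int (mdeg m) = d - k) p))"
    then obtain a b where ab: "a \<in> keys q" "b \<in> keys (p - part (\<lambda>m. int (mdeg m) = d - k) p)" "m = a + b"
      using keys_mult[of q] by blast
    from ab(2) have "int (mdeg b) \<noteq> d - k" unfolding in_keys_iff by (auto simp: lookup_minus lookup_part)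
    then show "int (mdeg m) \<noteq> d" using homogeneousD[OF q ab(1)] ab(3) by (simp add: mdeg_add)
  qed
  moreover have "hcomp d (q * hcomp (d - k) p) = q * hcomp (d - k) p"
    using homogeneous_mult[OF q homogeneous_hcomp, of "d - k" p] by (intro hcomp_eq_self) simp
  ultimately show ?thesis by (simp add: right_diff_distrib hcomp_diff)
qed

lemma homogeneous_lookup_0: "homogeneous d p \<Longrightarrow> lookup p 0 \<noteq> 0 \<Longrightarrow> d = 0"
  using homogeneousD[of d p 0] by (simp add: in_keys_iff)

lemma poly_ring_hcomp: "p \<in> polys V \<Longrightarrow> hcomp d p \<in> polys V"
  unfolding hcomp_def by (rule poly_ring_part)

section \<open>Comparison of graded free resolutions\<close>

text \<open>Matrices of degree-preserving maps of graded free modules, with \<open>cs\<close> and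
  \<open>rs\<close> the degrees of the basis elements of source and target.\<close>

definition hmat :: "'v set \<Rightarrow> int list \<Rightarrow> int list \<Rightarrow> ('v, 'k::comm_ring_1) mpoly mat \<Rightarrow> bool" where
  "hmat V rs cs A \<longleftrightarrow> A \<in> carrier_mat (length rs) (length cs) \<and>
    (\<forall>a<length rs. \<forall>b<length cs. A $$ (a, b) \<in> polys V \<and>
      homogeneous (cs ! b - rs ! a) (A $$ (a, b)))"

lemma hmat_carrier: "hmat V rs cs A \<Longrightarrow> A \<in> carrier_mat (length rs) (length cs)"
  by (simp add: hmat_def)

lemma hmat_dim: "hmat V rs cs A \<Longrightarrow> dim_row A = length rs" "hmat V rs cs A \<Longrightarrow> dim_col A = length cs"
  by (auto simp: hmat_def)

lemma hmat_entry:
  assumes "hmat V rs cs A" "a < length rs" "b < length cs"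
  shows "A $$ (a, b) \<in> polys V" "homogeneous (cs ! b - rs ! a) (A $$ (a, b))"
  using assms by (auto simp: hmat_def)

lemma mult_mat_entry:
  "A \<in> carrier_mat n m \<Longrightarrow> B \<in> carrier_mat m l \<Longrightarrow> i < n \<Longrightarrow> j < l \<Longrightarrow>
    (A * B) $$ (i, j) = (\<Sum>k<m. A $$ (i, k) * B $$ (k, j))"
  by (simp add: scalar_prod_def lessThan_atLeast0)

lemma mult_mat_vec_entry:
  "A \<in> carrier_mat n m \<Longrightarrow> v \<in> carrier_vec m \<Longrightarrow> i < n \<Longrightarrow>
    (A *\<^sub>v v) $ i = (\<Sum>k<m. A $$ (i, k) * v $ k)"
  by (simp add: scalar_prod_def lessThan_atLeast0)

lemma hmat_mult:
  assumes A: "hmat V rs ms A" and B: "hmat V ms cs B" shows "hmat V rs cs (A * B)"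
  unfolding hmat_def
proof (intro conjI allI impI)
  show "A * B \<in> carrier_mat (length rs) (length cs)"
    using A B by (intro mult_carrier_mat[of _ _ "length ms"] hmat_carrier)
  fix a b assume ab: "a < length rs" "b < length cs"
  have eq: "(A * B) $$ (a, b) = (\<Sum>k<length ms. A $$ (a, k) * B $$ (k, b))"
    by (rule mult_mat_entry[OF hmat_carrier[OF A] hmat_carrier[OF B] ab])
  show "(A * B) $$ (a, b) \<in> polys V"
    unfolding eq using ab by (intro poly_ring_sum poly_ring_mult hmat_entry[OF A] hmat_entry[OF B]) auto
  show "homogeneous (cs ! b - rs ! a) ((A * B) $$ (a, b))"
    unfolding eq
  proof (rule homogeneous_sum)
    fix k assume "k \<in> {..<length ms}"
    then have "homogeneous (ms ! k - rs ! a + (cs ! b - ms ! k)) (A $$ (a, k) * B $$ (k, b))"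
      using ab by (intro homogeneous_mult hmat_entry[OF A] hmat_entry[OF B]) auto
    then show "homogeneous (cs ! b - rs ! a) (A $$ (a, k) * B $$ (k, b))" by simp
  qed
qed

lemma hmat_minus:
  assumes A: "hmat V rs cs A" and B: "hmat V rs cs B" shows "hmat V rs cs (A - B)"
  unfolding hmat_def
proof (intro conjI allI impI)
  show "A - B \<in> carrier_mat (length rs) (length cs)" by (rule minus_carrier_mat[OF hmat_carrier[OF B]])
  fix a b assume ab: "a < length rs" "b < length cs"
  have eq: "(A - B) $$ (a, b) = A $$ (a, b) - B $$ (a, b)"
    using ab hmat_dim[OF B] by simp
  show "(A - B) $$ (a, b) \<in> polys V"
    unfolding eq by (rule poly_ring_diff[OF hmat_entry(1)[OF A ab] hmat_entry(1)[OF B ab]])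
  show "homogeneous (cs ! b - rs ! a) ((A - B) $$ (a, b))"
    unfolding eq by (rule homogeneous_diff[OF hmat_entry(2)[OF A ab] hmat_entry(2)[OF B ab]])
qed

lemma hmat_one: "hmat V rs rs (1\<^sub>m (length rs))"
  unfolding hmat_def by (auto simp: homogeneous_0 homogeneous_1 poly_ring_zero poly_ring_one)

lemma hmat_mult_vec:
  assumes A: "hmat V rs cs A" and v: "v \<in> poly_vecs V (length cs)"
  shows "A *\<^sub>v v \<in> poly_vecs V (length rs)"
proof -
  have vc: "v \<in> carrier_vec (length cs)" "\<And>b. b < length cs \<Longrightarrow> v $ b \<in> polys V"
    using v by (auto simp: poly_vecs_def)
  have "(A *\<^sub>v v) $ a \<in> polys V" if "a < length rs" for a
    unfolding mult_mat_vec_entry[OF hmat_carrier[OF A] vc(1) that]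
    using that by (intro poly_ring_sum poly_ring_mult hmat_entry[OF A] vc) auto
  then show ?thesis
    using mult_mat_vec_carrier[OF hmat_carrier[OF A] vc(1)] unfolding poly_vecs_def by blast
qed

lemma hmat_col:
  assumes A: "hmat V rs cs A" and b: "b < length cs"
  shows "col A b \<in> poly_vecs V (length rs)"
  unfolding poly_vecs_def
proof (intro CollectI conjI allI impI)
  show "col A b \<in> carrier_vec (length rs)" by (rule carrier_vecI) (simp only: dim_col hmat_dim[OF A])
  fix a assume "a < length rs"
  then show "col A b $ a \<in> polys V"
    using hmat_entry(1)[OF A _ b] b by (simp only: index_col hmat_dim[OF A])
qed

lemma mult_mat_unit_vec:
  assumes "A \<in> carrier_mat n m" "j < m"
  shows "A *\<^sub>v unit_vec m j = col (A :: 'a::comm_ring_1 mat) j"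
proof (rule eq_vecI)
  fix i assume "i < dim_vec (col A j)"
  then have i: "i < n" using assms by simp
  then have "row A i \<in> carrier_vec m" using assms by auto
  then show "(A *\<^sub>v unit_vec m j) $ i = col A j $ i"
    using i assms by (simp add: scalar_prod_right_unit)
qed (use assms in auto)

text \<open>An arbitrary lift of a column is replaced by its homogeneous component of the right degree.\<close>

lemma hmat_lift:
  assumes D: "hmat V rs ms D" and A: "hmat V rs cs A"
    and im: "\<And>b. b < length cs \<Longrightarrow> \<exists>w\<in>poly_vecs V (length ms). col A b = D *\<^sub>v w"
  obtains B where "hmat V ms cs B" "D * B = A"
proof -
  have "\<forall>b. \<exists>w. b < length cs \<longrightarrow> w \<in> poly_vecs V (length ms) \<and> col A b = D *\<^sub>v w" using im by blast
  then obtain w where w: "\<And>b. b < length cs \<Longrightarrow> w b \<in> poly_vecs V (length ms)"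
    "\<And>b. b < length cs \<Longrightarrow> col A b = D *\<^sub>v w b" by metis
  define B where "B = mat (length ms) (length cs) (\<lambda>(k, b). hcomp (cs ! b - ms ! k) (w b $ k))"
  have wc: "w b $ k \<in> polys V" "w b \<in> carrier_vec (length ms)"
    if "b < length cs" "k < length ms" for b k
    using w(1)[OF that(1)] that(2) by (auto simp: poly_vecs_def)
  have B: "hmat V ms cs B"
    unfolding hmat_def by (auto simp: B_def intro: homogeneous_hcomp poly_ring_hcomp wc)
  moreover have "D * B = A"
  proof (rule eq_matI)
    fix a b assume "a < dim_row A" "b < dim_col A"
    then have ab: "a < length rs" "b < length cs" by (simp_all add: hmat_dim[OF A])
    have wb: "w b \<in> carrier_vec (length ms)" using w(1)[OF ab(2)] by (simp add: poly_vecs_def)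
    have "(D * B) $$ (a, b) = (\<Sum>k<length ms. D $$ (a, k) * hcomp (cs ! b - ms ! k) (w b $ k))"
      unfolding mult_mat_entry[OF hmat_carrier[OF D] hmat_carrier[OF B] ab]
      using ab by (intro sum.cong) (auto simp: B_def)
    also have "\<dots> = (\<Sum>k<length ms. hcomp (cs ! b - rs ! a) (D $$ (a, k) * w b $ k))"
    proof (rule sum.cong[OF refl])
      fix k assume "k \<in> {..<length ms}"
      then have "hcomp (cs ! b - rs ! a) (D $$ (a, k) * w b $ k)
          = D $$ (a, k) * hcomp (cs ! b - rs ! a - (ms ! k - rs ! a)) (w b $ k)"
        using ab by (intro hcomp_mult hmat_entry[OF D]) auto
      then show "D $$ (a, k) * hcomp (cs ! b - ms ! k) (w b $ k)
          = hcomp (cs ! b - rs ! a) (D $$ (a, k) * w b $ k)" by simp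
    qed
    also have "\<dots> = hcomp (cs ! b - rs ! a) ((D *\<^sub>v w b) $ a)"
      unfolding mult_mat_vec_entry[OF hmat_carrier[OF D] wb ab(1)] by (rule hcomp_sum[symmetric])
    also have "(D *\<^sub>v w b) $ a = A $$ (a, b)"
      using w(2)[OF ab(2)] ab hmat_dim[OF A] by (metis index_col)
    also have "hcomp (cs ! b - rs ! a) \<dots> = A $$ (a, b)"
      by (intro hcomp_eq_self hmat_entry[OF A] ab)
    finally show "(D * B) $$ (a, b) = A $$ (a, b)" .
  qed (use hmat_dim[OF A] hmat_dim[OF B] hmat_dim[OF D] in auto)
  ultimately show ?thesis by (rule that)
qed

text \<open>The kernel at stage i, where stage 0 uses the augmentation modulo I instead of a
  differential. Exactness then has one form for all i, and the inductions below need no special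
  case.\<close>

definition syzygies ::
    "'v set \<Rightarrow> ('v, 'k::field) mpoly set \<Rightarrow> (nat \<Rightarrow> int list) \<Rightarrow> ('v, 'k) mpoly vec \<Rightarrow>
     (nat \<Rightarrow> ('v, 'k) mpoly mat) \<Rightarrow> nat \<Rightarrow> ('v, 'k) mpoly vec set" where
  "syzygies V I ds e D i = {v \<in> poly_vecs V (length (ds i)).
    case i of 0 \<Rightarrow> e \<bullet> v \<in> I | Suc l \<Rightarrow> D l *\<^sub>v v = 0\<^sub>v (length (ds l))}"

lemma syzygies_0: "v \<in> syzygies V I ds e D 0 \<longleftrightarrow> v \<in> poly_vecs V (length (ds 0)) \<and> e \<bullet> v \<in> I"
  by (simp add: syzygies_def)

lemma syzygies_Suc:
  "v \<in> syzygies V I ds e D (Suc l) \<longleftrightarrow>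
    v \<in> poly_vecs V (length (ds (Suc l))) \<and> D l *\<^sub>v v = 0\<^sub>v (length (ds l))"
  by (simp add: syzygies_def)

context
  fixes V :: "'v set" and I :: "('v, 'k::field) mpoly set" and ds e D
  assumes R: "graded_free_resolution V I ds e D"
begin

lemma resolution_hmat: "hmat V (ds i) (ds (Suc i)) (D i)"
  using R unfolding graded_free_resolution_def hmat_def by blast

lemma resolution_exact:
  assumes "v \<in> poly_vecs V (length (ds i))"
  shows "v \<in> syzygies V I ds e D i \<longleftrightarrow> (\<exists>w\<in>poly_vecs V (length (ds (Suc i))). v = D i *\<^sub>v w)"
proof (cases i)
  case 0
  then show ?thesis using R assms unfolding graded_free_resolution_def by (simp add: syzygies_0)
next
  case (Suc l)
  then show ?thesis using R assms unfolding graded_free_resolution_def by (simp add: syzygies_Suc)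
qed

lemma resolution_syzygiesE:
  assumes "v \<in> syzygies V I ds e D i"
  obtains w where "w \<in> poly_vecs V (length (ds (Suc i)))" "v = D i *\<^sub>v w"
proof -
  have "v \<in> poly_vecs V (length (ds i))" using assms by (simp add: syzygies_def)
  then show ?thesis using resolution_exact assms that by blast
qed

lemma resolution_im_syzygies:
  assumes "w \<in> poly_vecs V (length (ds (Suc i)))"
  shows "D i *\<^sub>v w \<in> syzygies V I ds e D i"
  using resolution_exact[of "D i *\<^sub>v w" i] hmat_mult_vec[OF resolution_hmat assms] assms by blast

lemma resolution_col_syzygies:
  assumes "b < length (ds (Suc i))"
  shows "col (D i) b \<in> syzygies V I ds e D i"
proof -
  have "unit_vec (length (ds (Suc i))) b \<in> poly_vecs V (length (ds (Suc i)))"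
    by (auto simp: poly_vecs_def unit_vec_def poly_ring_zero poly_ring_one)
  then show ?thesis
    using resolution_im_syzygies mult_mat_unit_vec[OF hmat_carrier[OF resolution_hmat] assms] by metis
qed

lemma resolution_mult_zero: "D i * D (Suc i) = 0\<^sub>m (length (ds i)) (length (ds (Suc (Suc i))))"
proof (rule eq_matI)
  fix a b assume "a < dim_row (0\<^sub>m (length (ds i)) (length (ds (Suc (Suc i)))))"
    "b < dim_col (0\<^sub>m (length (ds i)) (length (ds (Suc (Suc i)))))"
  then have ab: "a < length (ds i)" "b < length (ds (Suc (Suc i)))" by auto
  have c: "D i \<in> carrier_mat (length (ds i)) (length (ds (Suc i)))"
    "D (Suc i) \<in> carrier_mat (length (ds (Suc i))) (length (ds (Suc (Suc i))))"
    by (rule hmat_carrier[OF resolution_hmat])+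
  have "col (D i * D (Suc i)) b = D i *\<^sub>v col (D (Suc i)) b" by (rule col_mult2[OF c ab(2)])
  also have "\<dots> = 0\<^sub>v (length (ds i))"
    using resolution_col_syzygies[OF ab(2)] by (simp add: syzygies_Suc)
  finally have "col (D i * D (Suc i)) b $ a = 0" using ab by simp
  then show "(D i * D (Suc i)) $$ (a, b) = 0\<^sub>m (length (ds i)) (length (ds (Suc (Suc i)))) $$ (a, b)"
    using ab c by simp
qed (use hmat_dim[OF resolution_hmat] in auto)

end

definition homogeneous_ideal :: "'v set \<Rightarrow> ('v, 'k::comm_ring_1) mpoly set \<Rightarrow> bool" where
  "homogeneous_ideal V I \<longleftrightarrow> ideal I (poly_ring V) \<and> (\<forall>p\<in>I. \<forall>d. hcomp d p \<in> I)"

lemma scalar_prod_sum: "v \<in> carrier_vec n \<Longrightarrow> u \<bullet> v = (\<Sum>k<n. u $ k * v $ k)"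
  by (simp add: scalar_prod_def lessThan_atLeast0)

text \<open>Preimages of the generators under the other augmentation exist but need not be
  homogeneous. Passing to the component of the right degree changes the error term to its own
  component, which stays in I because I is homogeneous.\<close>

lemma resolution_lift_generators:
  fixes I :: "('v, 'k::field) mpoly set"
  assumes I: "homogeneous_ideal V I"
    and R: "graded_free_resolution V I ds e D" and R': "graded_free_resolution V I ds' e' D'"
  obtains \<phi> where "hmat V (ds' 0) (ds 0) \<phi>"
    "\<And>v. v \<in> poly_vecs V (length (ds 0)) \<Longrightarrow> e' \<bullet> (\<phi> *\<^sub>v v) - e \<bullet> v \<in> I"
proof -
  have idl: "ideal I (poly_ring V)" using I by (simp add: homogeneous_ideal_def)
  let ?n = "length (ds 0)" and ?n' = "length (ds' 0)"
  have e: "\<And>b. b < ?n \<Longrightarrow> e $ b \<in> polys V" "\<And>b. b < ?n \<Longrightarrow> homogeneous (ds 0 ! b) (e $ b)"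
    using R unfolding graded_free_resolution_def poly_vecs_def by auto
  have e': "\<And>b. b < ?n' \<Longrightarrow> homogeneous (ds' 0 ! b) (e' $ b)"
    "\<And>f. f \<in> polys V \<Longrightarrow> \<exists>v\<in>poly_vecs V ?n'. f - e' \<bullet> v \<in> I"
    using R' unfolding graded_free_resolution_def poly_vecs_def by auto
  have "\<forall>b. \<exists>v. b < ?n \<longrightarrow> v \<in> poly_vecs V ?n' \<and> e $ b - e' \<bullet> v \<in> I" using e' e by blast
  then obtain w where w: "\<And>b. b < ?n \<Longrightarrow> w b \<in> poly_vecs V ?n'" "\<And>b. b < ?n \<Longrightarrow> e $ b - e' \<bullet> w b \<in> I"
    by metis
  define \<phi> where "\<phi> = mat ?n' ?n (\<lambda>(k, b). hcomp (ds 0 ! b - ds' 0 ! k) (w b $ k))"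
  have "hmat V (ds' 0) (ds 0) \<phi>"
    unfolding hmat_def using w(1)
    by (auto simp: \<phi>_def poly_vecs_def intro: homogeneous_hcomp poly_ring_hcomp)
  moreover have "e' \<bullet> (\<phi> *\<^sub>v v) - e \<bullet> v \<in> I" if v: "v \<in> poly_vecs V ?n" for v
  proof -
    have vc: "v \<in> carrier_vec ?n" "\<And>b. b < ?n \<Longrightarrow> v $ b \<in> polys V"
      using v by (auto simp: poly_vecs_def)
    have \<phi>c: "\<phi> \<in> carrier_mat ?n' ?n" by (simp add: \<phi>_def)
    have "e' \<bullet> (\<phi> *\<^sub>v v) = (\<Sum>k<?n'. \<Sum>b<?n. e' $ k * (\<phi> $$ (k, b) * v $ b))"
      using mult_mat_vec_carrier[OF \<phi>c vc(1)] mult_mat_vec_entry[OF \<phi>c vc(1)]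
      by (simp add: scalar_prod_sum sum_distrib_left)
    also have "\<dots> = (\<Sum>b<?n. v $ b * (\<Sum>k<?n'. e' $ k * \<phi> $$ (k, b)))"
      by (subst sum.swap) (simp add: sum_distrib_left mult.commute mult.left_commute)
    finally have "e' \<bullet> (\<phi> *\<^sub>v v) - e \<bullet> v = (\<Sum>b<?n. v $ b * ((\<Sum>k<?n'. e' $ k * \<phi> $$ (k, b)) - e $ b))"
      by (simp add: scalar_prod_sum[OF vc(1)] right_diff_distrib sum_subtractf mult.commute)
    also have "\<dots> \<in> I"
    proof (rule ideal_sum[OF idl], rule ideal_mult[OF idl])
      fix b assume "b \<in> {..<?n}"
      then have b: "b < ?n" by simp
      show "v $ b \<in> polys V" by (rule vc(2)[OF b])
      have wb: "w b \<in> carrier_vec ?n'" using w(1)[OF b] by (simp add: poly_vecs_def)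
      have "(\<Sum>k<?n'. e' $ k * \<phi> $$ (k, b)) = (\<Sum>k<?n'. hcomp (ds 0 ! b) (e' $ k * w b $ k))"
      proof (rule sum.cong[OF refl])
        fix k assume "k \<in> {..<?n'}"
        then have k: "k < ?n'" by simp
        show "e' $ k * \<phi> $$ (k, b) = hcomp (ds 0 ! b) (e' $ k * w b $ k)"
          unfolding hcomp_mult[OF e'(1)[OF k]] using k b by (simp add: \<phi>_def)
      qed
      also have "\<dots> = hcomp (ds 0 ! b) (e' \<bullet> w b)"
        by (simp add: scalar_prod_sum[OF wb] hcomp_sum)
      finally have "(\<Sum>k<?n'. e' $ k * \<phi> $$ (k, b)) - e $ b = - hcomp (ds 0 ! b) (e $ b - e' \<bullet> w b)"
        using hcomp_eq_self[OF e(2)[OF b]] by (simp add: hcomp_diff)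
      moreover have "hcomp (ds 0 ! b) (e $ b - e' \<bullet> w b) \<in> I"
        using I w(2)[OF b] by (simp add: homogeneous_ideal_def)
      ultimately show "(\<Sum>k<?n'. e' $ k * \<phi> $$ (k, b)) - e $ b \<in> I"
        using ideal_uminus[OF idl] by simp
    qed
    finally show ?thesis .
  qed
  ultimately show ?thesis by (rule that)
qed

text \<open>The comparison theorem: a free module maps into an exact complex by lifting one basis
  element at a time.\<close>

lemma resolution_chain_map:
  fixes I :: "('v, 'k::field) mpoly set"
  assumes I: "homogeneous_ideal V I"
    and R: "graded_free_resolution V I ds e D" and R': "graded_free_resolution V I ds' e' D'"
  obtains \<phi> where "\<And>i. hmat V (ds' i) (ds i) (\<phi> i)" "\<And>i. D' i * \<phi> (Suc i) = \<phi> i * D i"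
    "\<And>v. v \<in> poly_vecs V (length (ds 0)) \<Longrightarrow> e' \<bullet> (\<phi> 0 *\<^sub>v v) - e \<bullet> v \<in> I"
proof -
  have idl: "ideal I (poly_ring V)" using I by (simp add: homogeneous_ideal_def)
  \<comment> \<open>The invariant includes that f sends syzygies to syzygies. This makes the columns
    of \<open>f * D i\<close> liftable along \<open>D' i\<close>, and commutation with the
    differentials restores it for the lift.\<close>
  define P where "P = (\<lambda>i f. hmat V (ds' i) (ds i) f \<and>
    (\<forall>v\<in>syzygies V I ds e D i. f *\<^sub>v v \<in> syzygies V I ds' e' D' i) \<and>
    (i = 0 \<longrightarrow> (\<forall>v\<in>poly_vecs V (length (ds 0)). e' \<bullet> (f *\<^sub>v v) - e \<bullet> v \<in> I)))"
  have "\<exists>\<phi>. \<forall>i. P i (\<phi> i) \<and> D' i * \<phi> (Suc i) = \<phi> i * D i"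
  proof (rule dependent_nat_choice)
    obtain f where f: "hmat V (ds' 0) (ds 0) f"
      "\<And>v. v \<in> poly_vecs V (length (ds 0)) \<Longrightarrow> e' \<bullet> (f *\<^sub>v v) - e \<bullet> v \<in> I"
      using resolution_lift_generators[OF I R R'] by blast
    have "f *\<^sub>v v \<in> syzygies V I ds' e' D' 0" if "v \<in> syzygies V I ds e D 0" for v
    proof -
      have v: "v \<in> poly_vecs V (length (ds 0))" "e \<bullet> v \<in> I" using that by (auto simp: syzygies_0)
      have "(e' \<bullet> (f *\<^sub>v v) - e \<bullet> v) + e \<bullet> v \<in> I" by (rule ideal_add[OF idl f(2)[OF v(1)] v(2)])
      then show ?thesis using hmat_mult_vec[OF f(1) v(1)] by (simp add: syzygies_0)
    qed
    then show "\<exists>f. P 0 f" unfolding P_def using f by blast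
  next
    fix f i assume "P i f"
    then have f: "hmat V (ds' i) (ds i) f" "\<And>v. v \<in> syzygies V I ds e D i \<Longrightarrow> f *\<^sub>v v \<in> syzygies V I ds' e' D' i"
      unfolding P_def by blast+
    have A: "hmat V (ds' i) (ds (Suc i)) (f * D i)" by (rule hmat_mult[OF f(1) resolution_hmat[OF R]])
    have "\<exists>w\<in>poly_vecs V (length (ds' (Suc i))). col (f * D i) b = D' i *\<^sub>v w" if b: "b < length (ds (Suc i))" for b
    proof -
      have "col (f * D i) b = f *\<^sub>v col (D i) b"
        by (rule col_mult2[OF hmat_carrier[OF f(1)] hmat_carrier[OF resolution_hmat[OF R]] b])
      then have "col (f * D i) b \<in> syzygies V I ds' e' D' i"
        using f(2)[OF resolution_col_syzygies[OF R b]] by simp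
      then show ?thesis using resolution_syzygiesE[OF R'] by blast
    qed
    then obtain g where g: "hmat V (ds' (Suc i)) (ds (Suc i)) g" "D' i * g = f * D i"
      using hmat_lift[OF resolution_hmat[OF R'] A] by blast
    have "g *\<^sub>v v \<in> syzygies V I ds' e' D' (Suc i)" if "v \<in> syzygies V I ds e D (Suc i)" for v
    proof -
      have v: "v \<in> poly_vecs V (length (ds (Suc i)))" "D i *\<^sub>v v = 0\<^sub>v (length (ds i))"
        using that by (auto simp: syzygies_Suc)
      then have vc: "v \<in> carrier_vec (length (ds (Suc i)))" by (simp add: poly_vecs_def)
      have "D' i *\<^sub>v (g *\<^sub>v v) = (D' i * g) *\<^sub>v v"
        by (rule assoc_mult_mat_vec[symmetric, OF hmat_carrier[OF resolution_hmat[OF R']] hmat_carrier[OF g(1)] vc])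
      also have "\<dots> = f *\<^sub>v (D i *\<^sub>v v)"
        unfolding g(2) by (rule assoc_mult_mat_vec[OF hmat_carrier[OF f(1)] hmat_carrier[OF resolution_hmat[OF R]] vc])
      also have "\<dots> = 0\<^sub>v (length (ds' i))"
        unfolding v(2) using hmat_dim[OF f(1)] by (intro eq_vecI) (simp_all add: scalar_prod_def)
      finally show ?thesis using hmat_mult_vec[OF g(1) v(1)] by (simp add: syzygies_Suc)
    qed
    then show "\<exists>g. P (Suc i) g \<and> D' i * g = f * D i" unfolding P_def using g by blast
  qed
  then obtain \<phi> where \<phi>: "\<And>i. P i (\<phi> i)" "\<And>i. D' i * \<phi> (Suc i) = \<phi> i * D i" by blast
  show ?thesis
    by (rule that[of \<phi>]) (use \<phi> in \<open>auto simp: P_def\<close>)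
qed

text \<open>A chain endomorphism that induces zero on S/I is null-homotopic. It is applied to the
  difference between a round trip through another resolution and the identity.\<close>

lemma resolution_homotopy:
  fixes I :: "('v, 'k::field) mpoly set"
  assumes R: "graded_free_resolution V I ds e D"
    and \<chi>: "\<And>i. hmat V (ds i) (ds i) (\<chi> i)" "\<And>i. D i * \<chi> (Suc i) = \<chi> i * D i"
    "\<And>v. v \<in> poly_vecs V (length (ds 0)) \<Longrightarrow> e \<bullet> (\<chi> 0 *\<^sub>v v) \<in> I"
  obtains h where "\<And>i. hmat V (ds (Suc i)) (ds i) (h i)" "\<chi> 0 = D 0 * h 0"
    "\<And>i. \<chi> (Suc i) = D (Suc i) * h (Suc i) + h i * D i"
proof -
  \<comment> \<open>The last clause says that the part of \<chi> not yet accounted for vanishes on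
    the image of \<open>D i\<close>. By commutation, \<open>\<chi> (Suc i) - h * D i\<close> then
    has syzygies as columns, which can be lifted to the next homotopy.\<close>
  define P where "P = (\<lambda>i h. hmat V (ds (Suc i)) (ds i) h \<and> (i = 0 \<longrightarrow> \<chi> 0 = D 0 * h) \<and>
    (\<chi> i - D i * h) * D i = 0\<^sub>m (length (ds i)) (length (ds (Suc i))))"
  note Dc = hmat_carrier[OF resolution_hmat[OF R]] and \<chi>c = hmat_carrier[OF \<chi>(1)]
  have "\<exists>h. \<forall>i. P i (h i) \<and> \<chi> (Suc i) = D (Suc i) * h (Suc i) + h i * D i"
  proof (rule dependent_nat_choice)
    have "\<exists>w\<in>poly_vecs V (length (ds (Suc 0))). col (\<chi> 0) b = D 0 *\<^sub>v w" if b: "b < length (ds 0)" for b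
    proof -
      have "unit_vec (length (ds 0)) b \<in> poly_vecs V (length (ds 0))"
        by (auto simp: poly_vecs_def unit_vec_def poly_ring_zero poly_ring_one)
      from \<chi>(3)[OF this] have "col (\<chi> 0) b \<in> syzygies V I ds e D 0"
        unfolding mult_mat_unit_vec[OF \<chi>c b] using hmat_col[OF \<chi>(1) b] by (simp add: syzygies_0)
      then show ?thesis using resolution_syzygiesE[OF R] by blast
    qed
    then obtain h where h: "hmat V (ds (Suc 0)) (ds 0) h" "D 0 * h = \<chi> 0"
      using hmat_lift[OF resolution_hmat[OF R] \<chi>(1)] by blast
    have "(\<chi> 0 - D 0 * h) * D 0 = 0\<^sub>m (length (ds 0)) (length (ds (Suc 0)))"
      unfolding h(2) minus_r_inv_mat[OF \<chi>c] by (rule left_mult_zero_mat[OF Dc])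
    then show "\<exists>h. P 0 h" unfolding P_def using h by auto
  next
    fix h i assume "P i h"
    then have h: "hmat V (ds (Suc i)) (ds i) h" "(\<chi> i - D i * h) * D i = 0\<^sub>m (length (ds i)) (length (ds (Suc i)))"
      unfolding P_def by blast+
    note hc = hmat_carrier[OF h(1)]
    have hD: "hmat V (ds (Suc i)) (ds (Suc i)) (h * D i)" by (rule hmat_mult[OF h(1) resolution_hmat[OF R]])
    define A where "A = \<chi> (Suc i) - h * D i"
    have A: "hmat V (ds (Suc i)) (ds (Suc i)) A" unfolding A_def by (rule hmat_minus[OF \<chi>(1) hD])
    have "D i * A = D i * \<chi> (Suc i) - D i * (h * D i)"
      unfolding A_def by (rule mult_minus_distrib_mat[OF Dc \<chi>c hmat_carrier[OF hD]])
    also have "\<dots> = \<chi> i * D i - (D i * h) * D i"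
      unfolding \<chi>(2) assoc_mult_mat[OF Dc hc Dc] ..
    also have "\<dots> = (\<chi> i - D i * h) * D i"
      by (rule minus_mult_distrib_mat[symmetric, OF \<chi>c mult_carrier_mat[OF Dc hc] Dc])
    finally have DA: "D i * A = 0\<^sub>m (length (ds i)) (length (ds (Suc i)))" unfolding h(2) .
    have "\<exists>w\<in>poly_vecs V (length (ds (Suc (Suc i)))). col A b = D (Suc i) *\<^sub>v w" if b: "b < length (ds (Suc i))" for b
    proof -
      have "D i *\<^sub>v col A b = col (D i * A) b" by (rule col_mult2[symmetric, OF Dc hmat_carrier[OF A] b])
      also have "\<dots> = 0\<^sub>v (length (ds i))" unfolding DA using b by (intro eq_vecI) auto
      finally have "col A b \<in> syzygies V I ds e D (Suc i)" using hmat_col[OF A b] by (simp add: syzygies_Suc)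
      then show ?thesis using resolution_syzygiesE[OF R] by blast
    qed
    then obtain g where g: "hmat V (ds (Suc (Suc i))) (ds (Suc i)) g" "D (Suc i) * g = A"
      using hmat_lift[OF resolution_hmat[OF R] A] by blast
    have "\<chi> (Suc i) = A + h * D i"
      unfolding A_def using hmat_dim[OF hD] hmat_dim[OF \<chi>(1)] by (intro eq_matI) auto
    moreover have "(\<chi> (Suc i) - D (Suc i) * g) * D (Suc i) = 0\<^sub>m (length (ds (Suc i))) (length (ds (Suc (Suc i))))"
    proof -
      have "\<chi> (Suc i) - D (Suc i) * g = h * D i"
        unfolding g(2) A_def using hmat_dim[OF hD] hmat_dim[OF \<chi>(1)] by (intro eq_matI) auto
      then have "(\<chi> (Suc i) - D (Suc i) * g) * D (Suc i) = h * (D i * D (Suc i))"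
        using assoc_mult_mat[OF hc Dc Dc] by simp
      then show ?thesis unfolding resolution_mult_zero[OF R] using right_mult_zero_mat[OF hc] by simp
    qed
    ultimately show "\<exists>g. P (Suc i) g \<and> \<chi> (Suc i) = D (Suc i) * g + h * D i"
      unfolding P_def using g by auto
  qed
  then obtain h where h: "\<And>i. P i (h i)" "\<And>i. \<chi> (Suc i) = D (Suc i) * h (Suc i) + h i * D i" by blast
  show ?thesis
  proof (rule that[of h])
    show "hmat V (ds (Suc i)) (ds i) (h i)" for i using h(1)[of i] by (simp add: P_def)
    show "\<chi> 0 = D 0 * h 0" using h(1)[of 0] by (simp add: P_def)
  qed (rule h(2))
qed

section \<open>Reduction to constant coefficients and the invariance of Tor\<close>

lemma const_mat_carrier: "A \<in> carrier_mat n m \<Longrightarrow> const_mat A \<in> carrier_mat n m"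
  by (simp add: const_mat_def)

lemma const_mat_entry: "A \<in> carrier_mat n m \<Longrightarrow> a < n \<Longrightarrow> b < m \<Longrightarrow> const_mat A $$ (a, b) = lookup (A $$ (a, b)) 0"
  by (simp add: const_mat_def)

lemma const_mat_mult:
  assumes A: "A \<in> carrier_mat n m" and B: "B \<in> carrier_mat m l"
  shows "const_mat (A * B) = const_mat A * const_mat B"
proof (rule eq_matI)
  fix a b assume "a < dim_row (const_mat A * const_mat B)" "b < dim_col (const_mat A * const_mat B)"
  then have ab: "a < n" "b < l" using A B by (simp_all add: const_mat_def)
  have "const_mat (A * B) $$ (a, b) = (\<Sum>k<m. lookup (A $$ (a, k)) 0 * lookup (B $$ (k, b)) 0)"
    unfolding const_mat_entry[OF mult_carrier_mat[OF A B] ab] mult_mat_entry[OF A B ab]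
    by (simp add: lookup_sum lookup_mult_0)
  also have "\<dots> = (const_mat A * const_mat B) $$ (a, b)"
    unfolding mult_mat_entry[OF const_mat_carrier[OF A] const_mat_carrier[OF B] ab]
    using ab by (intro sum.cong refl) (simp add: const_mat_entry[OF A] const_mat_entry[OF B])
  finally show "const_mat (A * B) $$ (a, b) = (const_mat A * const_mat B) $$ (a, b)" .
qed (use A B in \<open>auto simp: const_mat_def\<close>)

text \<open>An entry of nonzero degree has no constant coefficient, so after reduction only basis
  elements of equal degree are connected.\<close>

lemma const_mat_degree_part:
  assumes A: "hmat V rs cs A" and v: "v \<in> degree_part cs j"
  shows "const_mat A *\<^sub>v v \<in> degree_part rs j"
proof -
  have vc: "v \<in> carrier_vec (length cs)" using v by (simp add: degree_part_def)
  note Ac = hmat_carrier[OF A]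
  have "rs ! a = j" if a: "a < length rs" and ne: "(const_mat A *\<^sub>v v) $ a \<noteq> 0" for a
  proof -
    have "(\<Sum>b<length cs. const_mat A $$ (a, b) * v $ b) \<noteq> 0"
      using ne unfolding mult_mat_vec_entry[OF const_mat_carrier[OF Ac] vc a] .
    then obtain b where "b \<in> {..<length cs}" "const_mat A $$ (a, b) * v $ b \<noteq> 0"
      by (rule sum.not_neutral_contains_not_neutral)
    then have b: "b < length cs" "lookup (A $$ (a, b)) 0 \<noteq> 0" "v $ b \<noteq> 0"
      using const_mat_entry[OF Ac a] by auto
    have "cs ! b - rs ! a = 0" by (rule homogeneous_lookup_0[OF hmat_entry(2)[OF A a b(1)] b(2)])
    moreover have "cs ! b = j" using v b by (simp add: degree_part_def)
    ultimately show ?thesis by simp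
  qed
  then show ?thesis
    unfolding degree_part_def using mult_mat_vec_carrier[OF const_mat_carrier[OF Ac] vc] by blast
qed

lemma degree_part_eq_zero:
  assumes "v \<in> degree_part d j" "j \<notin> set d" shows "v = 0\<^sub>v (length d)"
proof (rule eq_vecI)
  fix b assume "b < dim_vec (0\<^sub>v (length d))"
  then show "v $ b = 0\<^sub>v (length d) $ b" using assms nth_mem[of b d] by (auto simp: degree_part_def)
qed (use assms in \<open>auto simp: degree_part_def\<close>)

lemma degree_part_uminus:
  assumes v: "v \<in> degree_part d j" shows "- v \<in> degree_part d j"
  unfolding degree_part_def
proof (intro CollectI conjI allI impI)
  have vc: "v \<in> carrier_vec (length d)" using v by (simp add: degree_part_def)
  then show "- v \<in> carrier_vec (length d)" by simp
  fix b assume "b < length d" "(- v) $ b \<noteq> 0"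
  then show "d ! b = j" using v vc by (simp add: degree_part_def)
qed

lemma mult_mat_uminus_vec:
  assumes A: "A \<in> carrier_mat n m" and v: "v \<in> carrier_vec m"
  shows "A *\<^sub>v (- v) = - (A *\<^sub>v v :: 'a::comm_ring_1 vec)"
proof (rule eq_vecI)
  fix i assume "i < dim_vec (- (A *\<^sub>v v))"
  then have i: "i < n" using A by simp
  have v': "- v \<in> carrier_vec m" using v by simp
  have "(A *\<^sub>v (- v)) $ i = (\<Sum>k<m. - (A $$ (i, k) * v $ k))"
    unfolding mult_mat_vec_entry[OF A v' i] using v by (intro sum.cong) auto
  also have "\<dots> = - (A *\<^sub>v v) $ i" unfolding mult_mat_vec_entry[OF A v i] by (simp add: sum_negf)
  finally show "(A *\<^sub>v (- v)) $ i = (- (A *\<^sub>v v)) $ i" using i A by simp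
qed (use A in simp)

text \<open>The composition through the second resolution is homotopic to the identity, and it vanishes in the
  degree \<open>j\<close> part of \<open>F\<^sub>i \<otimes> k\<close> because the second resolution has no generator there.\<close>

theorem tensor_homology_degree:
  fixes I :: "('v, 'k::field) mpoly set"
  assumes I: "homogeneous_ideal V I"
    and R: "graded_free_resolution V I ds e D" and R': "graded_free_resolution V I ds' e' D'"
    and j: "j \<notin> set (ds' i)"
  shows "tensor_cycles ds D i j = tensor_boundaries ds D i j"
proof
  have idl: "ideal I (poly_ring V)" using I by (simp add: homogeneous_ideal_def)
  note DH = resolution_hmat[OF R] and Dc = hmat_carrier[OF resolution_hmat[OF R]]
    and D'c = hmat_carrier[OF resolution_hmat[OF R']]
  show "tensor_boundaries ds D i j \<subseteq> tensor_cycles ds D i j"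
  proof
    fix v assume "v \<in> tensor_boundaries ds D i j"
    then obtain w where w: "w \<in> degree_part (ds (Suc i)) j" "v = const_mat (D i) *\<^sub>v w"
      by (auto simp: tensor_boundaries_def)
    have wc: "w \<in> carrier_vec (length (ds (Suc i)))" using w by (simp add: degree_part_def)
    have "const_mat (D l) *\<^sub>v v = 0\<^sub>v (length (ds l))" if i: "i = Suc l" for l
    proof -
      have "const_mat (D l) *\<^sub>v v = const_mat (D l * D (Suc l)) *\<^sub>v w"
        unfolding w(2) i const_mat_mult[OF Dc Dc]
        using assoc_mult_mat_vec[OF const_mat_carrier[OF Dc] const_mat_carrier[OF Dc]] wc i by simp
      also have "\<dots> = 0\<^sub>v (length (ds l))"
        unfolding resolution_mult_zero[OF R] using wc i
        by (intro eq_vecI) (simp_all add: const_mat_def scalar_prod_def)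
      finally show ?thesis .
    qed
    then show "v \<in> tensor_cycles ds D i j"
      using const_mat_degree_part[OF DH w(1)] by (simp add: tensor_cycles_def w(2))
  qed
  show "tensor_cycles ds D i j \<subseteq> tensor_boundaries ds D i j"
  proof
    fix v assume v: "v \<in> tensor_cycles ds D i j"
    then have vd: "v \<in> degree_part (ds i) j" by (simp add: tensor_cycles_def)
    then have vc: "v \<in> carrier_vec (length (ds i))" by (simp add: degree_part_def)
    obtain \<phi> where \<phi>: "\<And>i. hmat V (ds' i) (ds i) (\<phi> i)" "\<And>i. D' i * \<phi> (Suc i) = \<phi> i * D i"
      "\<And>v. v \<in> poly_vecs V (length (ds 0)) \<Longrightarrow> e' \<bullet> (\<phi> 0 *\<^sub>v v) - e \<bullet> v \<in> I"
      using resolution_chain_map[OF I R R'] by blast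
    obtain \<psi> where \<psi>: "\<And>i. hmat V (ds i) (ds' i) (\<psi> i)" "\<And>i. D i * \<psi> (Suc i) = \<psi> i * D' i"
      "\<And>v. v \<in> poly_vecs V (length (ds' 0)) \<Longrightarrow> e \<bullet> (\<psi> 0 *\<^sub>v v) - e' \<bullet> v \<in> I"
      using resolution_chain_map[OF I R' R] by blast
    note \<phi>c = hmat_carrier[OF \<phi>(1)] and \<psi>c = hmat_carrier[OF \<psi>(1)]
    define \<chi> where "\<chi> = (\<lambda>i. \<psi> i * \<phi> i - 1\<^sub>m (length (ds i)))"
    have \<psi>\<phi>: "hmat V (ds i) (ds i) (\<psi> i * \<phi> i)" for i by (rule hmat_mult[OF \<psi>(1) \<phi>(1)])
    have \<chi>: "hmat V (ds i) (ds i) (\<chi> i)" for i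
      unfolding \<chi>_def by (rule hmat_minus[OF \<psi>\<phi> hmat_one])
    have comm: "D i * \<chi> (Suc i) = \<chi> i * D i" for i
    proof -
      have "D i * (\<psi> (Suc i) * \<phi> (Suc i)) = (\<psi> i * D' i) * \<phi> (Suc i)"
        unfolding \<psi>(2)[symmetric] by (rule assoc_mult_mat[symmetric, OF Dc \<psi>c \<phi>c])
      also have "\<dots> = (\<psi> i * \<phi> i) * D i"
        unfolding assoc_mult_mat[OF \<psi>c D'c \<phi>c] \<phi>(2) by (rule assoc_mult_mat[symmetric, OF \<psi>c \<phi>c Dc])
      finally show ?thesis
        unfolding \<chi>_def mult_minus_distrib_mat[OF Dc hmat_carrier[OF \<psi>\<phi>] one_carrier_mat]
          minus_mult_distrib_mat[OF hmat_carrier[OF \<psi>\<phi>] one_carrier_mat Dc]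
        by (simp only: right_mult_one_mat[OF Dc] left_mult_one_mat[OF Dc])
    qed
    have aug: "e \<bullet> (\<chi> 0 *\<^sub>v u) \<in> I" if u: "u \<in> poly_vecs V (length (ds 0))" for u
    proof -
      have uc: "u \<in> carrier_vec (length (ds 0))" using u by (simp add: poly_vecs_def)
      have ec: "e \<in> carrier_vec (length (ds 0))"
        using R unfolding graded_free_resolution_def poly_vecs_def by blast
      have "\<chi> 0 *\<^sub>v u = \<psi> 0 *\<^sub>v (\<phi> 0 *\<^sub>v u) - u"
        unfolding \<chi>_def minus_mult_distrib_mat_vec[OF hmat_carrier[OF \<psi>\<phi>] one_carrier_mat uc]
          assoc_mult_mat_vec[OF \<psi>c \<phi>c uc] using uc by simp
      then have "e \<bullet> (\<chi> 0 *\<^sub>v u) = e \<bullet> (\<psi> 0 *\<^sub>v (\<phi> 0 *\<^sub>v u)) - e \<bullet> u"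
        using scalar_prod_minus_distrib[OF ec mult_mat_vec_carrier[OF \<psi>c mult_mat_vec_carrier[OF \<phi>c uc]] uc] by simp
      also have "\<dots> = (e \<bullet> (\<psi> 0 *\<^sub>v (\<phi> 0 *\<^sub>v u)) - e' \<bullet> (\<phi> 0 *\<^sub>v u)) + (e' \<bullet> (\<phi> 0 *\<^sub>v u) - e \<bullet> u)" by simp
      also have "\<dots> \<in> I" by (rule ideal_add[OF idl \<psi>(3)[OF hmat_mult_vec[OF \<phi>(1) u]] \<phi>(3)[OF u]])
      finally show ?thesis .
    qed
    obtain h where h: "\<And>i. hmat V (ds (Suc i)) (ds i) (h i)" "\<chi> 0 = D 0 * h 0"
      "\<And>i. \<chi> (Suc i) = D (Suc i) * h (Suc i) + h i * D i"
      using resolution_homotopy[OF R \<chi> comm aug] by blast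
    note hc = hmat_carrier[OF h(1)]
    have "const_mat (\<phi> i) *\<^sub>v v \<in> degree_part (ds' i) j" by (rule const_mat_degree_part[OF \<phi>(1) vd])
    then have \<phi>v: "const_mat (\<phi> i) *\<^sub>v v = 0\<^sub>v (length (ds' i))"
      using j by (rule degree_part_eq_zero)
    have "const_mat (\<chi> i) = const_mat (\<psi> i) * const_mat (\<phi> i) - 1\<^sub>m (length (ds i))"
      unfolding const_mat_mult[OF \<psi>c \<phi>c, symmetric] \<chi>_def
      using hmat_dim[OF \<psi>\<phi>] by (intro eq_matI) (auto simp: const_mat_def lookup_minus)
    then have "const_mat (\<chi> i) *\<^sub>v v = const_mat (\<psi> i) *\<^sub>v (const_mat (\<phi> i) *\<^sub>v v) - v"
      using minus_mult_distrib_mat_vec[OF mult_carrier_mat[OF const_mat_carrier[OF \<psi>c] const_mat_carrier[OF \<phi>c]] one_carrier_mat vc]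
        assoc_mult_mat_vec[OF const_mat_carrier[OF \<psi>c] const_mat_carrier[OF \<phi>c] vc] vc by simp
    also have "\<dots> = - v"
      unfolding \<phi>v using vc hmat_dim[OF \<psi>(1)] by (intro eq_vecI) (auto simp: const_mat_def scalar_prod_def)
    finally have lhs: "const_mat (\<chi> i) *\<^sub>v v = - v" .
    \<comment> \<open>Of the two terms of the homotopy only the boundary remains: the other is
      absent for i = 0 and otherwise vanishes because v is a cycle.\<close>
    have rhs: "const_mat (\<chi> i) *\<^sub>v v = const_mat (D i) *\<^sub>v (const_mat (h i) *\<^sub>v v)"
    proof (cases i)
      case 0
      then show ?thesis
        using assoc_mult_mat_vec[OF const_mat_carrier[OF Dc] const_mat_carrier[OF hc] vc]
        by (simp add: h(2) const_mat_mult[OF Dc hc])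
    next
      case (Suc l)
      have vcS: "v \<in> carrier_vec (length (ds (Suc l)))" using vc Suc by simp
      have "const_mat (\<chi> i) = const_mat (D (Suc l)) * const_mat (h (Suc l)) + const_mat (h l) * const_mat (D l)"
        unfolding Suc h(3) const_mat_mult[OF Dc hc, symmetric] const_mat_mult[OF hc Dc, symmetric]
        using hmat_dim[OF resolution_hmat[OF R]] hmat_dim[OF h(1)]
        by (intro eq_matI) (auto simp: const_mat_def lookup_add)
      then have "const_mat (\<chi> i) *\<^sub>v v = const_mat (D (Suc l)) *\<^sub>v (const_mat (h (Suc l)) *\<^sub>v v)
          + const_mat (h l) *\<^sub>v (const_mat (D l) *\<^sub>v v)"
        using add_mult_distrib_mat_vec[OF mult_carrier_mat[OF const_mat_carrier[OF Dc] const_mat_carrier[OF hc]]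
            mult_carrier_mat[OF const_mat_carrier[OF hc] const_mat_carrier[OF Dc]] vcS]
          assoc_mult_mat_vec[OF const_mat_carrier[OF Dc] const_mat_carrier[OF hc] vcS]
          assoc_mult_mat_vec[OF const_mat_carrier[OF hc] const_mat_carrier[OF Dc] vcS] by simp
      also have "const_mat (D l) *\<^sub>v v = 0\<^sub>v (length (ds l))" using v Suc by (simp add: tensor_cycles_def)
      also have "const_mat (h l) *\<^sub>v 0\<^sub>v (length (ds l)) = 0\<^sub>v (length (ds (Suc l)))"
        using hmat_dim[OF h(1)] by (intro eq_vecI) (auto simp: const_mat_def scalar_prod_def)
      finally show ?thesis
        using mult_mat_vec_carrier[OF const_mat_carrier[OF Dc] mult_mat_vec_carrier[OF const_mat_carrier[OF hc] vcS]] Suc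
        by simp
    qed
    have hv: "const_mat (h i) *\<^sub>v v \<in> degree_part (ds (Suc i)) j" by (rule const_mat_degree_part[OF h(1) vd])
    then have hvc: "const_mat (h i) *\<^sub>v v \<in> carrier_vec (length (ds (Suc i)))" by (simp add: degree_part_def)
    \<comment> \<open>As \<chi> acts on v as -1, the primitive of v is the negative of the homotopy
      applied to v.\<close>
    define u where "u = - (const_mat (h i) *\<^sub>v v)"
    have "u \<in> degree_part (ds (Suc i)) j" unfolding u_def by (rule degree_part_uminus[OF hv])
    moreover have "const_mat (D i) *\<^sub>v u = v"
    proof -
      have "const_mat (D i) *\<^sub>v u = - (const_mat (D i) *\<^sub>v (const_mat (h i) *\<^sub>v v))"
        unfolding u_def by (rule mult_mat_uminus_vec[OF const_mat_carrier[OF Dc] hvc])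
      also have "\<dots> = v" unfolding rhs[symmetric] lhs using vc by simp
      finally show ?thesis .
    qed
    ultimately show "v \<in> tensor_boundaries ds D i j" unfolding tensor_boundaries_def by blast
  qed
qed

section \<open>The Taylor resolution\<close>

text \<open>Generators are indexed by numbers so that \<open>ksign\<close> has an order to refer
  to.\<close>

locale taylor =
  fixes V :: "nat set" and n :: nat and g :: "nat \<Rightarrow> nat set"
  assumes finite_V: "finite V" and g_subset: "\<And>h. h < n \<Longrightarrow> g h \<subseteq> V"
begin

text \<open>The support of the least common multiple of the generators in \<sigma>. Quotients of
  such multiples are the squarefree monomials on differences of these sets.\<close>

definition U :: "nat set \<Rightarrow> nat set" where
  "U \<sigma> = \<Union> (g ` \<sigma>)"

lemma U_insert: "U (insert h \<sigma>) = g h \<union> U \<sigma>"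
  by (simp add: U_def)

lemma U_empty [simp]: "U {} = {}"
  by (simp add: U_def)

lemma U_mono: "\<sigma> \<subseteq> \<tau> \<Longrightarrow> U \<sigma> \<subseteq> U \<tau>"
  by (auto simp: U_def)

lemma U_subset: "\<sigma> \<subseteq> {..<n} \<Longrightarrow> U \<sigma> \<subseteq> V"
  unfolding U_def using g_subset by blast

lemma finite_U: "\<sigma> \<subseteq> {..<n} \<Longrightarrow> finite (U \<sigma>)"
  using U_subset finite_V finite_subset by blast

text \<open>The Taylor differential, written by target: the component at \<sigma> collects the
  contributions of all faces with one more element. This is the shape of a matrix row.\<close>

definition tdiff :: "(nat set \<Rightarrow> (nat, 'k::comm_ring_1) mpoly) \<Rightarrow> nat set \<Rightarrow> (nat, 'k) mpoly" where
  "tdiff w \<sigma> = (\<Sum>h\<in>{..<n} - \<sigma>. ksign h \<sigma> * sqf_monom (U (insert h \<sigma>) - U \<sigma>) * w (insert h \<sigma>))"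

text \<open>Inserting h and k in either order yields the same quotient of least common multiples,
  because the two factors telescope. Only the signs differ, and they are opposite.\<close>

lemma tdiff_tdiff:
  fixes w :: "nat set \<Rightarrow> (nat, 'k::comm_ring_1) mpoly"
  assumes \<sigma>: "\<sigma> \<subseteq> {..<n}" shows "tdiff (tdiff w) \<sigma> = 0"
proof -
  have fin: "finite \<sigma>" using \<sigma> finite_subset by blast
  define f where "f = (\<lambda>h k. ksign h \<sigma> * sqf_monom (U (insert h \<sigma>) - U \<sigma>) *
    (ksign k (insert h \<sigma>) * sqf_monom (U (insert k (insert h \<sigma>)) - U (insert h \<sigma>)) * w (insert k (insert h \<sigma>))))"
  have f: "f h k = (ksign h \<sigma> * ksign k (insert h \<sigma>)) * (sqf_monom (U (insert h (insert k \<sigma>)) - U \<sigma>) * w (insert h (insert k \<sigma>)))"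
    if hk: "h \<in> {..<n} - \<sigma>" "k \<in> {..<n} - \<sigma>" for h k
  proof -
    have sub: "U \<sigma> \<subseteq> U (insert h \<sigma>)" "U (insert h \<sigma>) \<subseteq> U (insert k (insert h \<sigma>))" by (rule U_mono; blast)+
    have fU: "finite (U (insert h \<sigma>) - U \<sigma>)" "finite (U (insert k (insert h \<sigma>)) - U (insert h \<sigma>))"
      using hk \<sigma> by (intro finite_Diff finite_U; simp)+
    have "sqf_monom (U (insert h \<sigma>) - U \<sigma>) * sqf_monom (U (insert k (insert h \<sigma>)) - U (insert h \<sigma>))
        = (sqf_monom ((U (insert h \<sigma>) - U \<sigma>) \<union> (U (insert k (insert h \<sigma>)) - U (insert h \<sigma>))) :: (nat, 'k) mpoly)"
      by (rule monom_mult_disjoint[OF fU]) blast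
    moreover have "(U (insert h \<sigma>) - U \<sigma>) \<union> (U (insert k (insert h \<sigma>)) - U (insert h \<sigma>)) = U (insert k (insert h \<sigma>)) - U \<sigma>"
      using sub by blast
    ultimately have m: "sqf_monom (U (insert h \<sigma>) - U \<sigma>) * sqf_monom (U (insert k (insert h \<sigma>)) - U (insert h \<sigma>))
        = (sqf_monom (U (insert k (insert h \<sigma>)) - U \<sigma>) :: (nat, 'k) mpoly)" by simp
    have "f h k = (ksign h \<sigma> * ksign k (insert h \<sigma>)) * ((sqf_monom (U (insert h \<sigma>) - U \<sigma>) *
      sqf_monom (U (insert k (insert h \<sigma>)) - U (insert h \<sigma>))) * w (insert k (insert h \<sigma>)))"
      unfolding f_def by (simp only: ac_simps)
    then show ?thesis using m by (simp only: insert_commute[of k h])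
  qed
  have anti: "f h k = - f k h" if hk: "h \<in> {..<n} - \<sigma>" "k \<in> {..<n} - \<sigma>" "h \<noteq> k" for h k
  proof -
    have s: "ksign h \<sigma> * ksign k (insert h \<sigma>) = - (ksign k \<sigma> * ksign h (insert k \<sigma>) :: (nat, 'k) mpoly)"
      using hk by (intro ksign_swap[OF fin]) auto
    show ?thesis unfolding f[OF hk(1,2)] f[OF hk(2,1)] insert_commute[of k h] s by simp
  qed
  have "(\<Sum>h\<in>{..<n} - \<sigma>. \<Sum>k\<in>{..<n} - \<sigma> - {h}. f h k) = 0"
    by (rule sum_antisym_eq_0[OF finite_Diff[OF finite_lessThan] anti])
  then show ?thesis unfolding tdiff_def f_def sum_distrib_left Diff_insert[of _ _ \<sigma>] .
qed

section \<open>Multigraded strands and the contracting homotopy\<close>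

text \<open>The part of w in multidegree m. The basis element \<sigma> has multidegree
  \<open>sqf (U \<sigma>)\<close>, so its coefficient sits at the difference; subtraction of
  exponents is truncated, whence the test on supports.\<close>

definition strand :: "(nat set \<Rightarrow> (nat, 'k::comm_ring_1) mpoly) \<Rightarrow> (nat \<Rightarrow>\<^sub>0 nat) \<Rightarrow> nat set \<Rightarrow> 'k" where
  "strand w m \<sigma> = (if U \<sigma> \<subseteq> keys m then lookup (w \<sigma>) (m - sqf (U \<sigma>)) else 0)"

lemma lookup_sqf_monom_mult:
  assumes "finite A"
  shows "lookup (sqf_monom A * p) q = (if A \<subseteq> keys q then lookup p (q - sqf A) else 0)"
proof (cases "A \<subseteq> keys q")
  case True
  then show ?thesis
    using lookup_single_mult[of "sqf A" 1 p "q - sqf A"] sqf_add_diff[OF assms True] by (simp add: sqf_monom_def)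
next
  case False
  have "q \<notin> keys (sqf_monom A * p)"
    using keys_single_mult[of q "sqf A" 1 p] sqf_adds_iff[OF assms, of q] False unfolding sqf_monom_def by blast
  then show ?thesis using False by (simp add: in_keys_iff)
qed

text \<open>Multiplication by a quotient of least common multiples only moves coefficients within a
  multidegree. On strands the monomials disappear and the signed simplicial boundary is
  left.\<close>

lemma lookup_tdiff:
  assumes \<sigma>: "\<sigma> \<subseteq> {..<n}" "U \<sigma> \<subseteq> keys m"
  shows "lookup (tdiff w \<sigma>) (m - sqf (U \<sigma>)) = (\<Sum>h\<in>{..<n} - \<sigma>. ksign h \<sigma> * strand w m (insert h \<sigma>))"
  unfolding tdiff_def lookup_sum
proof (rule sum.cong[OF refl])
  fix h assume h: "h \<in> {..<n} - \<sigma>"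
  have fin: "finite (U \<sigma>)" "finite (U (insert h \<sigma>))" using \<sigma> h by (intro finite_U; simp)+
  have sub: "U \<sigma> \<subseteq> U (insert h \<sigma>)" by (rule U_mono) blast
  let ?A = "U (insert h \<sigma>) - U \<sigma>"
  have k: "?A \<subseteq> keys (m - sqf (U \<sigma>)) \<longleftrightarrow> U (insert h \<sigma>) \<subseteq> keys m"
  proof -
    have "v \<in> keys (m - sqf (U \<sigma>)) \<longleftrightarrow> v \<in> keys m" if "v \<in> ?A" for v
      using that fin by (simp add: in_keys_iff lookup_minus lookup_sqf)
    then show ?thesis using \<sigma>(2) sub by blast
  qed
  have d: "m - sqf (U \<sigma>) - sqf ?A = m - sqf (U (insert h \<sigma>))"
    using fin sub by (intro poly_mapping_eqI) (auto simp: lookup_minus lookup_sqf)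
  have "lookup (sqf_monom ?A * w (insert h \<sigma>)) (m - sqf (U \<sigma>)) = strand w m (insert h \<sigma>)"
    using fin by (simp add: lookup_sqf_monom_mult k d strand_def)
  then show "lookup (ksign h \<sigma> * sqf_monom ?A * w (insert h \<sigma>)) (m - sqf (U \<sigma>)) = ksign h \<sigma> * strand w m (insert h \<sigma>)"
    unfolding ksign_def mult.assoc lookup_neg_one_power_mult by simp
qed

text \<open>In each multidegree the complex is the chain complex of a full simplex; the contraction inserts
  the first generator dividing the given multidegree.\<close>

definition first_gen :: "(nat \<Rightarrow>\<^sub>0 nat) \<Rightarrow> nat" where
  "first_gen m = (LEAST h. h < n \<and> g h \<subseteq> keys m)"

definition thom_coeff :: "(nat set \<Rightarrow> (nat, 'k::comm_ring_1) mpoly) \<Rightarrow> nat set \<Rightarrow> (nat \<Rightarrow>\<^sub>0 nat) \<Rightarrow> 'k" where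
  "thom_coeff w \<tau> m = (if first_gen m \<in> \<tau>
    then ksign (first_gen m) (\<tau> - {first_gen m}) * strand w m (\<tau> - {first_gen m}) else 0)"

text \<open>The contraction assembled from all strands: the coefficient of \<open>q\<close> in the
  component \<tau> belongs to multidegree \<open>q + sqf (U \<tau>)\<close>.\<close>

definition thom :: "(nat set \<Rightarrow> (nat, 'k::comm_ring_1) mpoly) \<Rightarrow> nat set \<Rightarrow> (nat, 'k) mpoly" where
  "thom w \<tau> = Abs_poly_mapping (\<lambda>q. thom_coeff w \<tau> (q + sqf (U \<tau>)))"

lemma thom_coeff_support:
  assumes "thom_coeff w \<tau> (q + sqf (U \<tau>)) \<noteq> 0"
  obtains h k where "h \<in> \<tau>" "k \<in> keys (w (\<tau> - {h}))" "U (\<tau> - {h}) \<subseteq> keys (q + sqf (U \<tau>))"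
    "k = q + sqf (U \<tau>) - sqf (U (\<tau> - {h}))"
proof -
  let ?h = "first_gen (q + sqf (U \<tau>))"
  have h: "?h \<in> \<tau>" using assms unfolding thom_coeff_def by presburger
  have s: "strand w (q + sqf (U \<tau>)) (\<tau> - {?h}) \<noteq> 0" using assms h unfolding thom_coeff_def by auto
  then have sub: "U (\<tau> - {?h}) \<subseteq> keys (q + sqf (U \<tau>))" unfolding strand_def by presburger
  then have "q + sqf (U \<tau>) - sqf (U (\<tau> - {?h})) \<in> keys (w (\<tau> - {?h}))"
    using s unfolding strand_def in_keys_iff by simp
  then show ?thesis using that[OF h _ sub refl] by blast
qed

text \<open>The support is finite, since every nonzero coefficient comes from a term of
  \<open>w (\<tau> - {h})\<close> for some h in \<tau> and is determined by that term and h.\<close>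

lemma lookup_thom:
  assumes \<tau>: "\<tau> \<subseteq> {..<n}"
  shows "lookup (thom w \<tau>) q = thom_coeff w \<tau> (q + sqf (U \<tau>))"
proof -
  let ?S = "{q. thom_coeff w \<tau> (q + sqf (U \<tau>)) \<noteq> 0}"
  have "?S \<subseteq> (\<Union>h\<in>\<tau>. (\<lambda>k. k + sqf (U (\<tau> - {h})) - sqf (U \<tau>)) ` keys (w (\<tau> - {h})))"
  proof
    fix q assume "q \<in> ?S"
    then obtain h k where hk: "h \<in> \<tau>" "k \<in> keys (w (\<tau> - {h}))" "U (\<tau> - {h}) \<subseteq> keys (q + sqf (U \<tau>))"
      "k = q + sqf (U \<tau>) - sqf (U (\<tau> - {h}))"
      using thom_coeff_support[of w \<tau> q] by blast
    have "finite (U (\<tau> - {h}))" using \<tau> by (intro finite_U) auto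
    then have "k + sqf (U (\<tau> - {h})) = q + sqf (U \<tau>)"
      using sqf_add_diff[OF _ hk(3)] hk(4) by (simp add: add.commute)
    then have "q = k + sqf (U (\<tau> - {h})) - sqf (U \<tau>)" by simp
    then show "q \<in> (\<Union>h\<in>\<tau>. (\<lambda>k. k + sqf (U (\<tau> - {h})) - sqf (U \<tau>)) ` keys (w (\<tau> - {h})))"
      using hk(1,2) by blast
  qed
  moreover have "finite \<tau>" using \<tau> finite_subset by blast
  ultimately have "finite ?S" using finite_subset by fastforce
  then show ?thesis unfolding thom_def by simp
qed

lemma thom_closed:
  assumes \<tau>: "\<tau> \<subseteq> {..<n}" and w: "\<And>\<sigma>. w \<sigma> \<in> polys V"
  shows "thom w \<tau> \<in> polys V"
  unfolding carrier_poly_ring_iff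
proof
  fix q assume "q \<in> keys (thom w \<tau>)"
  then have "thom_coeff w \<tau> (q + sqf (U \<tau>)) \<noteq> 0" unfolding in_keys_iff lookup_thom[OF \<tau>] .
  then obtain h k where hk: "h \<in> \<tau>" "k \<in> keys (w (\<tau> - {h}))" "U (\<tau> - {h}) \<subseteq> keys (q + sqf (U \<tau>))"
      "k = q + sqf (U \<tau>) - sqf (U (\<tau> - {h}))"
    by (rule thom_coeff_support)
  have fin: "finite (U (\<tau> - {h}))" using \<tau> by (intro finite_U) auto
  then have "q + sqf (U \<tau>) = sqf (U (\<tau> - {h})) + k"
    using sqf_add_diff[OF _ hk(3)] hk(4) by simp
  then have "keys (q + sqf (U \<tau>)) = U (\<tau> - {h}) \<union> keys k" by (simp only: keys_add_nat keys_sqf[OF fin])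
  moreover have "U (\<tau> - {h}) \<subseteq> V" using \<tau> by (intro U_subset) auto
  moreover have "keys k \<subseteq> V" using w[of "\<tau> - {h}"] hk(2) unfolding carrier_poly_ring_iff by blast
  ultimately show "keys q \<subseteq> V" unfolding keys_add_nat by blast
qed

lemma first_gen:
  assumes "h < n" "g h \<subseteq> keys m"
  shows "first_gen m < n" "g (first_gen m) \<subseteq> keys m"
  using LeastI[of "\<lambda>h. h < n \<and> g h \<subseteq> keys m" h] assms by (simp_all add: first_gen_def)

text \<open>A generator dividing m is assumed because \<open>first_gen\<close> is otherwise the
  least element of an empty set. If \<tau> leaves the support of m, this is not due to the first
  generator, so the face without it leaves the support too and both sides are 0.\<close>

lemma strand_thom:
  assumes \<tau>: "\<tau> \<subseteq> {..<n}" and h: "h < n" "g h \<subseteq> keys m"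
  shows "strand (thom w) m \<tau> = thom_coeff w \<tau> m"
proof (cases "U \<tau> \<subseteq> keys m")
  case True
  then show ?thesis
    using sqf_add_diff[OF finite_U[OF \<tau>] True] by (simp add: strand_def lookup_thom[OF \<tau>] add.commute)
next
  case False
  have "thom_coeff w \<tau> m = 0"
  proof (cases "first_gen m \<in> \<tau>")
    case True
    then have "U \<tau> = g (first_gen m) \<union> U (\<tau> - {first_gen m})" by (metis U_insert insert_Diff)
    then have "\<not> U (\<tau> - {first_gen m}) \<subseteq> keys m" using False first_gen[OF h] by blast
    then show ?thesis by (simp add: thom_coeff_def strand_def)
  qed (simp add: thom_coeff_def)
  then show ?thesis using False by (simp add: strand_def)
qed

text \<open>Compared one multidegree at a time. If some generator divides the multidegree, the
  strand belongs to a nonempty simplex and inserting the first vertex contracts it; if none does,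
  membership of \<open>w {}\<close> in the ideal takes over.\<close>

lemma tdiff_thom:
  fixes w :: "nat set \<Rightarrow> (nat, 'k::comm_ring_1) mpoly"
  assumes \<sigma>: "\<sigma> \<subseteq> {..<n}"
    and cycle: "\<And>h. h \<in> \<sigma> \<Longrightarrow> tdiff w (\<sigma> - {h}) = 0"
    and ideal: "\<sigma> = {} \<Longrightarrow> w \<sigma> \<in> sqf_ideal V (g ` {..<n})"
  shows "tdiff (thom w) \<sigma> = w \<sigma>"
proof (rule poly_mapping_eqI)
  fix q
  have fin\<sigma>: "finite \<sigma>" using \<sigma> finite_subset by blast
  define m where "m = q + sqf (U \<sigma>)"
  have q: "q = m - sqf (U \<sigma>)" by (simp add: m_def)
  have U\<sigma>: "U \<sigma> \<subseteq> keys m" unfolding m_def keys_add_nat keys_sqf[OF finite_U[OF \<sigma>]] by blast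
  have strand\<sigma>: "lookup (w \<sigma>) q = strand w m \<sigma>" using U\<sigma> by (simp add: strand_def q)
  have lhs: "lookup (tdiff (thom w) \<sigma>) q = (\<Sum>h\<in>{..<n} - \<sigma>. ksign h \<sigma> * strand (thom w) m (insert h \<sigma>))"
    unfolding q by (rule lookup_tdiff[OF \<sigma> U\<sigma>])
  show "lookup (tdiff (thom w) \<sigma>) q = lookup (w \<sigma>) q"
  proof (cases "\<exists>h<n. g h \<subseteq> keys m")
    case True
    then obtain h where h: "h < n" "g h \<subseteq> keys m" by blast
    define c where "c = first_gen m"
    have c: "c < n" unfolding c_def by (rule first_gen(1)[OF h])
    have lhs': "lookup (tdiff (thom w) \<sigma>) q = (\<Sum>h\<in>{..<n} - \<sigma>. ksign h \<sigma> * thom_coeff w (insert h \<sigma>) m)"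
      unfolding lhs using \<sigma> by (intro sum.cong refl arg_cong2[of _ _ _ _ "(*)"] strand_thom[OF _ h]) auto
    show ?thesis
    proof (cases "c \<in> \<sigma>")
      case False
      \<comment> \<open>The contraction at \<open>insert h \<sigma>\<close> is nonzero only if that
        face contains c, which leaves h = c.\<close>
      have "ksign h \<sigma> * thom_coeff w (insert h \<sigma>) m = (if h = c then strand w m \<sigma> else 0)" for h
        using False by (auto simp: thom_coeff_def c_def[symmetric])
      then show ?thesis unfolding lhs' strand\<sigma> using False c by simp
    next
      case True
      define \<rho> where "\<rho> = \<sigma> - {c}"
      have \<rho>: "c \<notin> \<rho>" "\<sigma> = insert c \<rho>" "\<rho> \<subseteq> {..<n}" "finite \<rho>" using True \<sigma> fin\<sigma> by (auto simp: \<rho>_def)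
      have "U \<rho> \<subseteq> keys m" using U\<sigma> U_mono[of \<rho> \<sigma>] by (auto simp: \<rho>_def)
      \<comment> \<open>The cycle condition at \<rho> expresses the strand at \<sigma> through the
        strands at the faces \<open>insert h \<rho>\<close>, which are exactly those that the
        contraction brings in.\<close>
      then have "0 = (\<Sum>h\<in>{..<n} - \<rho>. ksign h \<rho> * strand w m (insert h \<rho>))"
        using lookup_tdiff[OF \<rho>(3), of m w] cycle[OF True] by (simp add: \<rho>_def)
      also have "{..<n} - \<rho> = insert c ({..<n} - \<sigma>)" using c \<rho> by auto
      finally have z: "(\<Sum>h\<in>{..<n} - \<sigma>. ksign h \<rho> * strand w m (insert h \<rho>)) = - (ksign c \<rho> * strand w m \<sigma>)"
        using True by (simp add: \<rho>(2)[symmetric] eq_neg_iff_add_eq_0 add.commute)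
      have "ksign h \<sigma> * thom_coeff w (insert h \<sigma>) m = - ksign c \<rho> * (ksign h \<rho> * strand w m (insert h \<rho>))"
        if h: "h \<in> {..<n} - \<sigma>" for h
      proof -
        have hc: "c \<noteq> h" "h \<notin> \<rho>" using h \<rho> by auto
        have eq: "insert h \<sigma> - {c} = insert h \<rho>" using hc \<rho> by auto
        have "thom_coeff w (insert h \<sigma>) m = ksign c (insert h \<rho>) * strand w m (insert h \<rho>)"
          using True by (simp add: thom_coeff_def c_def[symmetric] eq)
        then have "ksign h \<sigma> * thom_coeff w (insert h \<sigma>) m
            = ksign h (insert c \<rho>) * ksign c (insert h \<rho>) * strand w m (insert h \<rho>)"
          by (simp add: \<rho>(2)[symmetric] mult.assoc)
        then show ?thesis unfolding ksign_swap'[OF \<rho>(4) hc(1) \<rho>(1) hc(2)] by (simp add: mult.assoc)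
      qed
      then have "lookup (tdiff (thom w) \<sigma>) q
          = (\<Sum>h\<in>{..<n} - \<sigma>. - ksign c \<rho> * (ksign h \<rho> * strand w m (insert h \<rho>)))"
        unfolding lhs' by (intro sum.cong refl)
      also have "\<dots> = - ksign c \<rho> * (- (ksign c \<rho> * strand w m \<sigma>))"
        unfolding sum_distrib_left[symmetric] z ..
      finally show ?thesis unfolding strand\<sigma> by simp
    qed
  next
    case False
    have "strand (thom w) m (insert h \<sigma>) = 0" if "h \<in> {..<n} - \<sigma>" for h
      using False that by (auto simp: strand_def U_insert)
    then have "lookup (tdiff (thom w) \<sigma>) q = 0" unfolding lhs by simp
    \<comment> \<open>The multidegree is a multiple of every generator in \<sigma>, so no generator
      can be in \<sigma>.\<close>
    moreover have "\<sigma> = {}"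
    proof (rule ccontr)
      assume "\<sigma> \<noteq> {}"
      then obtain h where "h \<in> \<sigma>" by blast
      then show False using False U\<sigma> \<sigma> by (auto simp: U_def)
    qed
    moreover have "lookup (w \<sigma>) q = 0"
    proof (rule ccontr)
      assume "lookup (w \<sigma>) q \<noteq> 0"
      then obtain e where "e \<in> g ` {..<n}" "e \<subseteq> keys q"
        using sqf_ideal_lookup[OF ideal[OF \<open>\<sigma> = {}\<close>]] by blast
      then show False using False by (auto simp: m_def keys_add_nat)
    qed
    ultimately show ?thesis by simp
  qed
qed

lemma tdiff_empty_in_ideal:
  assumes "\<And>\<sigma>. w \<sigma> \<in> polys V"
  shows "tdiff w {} \<in> sqf_ideal V (g ` {..<n})"
  unfolding tdiff_def
proof (rule ideal_sum[OF ideal_sqf_ideal])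
  fix h assume h: "h \<in> {..<n} - {}"
  have "sqf_monom (g h) \<in> sqf_ideal V (g ` {..<n})"
    using h g_subset[of h] finite_V finite_subset by (intro monom_in_sqf_ideal[of _ _ "g h"]) auto
  then have "(ksign h {} * w {h}) * sqf_monom (g h) \<in> sqf_ideal V (g ` {..<n})"
    by (rule ideal_mult[OF ideal_sqf_ideal]) (intro poly_ring_mult poly_ring_ksign assms)
  then show "ksign h {} * sqf_monom (U {h} - U {}) * w {h} \<in> sqf_ideal V (g ` {..<n})"
    by (simp add: U_insert ac_simps)
qed

section \<open>The Taylor complex in matrix form\<close>

definition faces :: "nat \<Rightarrow> nat set list" where
  "faces i = (SOME xs. set xs = {\<sigma>. \<sigma> \<subseteq> {..<n} \<and> card \<sigma> = i} \<and> distinct xs)"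

lemma faces: "distinct (faces i)" "set (faces i) = {\<sigma>. \<sigma> \<subseteq> {..<n} \<and> card \<sigma> = i}"
proof -
  have "finite {\<sigma>. \<sigma> \<subseteq> {..<n} \<and> card \<sigma> = i}" by (rule finite_subset[of _ "Pow {..<n}"]) auto
  then have "\<exists>xs. set xs = {\<sigma>. \<sigma> \<subseteq> {..<n} \<and> card \<sigma> = i} \<and> distinct xs"
    by (rule finite_distinct_list)
  then have *: "set (faces i) = {\<sigma>. \<sigma> \<subseteq> {..<n} \<and> card \<sigma> = i} \<and> distinct (faces i)"
    unfolding faces_def by (rule someI_ex)
  show "distinct (faces i)" by (rule conjunct2[OF *])
  show "set (faces i) = {\<sigma>. \<sigma> \<subseteq> {..<n} \<and> card \<sigma> = i}" by (rule conjunct1[OF *])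
qed

lemma faces_nth: "a < length (faces i) \<Longrightarrow> faces i ! a \<subseteq> {..<n}" "a < length (faces i) \<Longrightarrow> card (faces i ! a) = i"
  using nth_mem[of a "faces i"] by (auto simp: faces(2))

lemma faces_0: "faces 0 = [{}]"
proof -
  have "\<sigma> = {}" if "\<sigma> \<subseteq> {..<n}" "card \<sigma> = 0" for \<sigma>
    using that finite_subset[OF that(1)] by simp
  then have s: "set (faces 0) = {{}}" unfolding faces(2) by auto
  then have "length (faces 0) = 1" using distinct_card[OF faces(1)[of 0]] by simp
  then obtain x where "faces 0 = [x]" by (auto simp: length_Suc_conv)
  then show ?thesis using s by simp
qed

definition taylor_degs :: "nat \<Rightarrow> int list" where
  "taylor_degs i = map (\<lambda>\<sigma>. int (card (U \<sigma>))) (faces i)"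

text \<open>At most one summand is nonzero: the sum picks out the unique element by which \<tau>
  exceeds \<sigma>, if there is exactly one.\<close>

definition tcoeff :: "nat set \<Rightarrow> nat set \<Rightarrow> (nat, 'k::comm_ring_1) mpoly" where
  "tcoeff \<sigma> \<tau> = (\<Sum>h\<in>\<tau> - \<sigma>. if \<tau> = insert h \<sigma> then ksign h \<sigma> * sqf_monom (U \<tau> - U \<sigma>) else 0)"

definition taylor_mat :: "nat \<Rightarrow> (nat, 'k::comm_ring_1) mpoly mat" where
  "taylor_mat i = mat (length (faces i)) (length (faces (Suc i))) (\<lambda>(a, b). tcoeff (faces i ! a) (faces (Suc i) ! b))"

lemma taylor_degs_length [simp]: "length (taylor_degs i) = length (faces i)"
  by (simp add: taylor_degs_def)

lemma tcoeff_insert: "h \<notin> \<sigma> \<Longrightarrow> tcoeff \<sigma> (insert h \<sigma>) = ksign h \<sigma> * sqf_monom (U (insert h \<sigma>) - U \<sigma>)"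
  by (simp add: tcoeff_def insert_Diff_if)

lemma tcoeff_cases:
  obtains h where "h \<notin> \<sigma>" "\<tau> = insert h \<sigma>" | "(tcoeff \<sigma> \<tau> :: (nat, 'k::comm_ring_1) mpoly) = 0"
proof (cases "\<exists>h. h \<notin> \<sigma> \<and> \<tau> = insert h \<sigma>")
  case False
  then have "(tcoeff \<sigma> \<tau> :: (nat, 'k) mpoly) = 0" unfolding tcoeff_def by (intro sum.neutral) auto
  then show ?thesis by (rule that(2))
qed (use that(1) in blast)

lemma homogeneous_sqf_monom: "finite A \<Longrightarrow> homogeneous (int (card A)) (sqf_monom A)"
  by (simp add: homogeneous_def sqf_monom_def mdeg_sqf)

lemma homogeneous_ksign_mult: "homogeneous d p \<Longrightarrow> homogeneous d (ksign h \<sigma> * p)"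
  by (cases "even (card {k \<in> \<sigma>. k < h})") (simp_all add: ksign_def homogeneous_uminus)

lemma taylor_hmat:
  "hmat V (taylor_degs i) (taylor_degs (Suc i)) (taylor_mat i :: (nat, 'k::comm_ring_1) mpoly mat)"
  unfolding hmat_def
proof (intro conjI allI impI)
  fix a b assume ab: "a < length (taylor_degs i)" "b < length (taylor_degs (Suc i))"
  let ?\<sigma> = "faces i ! a" and ?\<tau> = "faces (Suc i) ! b"
  have entry: "(taylor_mat i :: (nat, 'k) mpoly mat) $$ (a, b) = tcoeff ?\<sigma> ?\<tau>" using ab by (simp add: taylor_mat_def)
  have sub: "?\<sigma> \<subseteq> {..<n}" "?\<tau> \<subseteq> {..<n}" using ab by (auto intro!: faces_nth)
  have "(tcoeff ?\<sigma> ?\<tau> :: (nat, 'k) mpoly) \<in> polys V \<and>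
    homogeneous (int (card (U ?\<tau>)) - int (card (U ?\<sigma>))) (tcoeff ?\<sigma> ?\<tau> :: (nat, 'k) mpoly)"
  proof (cases rule: tcoeff_cases[of ?\<sigma> ?\<tau>, where ?'k = 'k])
    case (1 h)
    have le: "U ?\<sigma> \<subseteq> U ?\<tau>" unfolding 1(2) by (rule U_mono) blast
    have fin: "finite (U ?\<tau> - U ?\<sigma>)" "finite (U ?\<tau>)" using finite_U[OF sub(2)] by auto
    have "int (card (U ?\<tau>)) - int (card (U ?\<sigma>)) = int (card (U ?\<tau> - U ?\<sigma>))"
      using le fin by (simp add: card_Diff_subset finite_subset card_mono of_nat_diff)
    moreover have "sqf_monom (U ?\<tau> - U ?\<sigma>) \<in> polys V"
      using U_subset[OF sub(2)] fin(1) by (intro poly_ring_monom) auto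
    ultimately show ?thesis
      using homogeneous_ksign_mult[OF homogeneous_sqf_monom[OF fin(1)]] tcoeff_insert[OF 1(1)] poly_ring_mult[OF poly_ring_ksign]
      unfolding 1(2)[symmetric] by metis
  next
    case 2
    then show ?thesis by (simp add: homogeneous_0)
  qed
  then show "(taylor_mat i :: (nat, 'k) mpoly mat) $$ (a, b) \<in> polys V"
    "homogeneous (taylor_degs (Suc i) ! b - taylor_degs i ! a) (taylor_mat i $$ (a, b) :: (nat, 'k) mpoly)"
    using ab by (simp_all add: entry taylor_degs_def)
qed (simp add: taylor_mat_def)

text \<open>The bridge between the matrices that a resolution consists of and functions on faces,
  for which exactness has been computed. In row \<sigma> only the faces
  \<open>insert h \<sigma>\<close> contribute.\<close>

lemma taylor_mat_mult_vec:
  fixes u :: "nat set \<Rightarrow> (nat, 'k::comm_ring_1) mpoly"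
  assumes v: "v \<in> carrier_vec (length (faces (Suc i)))" "\<And>b. b < length (faces (Suc i)) \<Longrightarrow> v $ b = u (faces (Suc i) ! b)"
    and a: "a < length (faces i)"
  shows "(taylor_mat i *\<^sub>v v) $ a = tdiff u (faces i ! a)"
proof -
  let ?\<sigma> = "faces i ! a" and ?F = "faces (Suc i)"
  have \<sigma>: "?\<sigma> \<subseteq> {..<n}" "card ?\<sigma> = i" using faces_nth[OF a] by auto
  then have fin: "finite ?\<sigma>" using finite_subset by blast
  have c: "(taylor_mat i :: (nat, 'k) mpoly mat) \<in> carrier_mat (length (faces i)) (length ?F)" by (simp add: taylor_mat_def)
  have "(taylor_mat i *\<^sub>v v) $ a = (\<Sum>b<length ?F. tcoeff ?\<sigma> (?F ! b) * u (?F ! b))"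
    unfolding mult_mat_vec_entry[OF c v(1) a] using a by (intro sum.cong) (auto simp: taylor_mat_def v(2))
  also have "\<dots> = (\<Sum>\<tau>\<in>set ?F. tcoeff ?\<sigma> \<tau> * u \<tau>)"
    by (rule sum.reindex_bij_betw[OF bij_betw_nth[OF faces(1) refl refl]])
  also have "\<dots> = (\<Sum>\<tau>\<in>(\<lambda>h. insert h ?\<sigma>) ` ({..<n} - ?\<sigma>). tcoeff ?\<sigma> \<tau> * u \<tau>)"
  proof (rule sum.mono_neutral_right)
    show "(\<lambda>h. insert h ?\<sigma>) ` ({..<n} - ?\<sigma>) \<subseteq> set ?F" using \<sigma> fin by (auto simp: faces(2))
    show "\<forall>\<tau>\<in>set ?F - (\<lambda>h. insert h ?\<sigma>) ` ({..<n} - ?\<sigma>). tcoeff ?\<sigma> \<tau> * u \<tau> = 0"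
    proof
      fix \<tau> assume \<tau>: "\<tau> \<in> set ?F - (\<lambda>h. insert h ?\<sigma>) ` ({..<n} - ?\<sigma>)"
      then have "\<tau> \<subseteq> {..<n}" by (auto simp: faces(2))
      with \<tau> show "tcoeff ?\<sigma> \<tau> * u \<tau> = 0"
        by (cases rule: tcoeff_cases[of ?\<sigma> \<tau>, where ?'k = 'k]) auto
    qed
  qed simp
  also have "\<dots> = (\<Sum>h\<in>{..<n} - ?\<sigma>. tcoeff ?\<sigma> (insert h ?\<sigma>) * u (insert h ?\<sigma>))"
  proof (rule sum.reindex_cong[OF _ refl refl])
    show "inj_on (\<lambda>h. insert h ?\<sigma>) ({..<n} - ?\<sigma>)" by (rule inj_onI) blast
  qed
  also have "\<dots> = tdiff u ?\<sigma>"
    unfolding tdiff_def by (intro sum.cong refl) (simp add: tcoeff_insert)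
  finally show ?thesis .
qed

lemma poly_vecs_function:
  assumes "v \<in> poly_vecs V (length (faces i))"
  obtains u where "\<And>\<tau>. u \<tau> \<in> polys V" "\<And>b. b < length (faces i) \<Longrightarrow> v $ b = u (faces i ! b)"
proof -
  define ix where "ix = the_inv_into {..<length (faces i)} ((!) (faces i))"
  define u where "u = (\<lambda>\<tau>. if \<tau> \<in> set (faces i) then v $ ix \<tau> else 0)"
  have bij: "bij_betw ((!) (faces i)) {..<length (faces i)} (set (faces i))"
    by (rule bij_betw_nth[OF faces(1) refl refl])
  have ix: "ix (faces i ! b) = b" if "b < length (faces i)" for b
    unfolding ix_def using bij that by (intro the_inv_into_f_f) (auto simp: bij_betw_def)
  have "u \<tau> \<in> polys V" for \<tau>
  proof (cases "\<tau> \<in> set (faces i)")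
    case True
    then obtain b where "b < length (faces i)" "\<tau> = faces i ! b" by (auto simp: in_set_conv_nth)
    then show ?thesis using assms True by (simp add: u_def ix poly_vecs_def)
  qed (simp add: u_def)
  moreover have "v $ b = u (faces i ! b)" if "b < length (faces i)" for b
    using that by (simp add: u_def ix)
  ultimately show ?thesis by (rule that)
qed

text \<open>Covers both kinds of exactness: at i = 0 the cycle condition is vacuous and membership
  in the ideal is used, and for positive i it is the other way round.\<close>

lemma taylor_lift:
  fixes w :: "nat set \<Rightarrow> (nat, 'k::field) mpoly"
  assumes w: "\<And>\<tau>. w \<tau> \<in> polys V"
    and v: "v \<in> poly_vecs V (length (faces i))" "\<And>a. a < length (faces i) \<Longrightarrow> v $ a = w (faces i ! a)"
    and cycle: "\<And>a h. a < length (faces i) \<Longrightarrow> h \<in> faces i ! a \<Longrightarrow> tdiff w (faces i ! a - {h}) = 0"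
    and ideal: "i = 0 \<Longrightarrow> w {} \<in> sqf_ideal V (g ` {..<n})"
  shows "\<exists>x\<in>poly_vecs V (length (faces (Suc i))). v = taylor_mat i *\<^sub>v x"
proof (rule bexI)
  let ?x = "vec (length (faces (Suc i))) (\<lambda>b. thom w (faces (Suc i) ! b))"
  show "?x \<in> poly_vecs V (length (faces (Suc i)))"
    unfolding poly_vecs_def using thom_closed[OF faces_nth(1) w] by auto
  show "v = taylor_mat i *\<^sub>v ?x"
  proof (rule eq_vecI)
    fix a assume "a < dim_vec (taylor_mat i *\<^sub>v ?x)"
    then have a: "a < length (faces i)" by (simp add: taylor_mat_def)
    have "(taylor_mat i *\<^sub>v ?x) $ a = tdiff (thom w) (faces i ! a)"
      by (rule taylor_mat_mult_vec[OF _ _ a]) auto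
    also have "\<dots> = w (faces i ! a)"
    proof (rule tdiff_thom[OF faces_nth(1)[OF a] cycle[OF a]])
      assume "faces i ! a = {}"
      then show "w (faces i ! a) \<in> sqf_ideal V (g ` {..<n})" using ideal faces_nth(2)[OF a] by simp
    qed
    finally show "v $ a = (taylor_mat i *\<^sub>v ?x) $ a" using v(2)[OF a] by simp
  qed (use v(1) in \<open>simp add: taylor_mat_def poly_vecs_def\<close>)
qed

theorem taylor_resolution:
  "graded_free_resolution V (sqf_ideal V (g ` {..<n})) taylor_degs (vec 1 (\<lambda>_. 1))
    (taylor_mat :: nat \<Rightarrow> (nat, 'k::field) mpoly mat)"
proof -
  let ?I = "sqf_ideal V (g ` {..<n}) :: (nat, 'k) mpoly set" and ?e = "vec 1 (\<lambda>_. 1) :: (nat, 'k) mpoly vec"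
  have len0: "length (faces 0) = 1" by (simp add: faces_0)
  have e: "?e \<bullet> v = v $ 0" if "v \<in> poly_vecs V 1" for v :: "(nat, 'k) mpoly vec"
  proof -
    have "v \<in> carrier_vec 1" using that by (simp add: poly_vecs_def)
    then have "dim_vec v = 1" by (rule carrier_vecD)
    then show ?thesis by (simp add: scalar_prod_def)
  qed
  have im: "\<exists>u. (\<forall>\<tau>. u \<tau> \<in> polys V) \<and> (\<forall>a<length (faces i). v $ a = tdiff u (faces i ! a))"
    if v: "v = taylor_mat i *\<^sub>v x" and x: "x \<in> poly_vecs V (length (faces (Suc i)))" for i v and x :: "(nat, 'k) mpoly vec"
  proof -
    obtain u where "\<And>\<tau>. u \<tau> \<in> polys V" "\<And>b. b < length (faces (Suc i)) \<Longrightarrow> x $ b = u (faces (Suc i) ! b)"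
      using poly_vecs_function[OF x] by blast
    moreover have "x \<in> carrier_vec (length (faces (Suc i)))" using x by (simp add: poly_vecs_def)
    ultimately show ?thesis using v taylor_mat_mult_vec by blast
  qed
  have gens: "?e \<bullet> v \<in> ?I \<longleftrightarrow> (\<exists>w\<in>poly_vecs V (length (taylor_degs 1)). v = taylor_mat 0 *\<^sub>v w)"
    if v: "v \<in> poly_vecs V (length (taylor_degs 0))" for v
  proof
    assume "\<exists>w\<in>poly_vecs V (length (taylor_degs 1)). v = taylor_mat 0 *\<^sub>v w"
    then obtain w where w: "w \<in> poly_vecs V (length (faces (Suc 0)))" "v = taylor_mat 0 *\<^sub>v w" by auto
    obtain u where u: "\<And>\<tau>. u \<tau> \<in> polys V" "\<And>a. a < length (faces 0) \<Longrightarrow> v $ a = tdiff u (faces 0 ! a)"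
      using im[OF w(2,1)] by blast
    have "?e \<bullet> v = tdiff u {}" using u(2)[of 0] e[of v] v by (simp add: faces_0)
    then show "?e \<bullet> v \<in> ?I" using tdiff_empty_in_ideal[of u] u(1) by simp
  next
    assume v0: "?e \<bullet> v \<in> ?I"
    obtain u where u: "\<And>\<tau>. u \<tau> \<in> polys V" "\<And>b. b < length (faces 0) \<Longrightarrow> v $ b = u (faces 0 ! b)"
      using poly_vecs_function[of v 0] v by auto
    have "\<exists>x\<in>poly_vecs V (length (faces (Suc 0))). v = taylor_mat 0 *\<^sub>v x"
    proof (rule taylor_lift[OF u(1) _ u(2)])
      show "u {} \<in> ?I" using v0 u(2)[of 0] e[of v] v by (simp add: faces_0)
    qed (use v in \<open>auto simp: faces_0\<close>)
    then show "\<exists>w\<in>poly_vecs V (length (taylor_degs 1)). v = taylor_mat 0 *\<^sub>v w" by simp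
  qed
  have exact: "taylor_mat i *\<^sub>v v = 0\<^sub>v (length (taylor_degs i)) \<longleftrightarrow>
      (\<exists>w\<in>poly_vecs V (length (taylor_degs (Suc (Suc i)))). v = taylor_mat (Suc i) *\<^sub>v w)"
    if v: "v \<in> poly_vecs V (length (taylor_degs (Suc i)))" for i and v :: "(nat, 'k) mpoly vec"
  proof
    have vc: "v \<in> carrier_vec (length (faces (Suc i)))" using v by (simp add: poly_vecs_def)
    {
      assume "\<exists>w\<in>poly_vecs V (length (taylor_degs (Suc (Suc i)))). v = taylor_mat (Suc i) *\<^sub>v w"
      then obtain w where w: "w \<in> poly_vecs V (length (faces (Suc (Suc i))))" "v = taylor_mat (Suc i) *\<^sub>v w" by auto
      obtain u where u: "\<And>a. a < length (faces (Suc i)) \<Longrightarrow> v $ a = tdiff u (faces (Suc i) ! a)"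
        using im[OF w(2,1)] by blast
      show "taylor_mat i *\<^sub>v v = 0\<^sub>v (length (taylor_degs i))"
      proof (rule eq_vecI)
        fix a assume "a < dim_vec (0\<^sub>v (length (taylor_degs i)))"
        then have a: "a < length (faces i)" by simp
        have "(taylor_mat i *\<^sub>v v) $ a = tdiff (tdiff u) (faces i ! a)" by (rule taylor_mat_mult_vec[OF vc u a])
        also have "\<dots> = 0" by (rule tdiff_tdiff[OF faces_nth(1)[OF a]])
        finally show "(taylor_mat i *\<^sub>v v) $ a = 0\<^sub>v (length (taylor_degs i)) $ a" using a by simp
      qed (simp add: taylor_mat_def)
    next
      assume zero: "taylor_mat i *\<^sub>v v = 0\<^sub>v (length (taylor_degs i))"
      obtain u where u: "\<And>\<tau>. u \<tau> \<in> polys V" "\<And>b. b < length (faces (Suc i)) \<Longrightarrow> v $ b = u (faces (Suc i) ! b)"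
        using poly_vecs_function[of v "Suc i"] v by auto
      have "\<exists>x\<in>poly_vecs V (length (faces (Suc (Suc i)))). v = taylor_mat (Suc i) *\<^sub>v x"
      proof (rule taylor_lift[OF u(1) _ u(2)])
        fix a h assume a: "a < length (faces (Suc i))" and h: "h \<in> faces (Suc i) ! a"
        have "finite (faces (Suc i) ! a)" using faces_nth(1)[OF a] finite_subset by blast
        then have "faces (Suc i) ! a - {h} \<in> set (faces i)"
          using faces_nth[OF a] h by (auto simp: faces(2))
        then obtain c where c: "c < length (faces i)" "faces i ! c = faces (Suc i) ! a - {h}"
          by (auto simp: in_set_conv_nth)
        have "tdiff u (faces i ! c) = (taylor_mat i *\<^sub>v v) $ c"
          by (rule taylor_mat_mult_vec[symmetric, OF vc u(2) c(1)])
        also have "\<dots> = 0" using c zero by simp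
        finally show "tdiff u (faces (Suc i) ! a - {h}) = 0" unfolding c(2) .
      qed (use v in auto)
      then show "\<exists>w\<in>poly_vecs V (length (taylor_degs (Suc (Suc i)))). v = taylor_mat (Suc i) *\<^sub>v w" by simp
    }
  qed
  have aug: "\<exists>v\<in>poly_vecs V (length (taylor_degs 0)). f - ?e \<bullet> v \<in> ?I" if f: "f \<in> polys V" for f
  proof (rule bexI)
    have v: "vec 1 (\<lambda>_. f) \<in> poly_vecs V 1" using f by (simp add: poly_vecs_def)
    show "f - ?e \<bullet> vec 1 (\<lambda>_. f) \<in> ?I" using e[OF v] ideal_zero[OF ideal_sqf_ideal] by simp
    show "vec 1 (\<lambda>_. f) \<in> poly_vecs V (length (taylor_degs 0))" using v by (simp add: len0)
  qed
  have "?e \<in> poly_vecs V (length (taylor_degs 0))" by (simp add: len0 poly_vecs_def)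
  moreover have "\<forall>b<length (taylor_degs 0). homogeneous (taylor_degs 0 ! b) (?e $ b)"
    by (simp add: taylor_degs_def faces_0 homogeneous_1)
  ultimately show ?thesis
    unfolding graded_free_resolution_def
    using taylor_hmat[where ?'k = 'k, unfolded hmat_def] aug gens exact by blast
qed

end

lemma homogeneous_ideal_sqf_ideal: "homogeneous_ideal V (sqf_ideal V E)"
proof -
  have "hcomp d p \<in> sqf_ideal V E" if "p \<in> sqf_ideal V E" for p :: "('a, 'b) mpoly" and d
    using that poly_ring_hcomp[of p V d] by (auto simp: sqf_ideal_def hcomp_def keys_part)
  then show ?thesis unfolding homogeneous_ideal_def using ideal_sqf_ideal by blast
qed

section \<open>Regularity from the matching number\<close>

context taylor
begin

lemma set_taylor_degs: "set (taylor_degs i) = {int (card (U \<sigma>)) | \<sigma>. \<sigma> \<subseteq> {..<n} \<and> card \<sigma> = i}"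
  by (auto simp: taylor_degs_def faces(2))

text \<open>The witness may be any resolution. Comparing it with the Taylor resolution shows that
  nonzero homology in degree j requires a Taylor generator of that degree.\<close>

lemma tor_nonzero_generator:
  assumes "tor_nonzero V (sqf_ideal V (g ` {..<n}) :: (nat, 'k::field) mpoly set) i j"
  obtains \<sigma> where "\<sigma> \<subseteq> {..<n}" "card \<sigma> = i" "j = int (card (U \<sigma>))"
proof -
  obtain ds e D where R: "graded_free_resolution V (sqf_ideal V (g ` {..<n}) :: (nat, 'k) mpoly set) ds e D"
    "tensor_cycles ds D i j \<noteq> tensor_boundaries ds D i j"
    using assms unfolding tor_nonzero_def by blast
  have "j \<in> set (taylor_degs i)"
    using tensor_homology_degree[OF homogeneous_ideal_sqf_ideal R(1) taylor_resolution] R(2) by blast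
  then show ?thesis using that unfolding set_taylor_degs by blast
qed

text \<open>If no further generator is supported on \<open>U \<sigma>\<close>, the row of \<open>\<sigma>\<close> in the Taylor differential has
  no constant entries, so the basis vector \<open>\<sigma>\<close> is not a boundary.\<close>

lemma tor_nonzero_induced:
  assumes \<sigma>: "\<sigma> \<subseteq> {..<n}" "card \<sigma> = r" "card (U \<sigma>) = 2 * r"
    and ind: "\<And>h. h < n \<Longrightarrow> g h \<subseteq> U \<sigma> \<Longrightarrow> h \<in> \<sigma>"
    and card_g: "\<And>h. h < n \<Longrightarrow> card (g h) \<le> 2"
  shows "tor_nonzero V (sqf_ideal V (g ` {..<n}) :: (nat, 'k::field) mpoly set) r (int (2 * r))"
proof -
  let ?M = "taylor_mat :: nat \<Rightarrow> (nat, 'k) mpoly mat"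
  have "\<sigma> \<in> set (faces r)" using \<sigma> by (simp add: faces(2))
  then obtain a where a: "a < length (faces r)" "faces r ! a = \<sigma>" by (auto simp: in_set_conv_nth)
  define v :: "'k vec" where "v = unit_vec (length (faces r)) a"
  have v: "v \<in> degree_part (taylor_degs r) (int (2 * r))"
    using a \<sigma> by (auto simp: degree_part_def v_def taylor_degs_def unit_vec_def)
  have "v \<in> tensor_cycles taylor_degs ?M r (int (2 * r))"
  proof -
    have "const_mat (?M l) *\<^sub>v v = 0\<^sub>v (length (taylor_degs l))" if l: "r = Suc l" for l
    proof (rule degree_part_eq_zero)
      show "const_mat (?M l) *\<^sub>v v \<in> degree_part (taylor_degs l) (int (2 * r))"
        using const_mat_degree_part[OF taylor_hmat] v unfolding l by blast
      \<comment> \<open>One edge fewer covers at most 2 r - 2 vertices, so the basis vector is sent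
        to a degree without generators and is a cycle.\<close>
      show "int (2 * r) \<notin> set (taylor_degs l)"
      proof
        assume "int (2 * r) \<in> set (taylor_degs l)"
        then obtain \<tau> where \<tau>: "\<tau> \<subseteq> {..<n}" "card \<tau> = l" "int (2 * r) = int (card (U \<tau>))"
          unfolding set_taylor_degs by blast
        have fin: "finite \<tau>" using \<tau>(1) finite_subset by blast
        have "card (U \<tau>) \<le> (\<Sum>h\<in>\<tau>. card (g h))" unfolding U_def by (rule card_UN_le[OF fin])
        also have "\<dots> \<le> (\<Sum>h\<in>\<tau>. 2)" using \<tau>(1) by (intro sum_mono card_g) auto
        finally show False using \<tau> l by simp
      qed
    qed
    then show ?thesis using v by (simp add: tensor_cycles_def)
  qed
  moreover have "v \<notin> tensor_boundaries taylor_degs ?M r (int (2 * r))"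
  proof
    assume "v \<in> tensor_boundaries taylor_degs ?M r (int (2 * r))"
    then obtain w where w: "w \<in> degree_part (taylor_degs (Suc r)) (int (2 * r))" "v = const_mat (?M r) *\<^sub>v w"
      unfolding tensor_boundaries_def by blast
    have wc: "w \<in> carrier_vec (length (faces (Suc r)))" using w(1) by (simp add: degree_part_def)
    have Mc: "?M r \<in> carrier_mat (length (faces r)) (length (faces (Suc r)))" by (simp add: taylor_mat_def)
    have "const_mat (?M r) $$ (a, b) = 0" if b: "b < length (faces (Suc r))" for b
    proof -
      let ?\<tau> = "faces (Suc r) ! b"
      have "lookup (tcoeff \<sigma> ?\<tau> :: (nat, 'k) mpoly) 0 = 0"
      proof (cases rule: tcoeff_cases[of \<sigma> ?\<tau>, where ?'k = 'k])
        case (1 h)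
        have h: "h < n" using faces_nth(1)[OF b] 1 by auto
        then have "\<not> g h \<subseteq> U \<sigma>" using ind 1(1) by blast
        then have ne: "U ?\<tau> - U \<sigma> \<noteq> {}" unfolding 1(2) U_insert by blast
        have fin: "finite (U ?\<tau> - U \<sigma>)" using finite_U[OF faces_nth(1)[OF b]] by blast
        then have "lookup (sqf_monom (U ?\<tau> - U \<sigma>) * 1 :: (nat, 'k) mpoly) 0 = 0"
          unfolding lookup_sqf_monom_mult[OF fin] using ne by simp
        then show ?thesis
          using tcoeff_insert[OF 1(1), where ?'a = 'k] by (simp add: 1(2) ksign_def lookup_neg_one_power_mult)
      qed simp
      then show ?thesis using const_mat_entry[OF Mc a(1) b] a b by (simp add: taylor_mat_def)
    qed
    then have "(const_mat (?M r) *\<^sub>v w) $ a = 0"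
      unfolding mult_mat_vec_entry[OF const_mat_carrier[OF Mc] wc a(1)] by simp
    then have "v $ a = 0" unfolding w(2) .
    then show False using a(1) by (simp add: v_def)
  qed
  ultimately show ?thesis unfolding tor_nonzero_def using taylor_resolution by blast
qed

end

text \<open>M is an induced matching: the two cardinalities make its edges disjoint, and the last
  condition excludes further edges on its vertices.\<close>

theorem regularity_edge_ideal:
  assumes G: "simple_graph V E" and small: "card (\<Union>E) \<le> 2 * r + 1"
    and M: "M \<subseteq> E" "card M = r" "card (\<Union>M) = 2 * r" "\<And>e. e \<in> E \<Longrightarrow> e \<subseteq> \<Union>M \<Longrightarrow> e \<in> M"
  shows "regularity V (edge_ideal V E :: (nat, 'k::field) mpoly set) = int r"
proof -
  let ?I = "sqf_ideal V E :: (nat, 'k) mpoly set"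
  let ?T = "{j. \<exists>i. tor_nonzero V ?I i (int i + j)}"
  have fin: "finite V" and e: "\<And>e. e \<in> E \<Longrightarrow> e \<subseteq> V \<and> card e = 2"
    using G by (auto simp: simple_graph_def)
  have "E \<subseteq> Pow V" using e by blast
  then have "finite E" by (rule finite_subset) (simp add: fin)
  then have "\<exists>(n :: nat) g. E = g ` {i. i < n} \<and> inj_on g {i. i < n}"
    by (rule finite_imp_nat_seg_image_inj_on)
  then obtain n :: nat and g where "E = g ` {i. i < n} \<and> inj_on g {i. i < n}"
    by (elim exE)
  then have E': "E = g ` {..<n}" "inj_on g {..<n}" unfolding lessThan_def by (rule conjunct1, rule conjunct2)
  have g: "g h \<in> E" if "h < n" for h using that E' by auto
  interpret taylor V n g
    by (rule taylor.intro[OF fin]) (use e g in blast)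
  \<comment> \<open>The lower bound makes the set finite, so that its \<open>Max\<close> is
    meaningful; it holds because the Taylor resolution stops at homological degree n.\<close>
  have bounds: "- int n \<le> j" "j \<le> int r" if j: "j \<in> ?T" for j
  proof -
    obtain i where "tor_nonzero V ?I i (int i + j)" using j by blast
    then obtain \<sigma> where \<sigma>: "\<sigma> \<subseteq> {..<n}" "card \<sigma> = i" "int i + j = int (card (U \<sigma>))"
      using tor_nonzero_generator[of i "int i + j", where ?'k = 'k] unfolding E'(1)[symmetric] by blast
    have fin\<sigma>: "finite \<sigma>" by (rule finite_subset[OF \<sigma>(1) finite_lessThan])
    have "i \<le> n" using card_mono[OF finite_lessThan \<sigma>(1)] \<sigma>(2) by simp
    then show "- int n \<le> j" using \<sigma>(3) by linarith
    have "finite (\<Union>E)" by (rule finite_subset[OF _ fin]) (use e in blast)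
    moreover have "U \<sigma> \<subseteq> \<Union>E" using \<sigma>(1) E'(1) by (auto simp: U_def)
    ultimately have "card (U \<sigma>) \<le> 2 * r + 1" using small card_mono le_trans by blast
    moreover have "card (U \<sigma>) \<le> 2 * i"
    proof -
      have "card (U \<sigma>) \<le> (\<Sum>h\<in>\<sigma>. card (g h))" unfolding U_def by (rule card_UN_le[OF fin\<sigma>])
      also have "\<dots> = (\<Sum>h\<in>\<sigma>. 2)" using \<sigma>(1) e g by (intro sum.cong) auto
      finally show ?thesis using \<sigma>(2) by simp
    qed
    \<comment> \<open>For i at most r the bound 2 i gives j \<le> i \<le> r; for larger i the bound
      2 r + 1 gives j \<le> 2 r + 1 - i \<le> r.\<close>
    ultimately show "j \<le> int r" using \<sigma>(3) by linarith
  qed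
  have "tor_nonzero V ?I r (int (2 * r))"
    unfolding E'(1)
  proof (rule tor_nonzero_induced[where \<sigma> = "{h. h < n \<and> g h \<in> M}"])
    have im: "g ` {h. h < n \<and> g h \<in> M} = M" using M(1) E'(1) by auto
    have "inj_on g {h. h < n \<and> g h \<in> M}" by (rule inj_on_subset[OF E'(2)]) auto
    then show "card {h. h < n \<and> g h \<in> M} = r" using card_image im M(2) by metis
    show "card (U {h. h < n \<and> g h \<in> M}) = 2 * r" unfolding U_def im by (rule M(3))
    show "h \<in> {h. h < n \<and> g h \<in> M}" if "h < n" "g h \<subseteq> U {h. h < n \<and> g h \<in> M}" for h
      using that M(4)[OF g] unfolding U_def im by blast
    show "card (g h) \<le> 2" if "h < n" for h using e[OF g[OF that]] by simp
  qed auto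
  then have r: "int r \<in> ?T" by (intro CollectI exI[of _ r]) simp
  have "?T \<subseteq> {- int n..int r}"
    unfolding subset_eq atLeastAtMost_iff by (intro ballI conjI bounds)
  then have "finite ?T" by (rule finite_subset) simp
  then show ?thesis
    unfolding regularity_def edge_ideal_eq_sqf_ideal[OF G] using r bounds(2) by (intro Max_eqI)
qed

section \<open>Algebraic dependence\<close>

text \<open>Bounding every exponent separately, instead of the total degree, makes the monomials
  easy to count: at most (B + 1) to the number of variables.\<close>

definition exps_le :: "nat \<Rightarrow> ('v, 'k::comm_ring_1) mpoly \<Rightarrow> bool" where
  "exps_le B p \<longleftrightarrow> (\<forall>m\<in>keys p. \<forall>v. lookup m v \<le> B)"

lemma exps_le_mult:
  assumes "exps_le B p" "exps_le C q" shows "exps_le (B + C) (p * q)"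
  unfolding exps_le_def
proof (intro ballI allI)
  fix m v assume "m \<in> keys (p * q)"
  then obtain a b where "a \<in> keys p" "b \<in> keys q" "m = a + b" using keys_mult[of p q] by blast
  then show "lookup m v \<le> B + C" using assms unfolding exps_le_def by (simp add: lookup_add add_mono)
qed

lemma exps_le_one: "exps_le B 1"
  by (simp add: exps_le_def)

lemma exps_le_mono: "exps_le B p \<Longrightarrow> B \<le> C \<Longrightarrow> exps_le C p"
  unfolding exps_le_def by (meson le_trans)

lemma exps_le_power: "exps_le B p \<Longrightarrow> exps_le (a * B) (p ^ a)"
  by (induction a) (auto intro: exps_le_one exps_le_mult)

lemma exps_le_exists: "\<exists>B. exps_le B p"
proof -
  have "finite (\<Union>m\<in>keys p. lookup m ` keys m)" by simp
  then obtain B where B: "\<forall>x\<in>(\<Union>m\<in>keys p. lookup m ` keys m). x \<le> B"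
    using finite_nat_set_iff_bounded_le by metis
  have "lookup m v \<le> B" if "m \<in> keys p" for m v
    using B that by (cases "v \<in> keys m") (auto simp: in_keys_iff)
  then show ?thesis unfolding exps_le_def by blast
qed

lemma exps_le_exists_list: "\<exists>B. \<forall>p\<in>set ps. exps_le B p"
proof (induction ps)
  case (Cons p ps)
  then obtain B where B: "\<forall>p\<in>set ps. exps_le B p" by blast
  obtain C where C: "exps_le C p" using exps_le_exists by blast
  have "exps_le (max B C) q" if "q \<in> set (p # ps)" for q
  proof (cases "q = p")
    case True
    then show ?thesis using exps_le_mono[OF C, of "max B C"] by simp
  next
    case False
    then have "exps_le B q" using B that by simp
    then show ?thesis using exps_le_mono[of B q "max B C"] by simp
  qed
  then show ?case by (intro exI[of _ "max B C"] ballI)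
qed simp

fun power_prod :: "('v, 'k::comm_ring_1) mpoly list \<Rightarrow> nat list \<Rightarrow> ('v, 'k) mpoly" where
  "power_prod (f # fs) (a # as) = f ^ a * power_prod fs as"
| "power_prod _ _ = 1"

lemma poly_ring_power: "p \<in> polys V \<Longrightarrow> p ^ a \<in> polys V"
  by (induction a) (auto intro: poly_ring_mult)

lemma power_prod_closed: "set fs \<subseteq> polys V \<Longrightarrow> power_prod fs as \<in> polys V"
  by (induction fs as rule: power_prod.induct) (auto intro: poly_ring_mult poly_ring_power)

lemma exps_le_power_prod:
  "\<forall>f\<in>set fs. exps_le B f \<Longrightarrow> set as \<subseteq> {..L} \<Longrightarrow> exps_le (length fs * (L * B)) (power_prod fs as)"
proof (induction fs as rule: power_prod.induct)
  case (1 f fs a as)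
  have "exps_le (L * B) (f ^ a)" using exps_le_mono[OF exps_le_power[of B f a], of "L * B"] 1 by simp
  moreover have "exps_le (length fs * (L * B)) (power_prod fs as)" using 1 by simp
  ultimately show ?case using exps_le_mult by fastforce
qed (auto intro: exps_le_one)

interpretation mpoly_space: vector_space "\<lambda>(c::'k::field) p. Const c * (p :: ('v, 'k) mpoly)"
proof
  fix a b :: 'k and x y :: "('v, 'k) mpoly"
  have "Const (a + b) = (Const a + Const b :: ('v, 'k) mpoly)" by (simp add: Const_def single_add)
  then show "Const (a + b) * x = Const a * x + Const b * x" by (simp add: distrib_right)
  have "Const a * Const b = (Const (a * b) :: ('v, 'k) mpoly)" by (simp add: Const_def mult_single)
  then show "Const a * (Const b * x) = Const (a * b) * x" by (simp add: mult.assoc[symmetric])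
  show "Const 1 * x = x" by (simp add: Const_def)
qed (simp add: distrib_left)

lemma bounded_monomials:
  assumes V: "finite V"
  shows "finite {m. keys m \<subseteq> V \<and> (\<forall>v. lookup m v \<le> B)}"
    "card {m. keys m \<subseteq> V \<and> (\<forall>v. lookup m v \<le> B)} \<le> (B + 1) ^ card V"
proof -
  let ?M = "{m. keys m \<subseteq> V \<and> (\<forall>v. lookup m v \<le> B)}" and ?F = "\<lambda>m. restrict (lookup m) V"
  have inj: "inj_on ?F ?M"
  proof (rule inj_onI, rule poly_mapping_eqI)
    fix m m' v assume m: "m \<in> ?M" "m' \<in> ?M" "?F m = ?F m'"
    show "lookup m v = lookup m' v"
    proof (cases "v \<in> V")
      case True
      then show ?thesis using fun_cong[OF m(3), of v] by simp
    next
      case False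
      then have "v \<notin> keys m" "v \<notin> keys m'" using m by auto
      then show ?thesis by (simp add: in_keys_iff)
    qed
  qed
  have im: "?F ` ?M \<subseteq> PiE V (\<lambda>_. {..B})" by auto
  have fin: "finite (PiE V (\<lambda>_. {..B}))" using V by (intro finite_PiE) auto
  show "finite ?M" by (rule inj_on_finite[OF inj im fin])
  have "card ?M \<le> card (PiE V (\<lambda>_. {..B}))" by (rule card_inj_on_le[OF inj im fin])
  then show "card ?M \<le> (B + 1) ^ card V" using V by (simp add: card_PiE)
qed

text \<open>More power products than monomials of bounded degree force a linear relation.\<close>

lemma algebraic_dependence:
  fixes fs :: "('v, 'k::field) mpoly list"
  assumes V: "finite V" and fs: "set fs \<subseteq> polys V" and len: "length fs = Suc (card V)"
  obtains A c where "finite A" "\<And>as. as \<in> A \<Longrightarrow> length as = length fs" "\<exists>as\<in>A. c as \<noteq> (0::'k)"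
    "(\<Sum>as\<in>A. Const (c as) * power_prod fs as) = 0"
proof -
  obtain e where e: "\<forall>f\<in>set fs. exps_le e f" using exps_le_exists_list by blast
  define N where "N = card V"
  \<comment> \<open>With exponents below L, the N + 1 given polynomials have L ^ (N + 1) power
    products, whose monomials have exponents at most B. Since B + 1 \<le> K L, there are at most K ^
    N L ^ N such monomials, and L is chosen larger than K ^ N.\<close>
  define K where "K = (N + 1) * e + 1"
  define L where "L = K ^ N + 1"
  define B where "B = (N + 1) * (L * e)"
  define A where "A = {as. set as \<subseteq> {..<L} \<and> length as = Suc N}"
  define T :: "('v, 'k) mpoly set" where "T = (\<lambda>m. single m 1) ` {m. keys m \<subseteq> V \<and> (\<forall>v. lookup m v \<le> B)}"
  have finA: "finite A" unfolding A_def by (rule finite_lists_length_eq) simp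
  have cardA: "card A = L ^ Suc N" unfolding A_def using card_lists_length_eq[of "{..<L}" "Suc N"] by simp
  have finT: "finite T" unfolding T_def using bounded_monomials(1)[OF V] by simp
  have "card T \<le> (B + 1) ^ N"
    using card_image_le[OF bounded_monomials(1)[OF V]] bounded_monomials(2)[OF V] le_trans
    unfolding T_def N_def by blast
  also have "\<dots> \<le> (K * L) ^ N"
    by (rule power_mono) (auto simp: B_def K_def L_def algebra_simps)
  also have "\<dots> = K ^ N * L ^ N" by (rule power_mult_distrib)
  also have "\<dots> < L * L ^ N" by (rule mult_strict_right_mono) (auto simp: L_def)
  finally have card: "card T < card A" unfolding cardA by simp
  have inspan: "power_prod fs as \<in> mpoly_space.span T" if as: "as \<in> A" for as
  proof -
    let ?p = "power_prod fs as"
    have "set as \<subseteq> {..L}" using as by (auto simp: A_def)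
    then have le: "exps_le B ?p" using exps_le_power_prod[OF e, of as L] len by (simp add: B_def N_def)
    have p: "?p \<in> polys V" by (rule power_prod_closed[OF fs])
    have "(\<Sum>m\<in>keys ?p. Const (lookup ?p m) * single m 1) \<in> mpoly_space.span T"
    proof (intro mpoly_space.span_sum mpoly_space.span_scale mpoly_space.span_base)
      fix m assume m: "m \<in> keys ?p"
      then have "keys m \<subseteq> V" using p unfolding carrier_poly_ring_iff by blast
      moreover have "\<forall>v. lookup m v \<le> B" using le m unfolding exps_le_def by blast
      ultimately show "single m 1 \<in> T" unfolding T_def by blast
    qed
    moreover have "(\<Sum>m\<in>keys ?p. Const (lookup ?p m) * single m 1) = ?p"
      using poly_mapping_sum_singles[of ?p] by (simp add: Const_def mult_single)
    ultimately show ?thesis by simp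
  qed
  have lenA: "length as = length fs" if "as \<in> A" for as using that len by (simp add: A_def N_def)
  show ?thesis
  proof (cases "inj_on (power_prod fs) A")
    case False
    then obtain a b where ab: "a \<in> A" "b \<in> A" "a \<noteq> b" "power_prod fs a = power_prod fs b"
      unfolding inj_on_def by blast
    \<comment> \<open>If two power products coincide, their difference is already a relation. This
      case is separate because linear dependence is stated for sets, which would merge the
      two.\<close>
    show ?thesis
    proof (rule that[of "{a, b}" "\<lambda>as. if as = a then 1 else - 1"])
      have "Const 1 = (1 :: ('v, 'k) mpoly)" "Const (- 1) = (- 1 :: ('v, 'k) mpoly)"
        by (simp_all add: Const_def single_uminus)
      then show "(\<Sum>as\<in>{a, b}. Const (if as = a then 1 else - 1) * power_prod fs as) = 0"
        using ab by simp
    qed (use ab lenA in auto)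
  next
    case True
    have "mpoly_space.dependent (power_prod fs ` A)"
    proof (rule ccontr)
      assume "\<not> mpoly_space.dependent (power_prod fs ` A)"
      then have "card (power_prod fs ` A) \<le> card T"
        using mpoly_space.independent_span_bound[OF finT] inspan by blast
      then show False using card card_image[OF True] by simp
    qed
    then obtain u where u: "\<exists>v\<in>power_prod fs ` A. u v \<noteq> 0"
      "(\<Sum>v\<in>power_prod fs ` A. Const (u v) * v) = 0"
      using mpoly_space.dependent_finite[of "power_prod fs ` A"] finA by auto
    show ?thesis
    proof (rule that[of A "\<lambda>as. u (power_prod fs as)"])
      show "(\<Sum>as\<in>A. Const (u (power_prod fs as)) * power_prod fs as) = 0"
        using u(2) sum.reindex[OF True, of "\<lambda>v. Const (u v) * v"] by simp
    qed (use u(1) finA lenA in auto)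
  qed
qed

section \<open>The Krull dimension\<close>

lemma prime_powerD:
  assumes P: "primeideal P (poly_ring V)" and f: "f \<in> polys V" "f \<notin> P"
    and g: "g \<in> polys V"
  shows "f ^ a * g \<in> P \<Longrightarrow> g \<in> P"
proof (induction a)
  case (Suc a)
  have "f * (f ^ a * g) \<in> P" using Suc.prems by (simp add: mult.assoc)
  then have "f ^ a * g \<in> P"
    using primeideal.I_prime[OF P f(1), of "f ^ a * g"] f g by (simp add: poly_ring_mult poly_ring_power)
  then show ?case by (rule Suc.IH)
qed simp

lemma primeideal_proper:
  assumes "primeideal P (poly_ring V)" and "c \<noteq> (0::'k::field)"
  shows "Const c \<notin> (P :: ('v, 'k) mpoly set)"
proof
  assume "Const c \<in> P"
  then have "Const (inverse c) * Const c \<in> P"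
    using ideal_mult[OF primeideal.axioms(1)[OF assms(1)]] poly_ring_Const by blast
  then have "1 \<in> P" using assms(2) by (simp add: Const_def mult_single)
  then have "polys V \<subseteq> P"
    using ideal_mult[OF primeideal.axioms(1)[OF assms(1)], of 1] by force
  then show False
    using primeideal.I_notcarr[OF assms(1)] ideal_subset[OF primeideal.axioms(1)[OF assms(1)]] by blast
qed

text \<open>Given \<open>f\<^sub>i \<in> P\<^sub>i\<^sub>+\<^sub>1 - P\<^sub>i\<close>, the lexicographically lowest term of an algebraic relation between
  the \<open>f\<^sub>i\<close> would have its coefficient in the last prime of the chain.\<close>

lemma chain_no_relation:
  fixes P :: "nat \<Rightarrow> ('v, 'k::field) mpoly set"
  assumes "\<And>i. i \<le> length fs \<Longrightarrow> primeideal (P i) (poly_ring V)"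
    and "\<And>i. i < length fs \<Longrightarrow> P i \<subseteq> P (Suc i) \<and> fs ! i \<in> P (Suc i) \<and> fs ! i \<notin> P i"
    and "finite A" "\<And>as. as \<in> A \<Longrightarrow> length as = length fs" "\<exists>as\<in>A. c as \<noteq> (0::'k)"
    and "(\<Sum>as\<in>A. Const (c as) * power_prod fs as) \<in> P 0"
  shows False
  using assms
proof (induction fs arbitrary: P A c)
  case Nil
  \<comment> \<open>With no polynomials left, the relation is a nonzero constant in a prime
    ideal.\<close>
  then have "A = {[]}" by (metis (no_types) empty_iff insertI1 length_0_conv list.size(3) singletonD subsetI subset_singletonD)
  then have "c [] \<noteq> 0" "Const (c []) \<in> P 0" using Nil by auto
  then show False using primeideal_proper[of "P 0" V] Nil.prems(1)[of 0] by auto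
next
  case (Cons f fs)
  have P0: "primeideal (P 0) (poly_ring V)" and P1: "primeideal (P (Suc 0)) (poly_ring V)"
    using Cons.prems(1)[of 0] Cons.prems(1)[of "Suc 0"] by auto
  have I0: "ideal (P 0) (poly_ring V)" and I1: "ideal (P (Suc 0)) (poly_ring V)"
    using P0 P1 primeideal.axioms(1) by blast+
  have sub: "P 0 \<subseteq> P (Suc 0)" and fP: "f \<in> P (Suc 0)" "f \<notin> P 0" using Cons.prems(2)[of 0] by auto
  have fc: "f \<in> polys V" using fP(1) ideal_subset[OF I1] by blast
  have fsc: "set fs \<subseteq> polys V"
  proof
    fix g assume "g \<in> set fs"
    then obtain i where i: "i < length fs" "g = fs ! i" by (auto simp: in_set_conv_nth)
    have "ideal (P (Suc (Suc i))) (poly_ring V)"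
      using Cons.prems(1)[of "Suc (Suc i)"] i primeideal.axioms(1) by auto
    then show "g \<in> polys V" using Cons.prems(2)[of "Suc i"] i ideal_subset by auto
  qed
  define S where "S = {as \<in> A. c as \<noteq> 0}"
  have finS: "finite S" using Cons.prems(3) by (simp add: S_def)
  have S0: "S \<noteq> {}" using Cons.prems(5) by (auto simp: S_def)
  have lenS: "length as = Suc (length fs)" if "as \<in> S" for as using that Cons.prems(4) by (simp add: S_def)
  \<comment> \<open>The lowest exponent of f among the terms that occur. Its power of f can be
    factored out and cancelled, since f is not in the prime \<open>P 0\<close>.\<close>
  define a0 where "a0 = Min (hd ` S)"
  have a0: "a0 \<in> hd ` S" "\<And>as. as \<in> S \<Longrightarrow> a0 \<le> hd as"
    unfolding a0_def using finS S0 by (auto intro: Min_in Min_le)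
  define h where "h = (\<lambda>as. Const (c as) * (f ^ (hd as - a0) * power_prod fs (tl as)))"
  have hc: "h as \<in> polys V" for as
    unfolding h_def by (intro poly_ring_mult poly_ring_Const poly_ring_power power_prod_closed fc fsc)
  have "(\<Sum>as\<in>A. Const (c as) * power_prod (f # fs) as) = (\<Sum>as\<in>S. Const (c as) * power_prod (f # fs) as)"
    unfolding S_def using Cons.prems(3) by (intro sum.mono_neutral_right) (auto simp: Const_def)
  also have "\<dots> = (\<Sum>as\<in>S. f ^ a0 * h as)"
  proof (rule sum.cong[OF refl])
    fix as assume as: "as \<in> S"
    then obtain a as' where as': "as = a # as'" using lenS[OF as] by (cases as) auto
    have "f ^ a = f ^ a0 * f ^ (a - a0)" using a0(2)[OF as] as' by (simp add: power_add[symmetric])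
    then show "Const (c as) * power_prod (f # fs) as = f ^ a0 * h as"
      by (simp add: as' h_def ac_simps)
  qed
  finally have "f ^ a0 * (\<Sum>as\<in>S. h as) \<in> P 0" using Cons.prems(6) by (simp add: sum_distrib_left)
  then have "(\<Sum>as\<in>S. h as) \<in> P 0"
    by (rule prime_powerD[OF P0 fc fP(2) poly_ring_sum[OF hc]])
  then have sum1: "(\<Sum>as\<in>S. h as) \<in> P (Suc 0)" using sub by blast
  have rest: "h as \<in> P (Suc 0)" if as: "as \<in> S" "hd as \<noteq> a0" for as
  proof -
    obtain d where d: "hd as - a0 = Suc d" using a0(2)[OF as(1)] as(2) by (metis diff_is_0_eq le_antisym not0_implies_Suc)
    have "h as = (Const (c as) * (f ^ d * power_prod fs (tl as))) * f"
      unfolding h_def d by (simp add: ac_simps)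
    also have "\<dots> \<in> P (Suc 0)"
      by (rule ideal_mult[OF I1 fP(1)]) (intro poly_ring_mult poly_ring_Const poly_ring_power power_prod_closed fc fsc)
    finally show ?thesis .
  qed
  have split: "(\<Sum>as\<in>S. h as) = (\<Sum>as\<in>{as \<in> S. hd as = a0}. h as) + (\<Sum>as\<in>{as \<in> S. hd as \<noteq> a0}. h as)"
    using finS by (subst sum.union_disjoint[symmetric]) (auto intro!: sum.cong)
  have "(\<Sum>as\<in>{as \<in> S. hd as \<noteq> a0}. h as) \<in> P (Suc 0)"
    by (rule ideal_sum[OF I1]) (use rest in blast)
  \<comment> \<open>Terms with a higher power of f lie in \<open>P (Suc 0)\<close>, which contains
    f. What is left is a relation among the remaining polynomials, over the shifted chain.\<close>
  from ideal_diff[OF I1 sum1 this] have "(\<Sum>as\<in>{as \<in> S. hd as = a0}. h as) \<in> P (Suc 0)"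
    unfolding split by simp
  also have "(\<Sum>as\<in>{as \<in> S. hd as = a0}. h as) = (\<Sum>as\<in>tl ` {as \<in> S. hd as = a0}. Const (c (a0 # as)) * power_prod fs as)"
  proof (rule sum.reindex_cong[symmetric, OF _ refl])
    have eq: "a0 # tl as = as" if "as \<in> {as \<in> S. hd as = a0}" for as
      using that lenS[of as] by (cases as) auto
    show "inj_on tl {as \<in> S. hd as = a0}" by (rule inj_on_inverseI[of _ "(#) a0"]) (rule eq)
    show "Const (c (a0 # tl as)) * power_prod fs (tl as) = h as" if "as \<in> {as \<in> S. hd as = a0}" for as
      using eq[OF that] that by (simp add: h_def)
  qed
  finally have rel: "(\<Sum>as\<in>tl ` {as \<in> S. hd as = a0}. Const (c (a0 # as)) * power_prod fs as) \<in> P (Suc 0)" .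
  show False
  proof (rule Cons.IH[of "\<lambda>i. P (Suc i)" "tl ` {as \<in> S. hd as = a0}" "\<lambda>as. c (a0 # as)"])
    show "primeideal (P (Suc i)) (poly_ring V)" if "i \<le> length fs" for i using Cons.prems(1)[of "Suc i"] that by simp
    show "P (Suc i) \<subseteq> P (Suc (Suc i)) \<and> fs ! i \<in> P (Suc (Suc i)) \<and> fs ! i \<notin> P (Suc i)" if "i < length fs" for i
      using Cons.prems(2)[of "Suc i"] that by simp
    show "finite (tl ` {as \<in> S. hd as = a0})" using finS by simp
    show "length as = length fs" if "as \<in> tl ` {as \<in> S. hd as = a0}" for as using that lenS by auto
    obtain as where as: "as \<in> S" "hd as = a0" using a0(1) by auto
    then have "a0 # tl as = as" using lenS[of as] by (cases as) auto
    then show "\<exists>as\<in>tl ` {as \<in> S. hd as = a0}. c (a0 # as) \<noteq> 0"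
      using as by (intro bexI[of _ "tl as"]) (auto simp: S_def)
  qed (rule rel)
qed

text \<open>A longer chain would supply \<open>card V + 1\<close> polynomials, each chosen in a
  prime but not in the preceding one. They are algebraically dependent, which
  \<open>chain_no_relation\<close> forbids.\<close>

lemma prime_chain_length:
  fixes P :: "nat \<Rightarrow> ('v, 'k::field) mpoly set"
  assumes V: "finite V" and P: "\<And>i. i \<le> n \<Longrightarrow> primeideal (P i) (poly_ring V)"
    and chain: "\<And>i. i < n \<Longrightarrow> P i \<subset> P (Suc i)"
  shows "n \<le> card V"
proof (rule ccontr)
  assume "\<not> n \<le> card V"
  then have n: "Suc (card V) \<le> n" by simp
  have "\<forall>i. \<exists>f. i < n \<longrightarrow> f \<in> P (Suc i) \<and> f \<notin> P i" using chain by blast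
  then obtain f where f: "\<And>i. i < n \<Longrightarrow> f i \<in> P (Suc i) \<and> f i \<notin> P i" by metis
  define fs where "fs = map f [0..<Suc (card V)]"
  have fsc: "set fs \<subseteq> polys V"
  proof
    fix g assume "g \<in> set fs"
    then obtain i where "i < Suc (card V)" "g = f i" unfolding fs_def by (auto simp del: upt_Suc)
    then have i: "i < n" "g = f i" using n by auto
    have "ideal (P (Suc i)) (poly_ring V)" using P[of "Suc i"] i primeideal.axioms(1) by auto
    then show "g \<in> polys V" using f[OF i(1)] i ideal_subset by blast
  qed
  have len: "length fs = Suc (card V)" by (simp add: fs_def)
  obtain A c where A: "finite A" "\<And>as. as \<in> A \<Longrightarrow> length as = length fs" "\<exists>as\<in>A. c as \<noteq> (0::'k)"
    "(\<Sum>as\<in>A. Const (c as) * power_prod fs as) = 0"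
    by (rule algebraic_dependence[OF V fsc len]) blast
  have "ideal (P 0) (poly_ring V)" using P[of 0] primeideal.axioms(1) by auto
  then have rel: "(\<Sum>as\<in>A. Const (c as) * power_prod fs as) \<in> P 0" unfolding A(4) by (rule ideal_zero)
  show False
  proof (rule chain_no_relation[of fs P V A c, OF _ _ A(1-3) rel])
    show "primeideal (P i) (poly_ring V)" if "i \<le> length fs" for i using that n len by (intro P) simp
    show "P i \<subseteq> P (Suc i) \<and> fs ! i \<in> P (Suc i) \<and> fs ! i \<notin> P i" if "i < length fs" for i
      using that n len f[of i] chain[of i] by (auto simp: fs_def simp del: upt_Suc)
  qed
qed

section \<open>Primes of the quotient ring and the dimension of a star\<close>

lemma coset_eq_iff:
  assumes I: "ideal I (poly_ring V)"
  shows "coset V I a = coset V I b \<longleftrightarrow> a - b \<in> I"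
proof -
  have mem: "x \<in> coset V I p \<longleftrightarrow> x - p \<in> I" for x p
  proof
    assume "x \<in> coset V I p"
    then obtain i where "i \<in> I" "x = i + p" by (auto simp: a_r_coset_def')
    then show "x - p \<in> I" by simp
  next
    assume "x - p \<in> I"
    then show "x \<in> coset V I p"
      by (auto simp: a_r_coset_def' intro!: bexI[of _ "x - p"])
  qed
  show ?thesis
  proof
    assume eq: "coset V I a = coset V I b"
    have "a \<in> coset V I a" unfolding mem using ideal_zero[OF I] by simp
    then show "a - b \<in> I" unfolding eq mem .
  next
    assume ab: "a - b \<in> I"
    have "x - a \<in> I \<longleftrightarrow> x - b \<in> I" for x
      using ideal_add[OF I _ ab, of "x - a"] ideal_diff[OF I _ ab, of "x - b"] by auto
    then show "coset V I a = coset V I b" by (simp add: set_eq_iff mem)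
  qed
qed

lemma carrier_Quot: "carrier (poly_ring V Quot I) = coset V I ` polys V"
  by (auto simp: FactRing_def A_RCOSETS_def')

lemma Quot_mult:
  assumes "ideal I (poly_ring V)" "a \<in> polys V" "b \<in> polys V"
  shows "(coset V I a) \<otimes>\<^bsub>poly_ring V Quot I\<^esub> (coset V I b) = coset V I (a * b)"
  using ring_hom_mult[OF ideal.rcos_ring_hom[OF assms(1)] assms(2,3)] by simp

lemma Quot_add:
  assumes "ideal I (poly_ring V)" "a \<in> polys V" "b \<in> polys V"
  shows "(coset V I a) \<oplus>\<^bsub>poly_ring V Quot I\<^esub> (coset V I b) = coset V I (a + b)"
  using ring_hom_add[OF ideal.rcos_ring_hom[OF assms(1)] assms(2,3)] by simp

lemma Quot_one: "\<one>\<^bsub>poly_ring V Quot I\<^esub> = coset V I 1"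
  by (simp add: FactRing_def)

lemma Quot_zero:
  assumes "ideal I (poly_ring V)" shows "\<zero>\<^bsub>poly_ring V Quot I\<^esub> = coset V I 0"
  using ring.a_rcos_zero[OF poly_ring_ring assms ideal_zero[OF assms]] by (simp add: FactRing_def)

lemma primeideal_pullback:
  assumes I: "ideal I (poly_ring V)" and P: "primeideal P (poly_ring V Quot I)"
  shows "primeideal {p \<in> polys V. coset V I p \<in> P} (poly_ring V)"
proof (rule primeidealI[OF _ poly_ring_cring])
  let ?R = "poly_ring V Quot I" and ?Q = "{p \<in> polys V. coset V I p \<in> P}"
  have PI: "ideal P ?R" using P primeideal.axioms(1) by blast
  have car: "coset V I p \<in> carrier ?R" if "p \<in> polys V" for p
    using that unfolding carrier_Quot by blast
  show "ideal ?Q (poly_ring V)"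
  proof (rule ideal_poly_ringI)
    show "?Q \<subseteq> polys V" by blast
    show "0 \<in> ?Q"
      using additive_subgroup.zero_closed[OF ideal.axioms(1)[OF PI]] Quot_zero[OF I] by simp
    show "a + b \<in> ?Q" if "a \<in> ?Q" "b \<in> ?Q" for a b
      using that additive_subgroup.a_closed[OF ideal.axioms(1)[OF PI]] Quot_add[OF I, of a b] poly_ring_add[of a V b] by force
    show "p * a \<in> ?Q" if "a \<in> ?Q" "p \<in> polys V" for a p
      using that ideal.I_l_closed[OF PI, of "coset V I a" "coset V I p"] Quot_mult[OF I, of p a]
        poly_ring_mult[of p V a] car[of p] by force
  qed
  show "polys V \<noteq> ?Q"
  proof
    assume eq: "polys V = ?Q"
    have "1 \<in> ?Q" using poly_ring_one[of V] unfolding eq[symmetric] .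
    then have "\<one>\<^bsub>?R\<^esub> \<in> P" unfolding Quot_one by blast
    then show False using ideal.one_imp_carrier[OF PI] primeideal.I_notcarr[OF P] by blast
  qed
  show "a \<in> ?Q \<or> b \<in> ?Q"
    if a: "a \<in> polys V" and b: "b \<in> polys V" and ab: "a \<otimes>\<^bsub>poly_ring V\<^esub> b \<in> ?Q" for a b
  proof -
    have "(coset V I a) \<otimes>\<^bsub>?R\<^esub> (coset V I b) \<in> P"
      using ab unfolding Quot_mult[OF I a b] by simp
    then show ?thesis using primeideal.I_prime[OF P car[OF a] car[OF b]] a b by blast
  qed
qed

lemma primeideal_image:
  fixes I :: "('v, 'k::comm_ring_1) mpoly set"
  assumes I: "ideal I (poly_ring V)" and Q: "primeideal Q (poly_ring V)" and sub: "I \<subseteq> Q"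
  shows "primeideal (coset V I ` Q) (poly_ring V Quot I)"
proof (rule primeidealI)
  have QI: "ideal Q (poly_ring V)" using Q primeideal.axioms(1) by blast
  have mem: "coset V I a \<in> coset V I ` Q \<longleftrightarrow> a \<in> Q" for a
  proof
    assume "coset V I a \<in> coset V I ` Q"
    then obtain q where q: "q \<in> Q" "coset V I a = coset V I q" by blast
    then have "a - q \<in> Q" using coset_eq_iff[OF I] sub by blast
    from ideal_add[OF QI this q(1)] show "a \<in> Q" by simp
  qed blast
  show "ideal (coset V I ` Q) (poly_ring V Quot I)"
    by (rule ring.ring_ideal_imp_quot_ideal[OF poly_ring_ring I QI])
  show "cring (poly_ring V Quot I)" by (rule ideal.quotient_is_cring[OF I poly_ring_cring])
  show "carrier (poly_ring V Quot I) \<noteq> coset V I ` Q"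
  proof
    assume eq: "carrier (poly_ring V Quot I) = coset V I ` Q"
    have "polys V \<subseteq> Q"
    proof
      fix a :: "('v, 'k) mpoly" assume "a \<in> polys V"
      then have "coset V I a \<in> coset V I ` Q"
        unfolding eq[symmetric] carrier_Quot by blast
      then show "a \<in> Q" unfolding mem .
    qed
    then show False using primeideal.I_notcarr[OF Q] ideal_subset[OF QI] by blast
  qed
  fix X Y assume X: "X \<in> carrier (poly_ring V Quot I)" and Y: "Y \<in> carrier (poly_ring V Quot I)"
    and XY: "X \<otimes>\<^bsub>poly_ring V Quot I\<^esub> Y \<in> coset V I ` Q"
  from X obtain a where a: "a \<in> polys V" "X = coset V I a" unfolding carrier_Quot by blast
  from Y obtain b where b: "b \<in> polys V" "Y = coset V I b" unfolding carrier_Quot by blast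
  have "a * b \<in> Q" using XY unfolding a(2) b(2) Quot_mult[OF I a(1) b(1)] mem .
  then have "a \<in> Q \<or> b \<in> Q" using primeideal.I_prime[OF Q a(1) b(1)] by simp
  then show "X \<in> coset V I ` Q \<or> Y \<in> coset V I ` Q"
    unfolding a(2) b(2) mem .
qed

text \<open>The ideal generated by the variables in A is the kernel of setting these variables to
  zero. The image is a domain, hence \<open>primeideal_vars\<close>.\<close>

lemma vars_ideal_iff:
  "p \<in> sqf_ideal V ((\<lambda>v. {v}) ` A) \<longleftrightarrow> p \<in> polys V \<and> part (\<lambda>m. keys m \<inter> A = {}) p = 0"
proof -
  have "part (\<lambda>m. keys m \<inter> A = {}) p = 0 \<longleftrightarrow> (\<forall>m\<in>keys p. keys m \<inter> A \<noteq> {})"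
  proof
    assume z: "part (\<lambda>m. keys m \<inter> A = {}) p = 0"
    show "\<forall>m\<in>keys p. keys m \<inter> A \<noteq> {}"
    proof
      fix m assume m: "m \<in> keys p"
      have "m \<notin> keys (part (\<lambda>m. keys m \<inter> A = {}) p)" unfolding z by simp
      then show "keys m \<inter> A \<noteq> {}" using m unfolding keys_part by blast
    qed
  next
    assume a: "\<forall>m\<in>keys p. keys m \<inter> A \<noteq> {}"
    show "part (\<lambda>m. keys m \<inter> A = {}) p = 0" by (rule part_eq_0) (rule bspec[OF a])
  qed
  moreover have "(\<exists>e\<in>(\<lambda>v. {v}) ` A. e \<subseteq> keys m) \<longleftrightarrow> keys m \<inter> A \<noteq> {}" for m :: "'a \<Rightarrow>\<^sub>0 nat" by auto
  ultimately show ?thesis unfolding sqf_ideal_def by simp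
qed

lemma primeideal_vars:
  "primeideal (sqf_ideal V ((\<lambda>v. {v}) ` A) :: (nat, 'k::field) mpoly set) (poly_ring V)"
proof (rule primeidealI[OF ideal_sqf_ideal poly_ring_cring])
  let ?Q = "sqf_ideal V ((\<lambda>v. {v}) ` A) :: (nat, 'k) mpoly set"
  have "part (\<lambda>m. keys m \<inter> A = {}) 1 = (1 :: (nat, 'k) mpoly)" by (rule part_eq_self) simp
  then have "1 \<notin> ?Q" unfolding vars_ideal_iff by simp
  then show "polys V \<noteq> ?Q" using poly_ring_one by blast
  fix a b :: "(nat, 'k) mpoly"
  assume ab: "a \<in> polys V" "b \<in> polys V" "a \<otimes>\<^bsub>poly_ring V\<^esub> b \<in> ?Q"
  have "part (\<lambda>m. keys m \<inter> A = {}) (a * b) = 0" using ab(3) unfolding vars_ideal_iff by simp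
  moreover have "part (\<lambda>m. keys m \<inter> A = {}) (a * b) = part (\<lambda>m. keys m \<inter> A = {}) a * part (\<lambda>m. keys m \<inter> A = {}) b"
    by (rule part_mult) (auto simp: keys_add_nat)
  ultimately have "part (\<lambda>m. keys m \<inter> A = {}) a = 0 \<or> part (\<lambda>m. keys m \<inter> A = {}) b = 0" by simp
  then show "a \<in> ?Q \<or> b \<in> ?Q" using ab(1,2) unfolding vars_ideal_iff by blast
qed

lemma Var_in_vars_ideal_iff: "v \<in> V \<Longrightarrow> (Var v :: (nat, 'k::field) mpoly) \<in> sqf_ideal V ((\<lambda>v. {v}) ` A) \<longleftrightarrow> v \<in> A"
  unfolding sqf_ideal_def using poly_ring_Var[of v V] by (auto simp: Var_def)

text \<open>The pulled-back primes all contain h, so the zero ideal, which is prime, can be placed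
  strictly below them. This gains one step over the bound for the polynomial ring.\<close>

lemma quotient_prime_chain_length:
  fixes I :: "(nat, 'k::field) mpoly set"
  assumes V: "finite V" and I: "ideal I (poly_ring V)" and h: "h \<in> I" "h \<noteq> 0"
    and P: "\<And>i. i \<le> n \<Longrightarrow> primeideal (P i) (poly_ring V Quot I)" and chain: "\<And>i. i < n \<Longrightarrow> P i \<subset> P (Suc i)"
  shows "Suc n \<le> card V"
proof -
  define Q where "Q = (\<lambda>i. {p \<in> polys V. coset V I p \<in> P i})"
  have QP: "primeideal (Q i) (poly_ring V)" if "i \<le> n" for i
    unfolding Q_def by (rule primeideal_pullback[OF I P[OF that]])
  have PI: "ideal (P i) (poly_ring V Quot I)" if "i \<le> n" for i
    using P[OF that] primeideal.axioms(1) by blast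
  have Qchain: "Q i \<subset> Q (Suc i)" if i: "i < n" for i
  proof
    show "Q i \<subseteq> Q (Suc i)" using chain[OF i] unfolding Q_def by blast
    obtain X where X: "X \<in> P (Suc i)" "X \<notin> P i" using chain[OF i] by blast
    have "X \<in> carrier (poly_ring V Quot I)"
      using X(1) additive_subgroup.a_subset[OF ideal.axioms(1)[OF PI[of "Suc i"]]] i by auto
    then obtain p where "p \<in> polys V" "X = coset V I p" unfolding carrier_Quot by blast
    then have "p \<in> Q (Suc i)" "p \<notin> Q i" using X unfolding Q_def by auto
    then show "Q i \<noteq> Q (Suc i)" by blast
  qed
  have "I \<subseteq> Q 0"
  proof
    fix a assume a: "a \<in> I"
    have "coset V I a = coset V I 0" using a by (simp add: coset_eq_iff[OF I])
    then have "coset V I a = \<zero>\<^bsub>poly_ring V Quot I\<^esub>" by (simp add: Quot_zero[OF I])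
    then have "coset V I a \<in> P 0"
      using additive_subgroup.zero_closed[OF ideal.axioms(1)[OF PI[of 0]]] by simp
    then show "a \<in> Q 0" using a ideal_subset[OF I] unfolding Q_def by blast
  qed
  then have Q0: "h \<in> Q 0" using h(1) by blast
  define Q' where "Q' = (\<lambda>i. case i of 0 \<Rightarrow> {0} | Suc l \<Rightarrow> Q l)"
  have zero: "primeideal {0 :: (nat, 'k) mpoly} (poly_ring V)"
  proof (rule primeidealI[OF _ poly_ring_cring])
    show "ideal {0 :: (nat, 'k) mpoly} (poly_ring V)" by (rule ideal_poly_ringI) auto
    show "polys V \<noteq> {0 :: (nat, 'k) mpoly}" using poly_ring_one[of V, where ?'b = 'k] by (metis singletonD zero_neq_one)
  qed simp
  show ?thesis
  proof (rule prime_chain_length[OF V, of "Suc n" Q'])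
    show "primeideal (Q' i) (poly_ring V)" if "i \<le> Suc n" for i
      using that zero QP by (cases i) (simp_all add: Q'_def)
    show "Q' i \<subset> Q' (Suc i)" if "i < Suc n" for i
    proof (cases i)
      case 0
      have "0 \<in> Q 0" using ideal_zero primeideal.axioms(1)[OF QP[of 0]] by blast
      then show ?thesis using 0 Q0 h(2) by (auto simp: Q'_def)
    next
      case (Suc l)
      then show ?thesis using Qchain[of l] that by (simp add: Q'_def)
    qed
  qed
qed

text \<open>All edges contain x, so the ideal lies in the prime generated by x. Adjoining the other
  variables one by one gives \<open>card V\<close> primes, that is, \<open>card V - 1\<close> strict
  inclusions.\<close>

lemma krull_dim_star:
  assumes G: "simple_graph V E" and x: "x \<in> V" "\<And>e. e \<in> E \<Longrightarrow> x \<in> e" and ne: "E \<noteq> {}"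
  shows "krull_dim (poly_ring V Quot (edge_ideal V E :: (nat, 'k::field) mpoly set)) = card V - 1"
proof -
  let ?I = "sqf_ideal V E :: (nat, 'k) mpoly set"
  let ?T = "{n. \<exists>P. (\<forall>i\<le>n. primeideal (P i) (poly_ring V Quot ?I)) \<and> (\<forall>i<n. P i \<subset> P (Suc i))}"
  have fin: "finite V" using G by (simp add: simple_graph_def)
  obtain e where e: "e \<in> E" using ne by blast
  then have eV: "e \<subseteq> V" "finite e" using G finite_subset[OF _ fin] unfolding simple_graph_def by auto
  have h: "sqf_monom e \<in> ?I" by (rule monom_in_sqf_ideal[OF eV(2,1) e]) simp
  have h0: "sqf_monom e \<noteq> (0 :: (nat, 'k) mpoly)"
    using keys_single[of "sqf e" "1 :: 'k"] unfolding sqf_monom_def by fastforce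
  have le: "n \<le> card V - 1" if n: "n \<in> ?T" for n
  proof -
    obtain P where P: "\<forall>i\<le>n. primeideal (P i) (poly_ring V Quot ?I)" "\<forall>i<n. P i \<subset> P (Suc i)"
      using n by blast
    have "Suc n \<le> card V" by (rule quotient_prime_chain_length[OF fin ideal_sqf_ideal h h0, of n P]) (use P in blast)+
    then show ?thesis by simp
  qed
  have "?T \<subseteq> {..card V - 1}" unfolding subset_eq atMost_iff by (intro ballI le)
  then have finT: "finite ?T" by (rule finite_subset) simp
  define ys where "ys = sorted_list_of_set (V - {x})"
  have ys: "set ys = V - {x}" "distinct ys" "length ys = card V - 1" using fin x(1) by (simp_all add: ys_def)
  define A where "A = (\<lambda>i. insert x (set (take i ys)))"
  define Q where "Q = (\<lambda>i. sqf_ideal V ((\<lambda>v. {v}) ` A i) :: (nat, 'k) mpoly set)"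
  have IQ: "?I \<subseteq> Q i" for i
  proof
    fix p assume p: "p \<in> ?I"
    have "\<exists>f\<in>(\<lambda>v. {v}) ` A i. f \<subseteq> keys m" if m: "m \<in> keys p" for m
    proof -
      obtain f where "f \<in> E" "f \<subseteq> keys m" using p m unfolding sqf_ideal_def by blast
      then have "{x} \<subseteq> keys m" using x(2) by blast
      then show ?thesis by (intro bexI[of _ "{x}"]) (auto simp: A_def)
    qed
    then show "p \<in> Q i" using p unfolding Q_def sqf_ideal_def by blast
  qed
  have Qp: "primeideal (Q i) (poly_ring V)" for i unfolding Q_def by (rule primeideal_vars)
  have "card V - 1 \<in> ?T"
  proof (intro CollectI exI[of _ "\<lambda>i. coset V ?I ` Q i"] conjI allI impI)
    show "primeideal (coset V ?I ` Q i) (poly_ring V Quot ?I)" for i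
      by (rule primeideal_image[OF ideal_sqf_ideal Qp IQ])
    fix i assume i: "i < card V - 1"
    then have iy: "i < length ys" using ys by simp
    have "A i \<subseteq> A (Suc i)" unfolding A_def using set_take_subset_set_take[of i "Suc i" ys] by auto
    then have sub: "Q i \<subseteq> Q (Suc i)" unfolding Q_def sqf_ideal_def by blast
    have yV: "ys ! i \<in> V" "ys ! i \<noteq> x" using nth_mem[OF iy] ys(1) by auto
    have y1: "Var (ys ! i) \<in> Q (Suc i)"
      unfolding Q_def Var_in_vars_ideal_iff[OF yV(1)] A_def using iy by (simp add: take_Suc_conv_app_nth)
    have "ys ! i \<notin> set (take i ys)"
    proof
      assume "ys ! i \<in> set (take i ys)"
      then obtain j where "j < i" "ys ! j = ys ! i" by (auto simp: in_set_conv_nth)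
      then show False using nth_eq_iff_index_eq[OF ys(2), of j i] iy by simp
    qed
    then have y2: "Var (ys ! i) \<notin> Q i"
      unfolding Q_def Var_in_vars_ideal_iff[OF yV(1)] A_def using yV(2) by simp
    \<comment> \<open>Strictness survives in the quotient because each \<open>Q i\<close> contains
      the ideal divided out.\<close>
    have "coset V ?I (Var (ys ! i)) \<notin> coset V ?I ` Q i"
    proof
      assume "coset V ?I (Var (ys ! i)) \<in> coset V ?I ` Q i"
      then obtain q where q: "q \<in> Q i" "coset V ?I (Var (ys ! i)) = coset V ?I q" by blast
      have "Var (ys ! i) - q \<in> Q i" using q(2) IQ unfolding coset_eq_iff[OF ideal_sqf_ideal] by blast
      from ideal_add[OF primeideal.axioms(1)[OF Qp] this q(1)] show False using y2 by simp
    qed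
    then show "coset V ?I ` Q i \<subset> coset V ?I ` Q (Suc i)"
      using sub y1 by blast
  qed
  then show ?thesis
    unfolding krull_dim_def edge_ideal_eq_sqf_ideal[OF G] using finT le by (intro Max_eqI)
qed

section \<open>The Hilbert function\<close>

lemma a_inv_poly_ring:
  assumes "a \<in> polys V" shows "\<ominus>\<^bsub>poly_ring V\<^esub> a = - a"
  using assms
  by (intro abelian_group.minus_equality[OF ring.is_abelian_group[OF poly_ring_ring]]) (auto intro: poly_ring_uminus)

lemma Const_simps:
  "Const 0 = 0" "Const 1 = 1" "Const (a + b) = Const a + Const b" "Const (- a) = - Const a"
  "Const (a * b) = Const a * Const b"
  by (simp_all add: Const_def single_add single_uminus mult_single)

lemma subfield_Const: "subfield (range Const) (poly_ring V :: ('v, 'k::field) mpoly ring)"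
proof -
  let ?K = "range Const :: ('v, 'k) mpoly set" and ?R = "poly_ring V :: ('v, 'k) mpoly ring"
  have "subring ?K ?R"
  proof (rule ring.subringI[OF poly_ring_ring])
    show "?K \<subseteq> carrier ?R" using poly_ring_Const by blast
    show "\<one>\<^bsub>?R\<^esub> \<in> ?K" using Const_simps(2) by (metis poly_ring_simps(2) rangeI)
    show "\<ominus>\<^bsub>?R\<^esub> h \<in> ?K" if h: "h \<in> ?K" for h
    proof -
      obtain c where "h = Const c" using h by blast
      then have "\<ominus>\<^bsub>?R\<^esub> h = Const (- c)" by (simp add: a_inv_poly_ring poly_ring_Const Const_simps)
      then show ?thesis by blast
    qed
    show "h \<otimes>\<^bsub>?R\<^esub> k \<in> ?K" "h \<oplus>\<^bsub>?R\<^esub> k \<in> ?K" if hk: "h \<in> ?K" "k \<in> ?K" for h k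
    proof -
      obtain c d where cd: "h = Const c" "k = Const d" using hk by blast
      show "h \<otimes>\<^bsub>?R\<^esub> k \<in> ?K" unfolding poly_ring_simps cd Const_simps(5)[symmetric] by (rule rangeI)
      show "h \<oplus>\<^bsub>?R\<^esub> k \<in> ?K" unfolding poly_ring_simps cd Const_simps(3)[symmetric] by (rule rangeI)
    qed
  qed
  then have "subcring ?K ?R" by (rule cring.subcringI'[OF poly_ring_cring])
  then show ?thesis
  proof (rule ring.subfieldI[OF poly_ring_ring])
    have "x \<in> Units (?R\<lparr>carrier := ?K\<rparr>) \<longleftrightarrow> x \<in> ?K - {0}" for x
    proof
      assume "x \<in> Units (?R\<lparr>carrier := ?K\<rparr>)"
      then obtain y where "x \<in> ?K" "y * x = 1" unfolding Units_def by auto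
      then show "x \<in> ?K - {0}" by auto
    next
      assume "x \<in> ?K - {0}"
      then obtain c where "x = Const c" "x \<noteq> 0" by blast
      then have c: "x = Const c" "c \<noteq> 0" using Const_simps(1) by auto
      have "Const (inverse c) * x = 1" "x * Const (inverse c) = 1"
        unfolding c(1) Const_simps(5)[symmetric] using c(2) by (simp_all add: Const_simps)
      then show "x \<in> Units (?R\<lparr>carrier := ?K\<rparr>)" unfolding Units_def c(1) by auto
    qed
    then show "Units (?R\<lparr>carrier := ?K\<rparr>) = ?K - {\<zero>\<^bsub>?R\<^esub>}" by auto
  qed
qed

definition standard_monomials :: "'v set \<Rightarrow> 'v set set \<Rightarrow> nat \<Rightarrow> ('v \<Rightarrow>\<^sub>0 nat) set" where
  "standard_monomials V E j = {m. keys m \<subseteq> V \<and> mdeg m = j \<and> \<not> (\<exists>e\<in>E. e \<subseteq> keys m)}"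

lemma lookup_le_mdeg: "lookup m v \<le> mdeg m"
proof (cases "v \<in> keys m")
  case True
  then show ?thesis unfolding mdeg_def by (intro member_le_sum) auto
qed (simp add: in_keys_iff)

lemma finite_monomials:
  assumes "finite V" shows "finite {m. keys m \<subseteq> V \<and> mdeg m = j}"
proof (rule finite_subset[OF _ bounded_monomials(1)[OF assms, of j]])
  show "{m. keys m \<subseteq> V \<and> mdeg m = j} \<subseteq> {m. keys m \<subseteq> V \<and> (\<forall>v. lookup m v \<le> j)}"
    by (auto intro: lookup_le_mdeg)
qed

text \<open>The induction follows the definition of \<open>ring.dimension\<close> by line
  extensions. The class of a new monomial is independent of the earlier ones because no member of
  the ideal has a standard monomial among its terms.\<close>

lemma dimension_standard_monomials:
  fixes I :: "('v, 'k::field) mpoly set" and M :: "('v \<Rightarrow>\<^sub>0 nat) set" and V :: "'v set" and E :: "'v set set"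
  defines "I \<equiv> sqf_ideal V E"
  assumes "finite M" and "\<And>m. m \<in> M \<Longrightarrow> keys m \<subseteq> V \<and> \<not> (\<exists>e\<in>E. e \<subseteq> keys m)"
  shows "ring.dimension (poly_ring V Quot I) (card M) {coset V I (Const c) | c. True}
    {coset V I f | f. keys f \<subseteq> M}"
  using assms(2-)
proof (induction M rule: finite_induct)
  let ?R = "poly_ring V Quot I" and ?c = "coset V I"
  have I: "ideal I (poly_ring V)" unfolding I_def by (rule ideal_sqf_ideal)
  have R: "ring ?R" by (rule ideal.quotient_is_ring[OF I])
  {
    case empty
    have "{?c f | f. keys f \<subseteq> {}} = {\<zero>\<^bsub>?R\<^esub>}" unfolding Quot_zero[OF I] by auto
    then show ?case using ring.zero_dim[OF R] by simp
  next
    case (insert m M)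
    have carr: "f \<in> polys V" if f: "keys f \<subseteq> insert m M" for f :: "('v, 'k) mpoly"
      unfolding carrier_poly_ring_iff using f insert.prems by blast
    have m: "single m 1 \<in> polys V" using insert.prems by (intro poly_ring_single) blast
    have "?c (single m 1) \<notin> {?c f | f. keys f \<subseteq> M}"
    proof
      assume "?c (single m 1) \<in> {?c f | f. keys f \<subseteq> M}"
      then obtain f where f: "keys f \<subseteq> M" "?c (single m 1) = ?c f" by blast
      then have d: "single m 1 - f \<in> I" unfolding coset_eq_iff[OF I] by blast
      have "m \<notin> keys f" using f(1) insert.hyps(2) by blast
      then have "lookup (single m 1 - f) m \<noteq> 0" by (simp add: lookup_minus in_keys_iff)
      then show False using sqf_ideal_lookup[OF d[unfolded I_def]] insert.prems by blast
    qed
    moreover have "ring.line_extension ?R {?c (Const k) | k. True} (?c (single m 1)) {?c f | f. keys f \<subseteq> M}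
      = {?c f | f. keys f \<subseteq> insert m M}" (is "?L = ?S")
    proof
      have mem: "u \<in> ?L \<longleftrightarrow> (\<exists>k f. keys f \<subseteq> M \<and> u = ?c (Const k * single m 1 + f))" for u
      proof -
        have eq: "?c (Const k) \<otimes>\<^bsub>?R\<^esub> ?c (single m 1) \<oplus>\<^bsub>?R\<^esub> ?c f = ?c (Const k * single m 1 + f)"
          if f: "keys f \<subseteq> M" for k and f :: "('v, 'k) mpoly"
        proof -
          have "f \<in> polys V" using carr[of f] f by blast
          then show ?thesis
            by (simp add: Quot_mult[OF I poly_ring_Const m] Quot_add[OF I poly_ring_mult[OF poly_ring_Const m]])
        qed
        have "u \<in> ?L \<longleftrightarrow> (\<exists>k f. keys f \<subseteq> M \<and> u = ?c (Const k) \<otimes>\<^bsub>?R\<^esub> ?c (single m 1) \<oplus>\<^bsub>?R\<^esub> ?c f)"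
          unfolding ring.line_extension_mem_iff[OF R] by blast
        also have "\<dots> \<longleftrightarrow> (\<exists>k f. keys f \<subseteq> M \<and> u = ?c (Const k * single m 1 + f))"
          by (intro ex_cong1 conj_cong refl) (simp only: eq)
        finally show ?thesis .
      qed
      show "?L \<subseteq> ?S"
      proof
        fix u assume "u \<in> ?L"
        then obtain k f where kf: "keys f \<subseteq> M" "u = ?c (Const k * single m 1 + f)" using mem by blast
        have "keys (Const k * single m 1 :: ('v, 'k) mpoly) \<subseteq> {m}" by (simp add: Const_def mult_single)
        then have "keys (Const k * single m 1 + f) \<subseteq> insert m M"
          using Poly_Mapping.keys_add[of "Const k * single m 1" f] kf(1) by blast
        then show "u \<in> ?S" using kf(2) by blast
      qed
      show "?S \<subseteq> ?L"
      proof
        fix u assume "u \<in> ?S"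
        then obtain f where f: "keys f \<subseteq> insert m M" "u = ?c f" by blast
        let ?g = "part (\<lambda>q. q \<noteq> m) f"
        have "keys ?g \<subseteq> M" using f(1) unfolding keys_part by blast
        moreover have "f = Const (lookup f m) * single m 1 + ?g"
          by (rule poly_mapping_eqI) (simp add: Const_def mult_single lookup_add lookup_part lookup_single when_def)
        ultimately show "u \<in> ?L" unfolding mem f(2) by (intro exI[of _ "lookup f m"] exI[of _ ?g]) simp
      qed
    qed
    moreover have "?c (single m 1) \<in> carrier ?R" unfolding carrier_Quot using m by blast
    moreover have "ring.dimension ?R (card M) {?c (Const k) | k. True} {?c f | f. keys f \<subseteq> M}"
      using insert.prems by (intro insert.IH) blast
    ultimately show ?case
      using ring.Suc_dim[OF R, of "?c (single m 1)" "{?c f | f. keys f \<subseteq> M}" "card M" "{?c (Const k) | k. True}"]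
        insert.hyps by simp
  }
qed

text \<open>Every polynomial is congruent to its standard part. The condition on E keeps 1 out of
  the ideal, so that the constants remain a field in the quotient and the dimension over them is
  well defined.\<close>

lemma hilbert_function_sqf_ideal:
  assumes V: "finite V" and E: "{} \<notin> E"
  shows "hilbert_function V (sqf_ideal V E :: ('v, 'k::field) mpoly set) j = card (standard_monomials V E j)"
proof -
  let ?I = "sqf_ideal V E :: ('v, 'k) mpoly set" and ?M = "standard_monomials V E j"
  let ?R = "poly_ring V Quot ?I" and ?c = "coset V ?I"
  let ?K = "{?c (Const k) | k. True}"
  have I: "ideal ?I (poly_ring V)" by (rule ideal_sqf_ideal)
  have R: "ring ?R" by (rule ideal.quotient_is_ring[OF I])
  have finM: "finite ?M"
    by (rule finite_subset[OF _ finite_monomials[OF V, of j]]) (auto simp: standard_monomials_def)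
  have "1 \<notin> ?I"
  proof
    assume i: "1 \<in> ?I"
    have "lookup (1 :: ('v, 'k) mpoly) 0 \<noteq> 0" by simp
    from sqf_ideal_lookup[OF i this] show False using E by auto
  qed
  then have "\<one>\<^bsub>?R\<^esub> \<noteq> \<zero>\<^bsub>?R\<^esub>" unfolding Quot_one Quot_zero[OF I] coset_eq_iff[OF I] by simp
  then have "subfield (?c ` range Const) ?R"
    using ring_hom_ring.img_is_subfield(2)[OF ideal.rcos_ring_hom_ring[OF I] subfield_Const] by blast
  moreover have "?c ` range Const = ?K" by blast
  ultimately have K: "subfield ?K ?R" by simp
  have "{?c f | f. f \<in> polys V \<and> homogeneous (int j) f} = {?c f | f. keys f \<subseteq> ?M}"
  proof
    show "{?c f | f. keys f \<subseteq> ?M} \<subseteq> {?c f | f. f \<in> polys V \<and> homogeneous (int j) f}"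
      unfolding carrier_poly_ring_iff homogeneous_def standard_monomials_def by blast
    show "{?c f | f. f \<in> polys V \<and> homogeneous (int j) f} \<subseteq> {?c f | f. keys f \<subseteq> ?M}"
    proof
      fix u assume "u \<in> {?c f | f. f \<in> polys V \<and> homogeneous (int j) f}"
      then obtain f where f: "f \<in> polys V" "homogeneous (int j) f" "u = ?c f" by blast
      let ?g = "part (\<lambda>m. \<not> (\<exists>e\<in>E. e \<subseteq> keys m)) f"
      have fm: "keys m \<subseteq> V" "mdeg m = j" if "m \<in> keys f" for m
        using f(1,2) that unfolding carrier_poly_ring_iff homogeneous_def by auto
      have gM: "keys ?g \<subseteq> ?M" unfolding keys_part standard_monomials_def using fm by blast
      have "f - ?g \<in> ?I"
        unfolding sqf_ideal_def
      proof (intro CollectI conjI ballI)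
        show "f - ?g \<in> polys V" by (rule poly_ring_diff[OF f(1) poly_ring_part[OF f(1)]])
        fix m assume "m \<in> keys (f - ?g)"
        then have "lookup f m - (if \<not> (\<exists>e\<in>E. e \<subseteq> keys m) then lookup f m else 0) \<noteq> 0"
          unfolding in_keys_iff lookup_minus lookup_part .
        then show "\<exists>e\<in>E. e \<subseteq> keys m" by (cases "\<exists>e\<in>E. e \<subseteq> keys m") simp_all
      qed
      then have "u = ?c ?g" unfolding f(3) coset_eq_iff[OF I] .
      then show "u \<in> {?c f | f. keys f \<subseteq> ?M}" using gM by blast
    qed
  qed
  moreover have "ring.dimension ?R (card ?M) ?K {?c f | f. keys f \<subseteq> ?M}"
    by (rule dimension_standard_monomials[OF finM]) (auto simp: standard_monomials_def)
  ultimately show ?thesis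
    unfolding hilbert_function_def using ring.dimI[OF R K] by (simp add: over_def)
qed

section \<open>The Hilbert series of a star with isolated vertices\<close>

text \<open>The Hilbert series of the polynomial ring on V, that is,
  \<open>1 / (1 - fps_X) ^ card V\<close> for finite V.\<close>

definition monomial_series :: "'v set \<Rightarrow> int fps" where
  "monomial_series V = Abs_fps (\<lambda>j. int (card {m :: 'v \<Rightarrow>\<^sub>0 nat. keys m \<subseteq> V \<and> mdeg m = j}))"

lemma monomials_containing:
  assumes "v \<in> V"
  shows "{m. keys m \<subseteq> V \<and> mdeg m = Suc j \<and> v \<in> keys m} = (\<lambda>m. m + single v 1) ` {m. keys m \<subseteq> V \<and> mdeg m = j}"
proof
  show "(\<lambda>m. m + single v 1) ` {m. keys m \<subseteq> V \<and> mdeg m = j} \<subseteq> {m. keys m \<subseteq> V \<and> mdeg m = Suc j \<and> v \<in> keys m}"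
    using assms by (auto simp: keys_add_nat mdeg_add)
  show "{m. keys m \<subseteq> V \<and> mdeg m = Suc j \<and> v \<in> keys m} \<subseteq> (\<lambda>m. m + single v 1) ` {m. keys m \<subseteq> V \<and> mdeg m = j}"
  proof
    fix m assume m: "m \<in> {m. keys m \<subseteq> V \<and> mdeg m = Suc j \<and> v \<in> keys m}"
    have "sqf {v} + (m - sqf {v}) = m" using m by (intro sqf_add_diff) auto
    then have eq: "m = (m - single v 1) + single v 1" by (simp add: sqf_def add.commute)
    have "mdeg m = mdeg (m - single v 1) + 1" "keys m = keys (m - single v 1) \<union> {v}"
      by (subst eq, simp add: mdeg_add keys_add_nat)+
    then show "m \<in> (\<lambda>m. m + single v 1) ` {m. keys m \<subseteq> V \<and> mdeg m = j}"
      using m eq by (intro image_eqI[of _ _ "m - single v 1"]) auto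
  qed
qed

lemma card_monomials_containing:
  assumes "v \<in> V"
  shows "card {m. keys m \<subseteq> V \<and> mdeg m = Suc j \<and> v \<in> keys m} = card {m. keys m \<subseteq> V \<and> mdeg m = j}"
  unfolding monomials_containing[OF assms] by (rule card_image) (rule inj_onI, simp)

text \<open>A monomial either avoids v or is v times an arbitrary monomial of one degree
  less.\<close>

lemma monomial_series_insert:
  assumes V: "finite V" and v: "v \<notin> V"
  shows "monomial_series (insert v V) = monomial_series V + fps_X * monomial_series (insert v V)"
proof (rule fps_ext)
  fix j
  show "fps_nth (monomial_series (insert v V)) j = fps_nth (monomial_series V + fps_X * monomial_series (insert v V)) j"
  proof (cases j)
    case 0
    have "{m :: 'a \<Rightarrow>\<^sub>0 nat. keys m \<subseteq> A \<and> mdeg m = 0} = {0}" for A by (auto simp: mdeg_eq_0_iff)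
    then show ?thesis using 0 by (simp add: monomial_series_def)
  next
    case (Suc i)
    let ?A = "{m. keys m \<subseteq> insert v V \<and> mdeg m = Suc i}" and ?B = "{m. keys m \<subseteq> V \<and> mdeg m = Suc i}"
      and ?C = "{m. keys m \<subseteq> insert v V \<and> mdeg m = Suc i \<and> v \<in> keys m}"
    have un: "?A = ?B \<union> ?C" by auto
    have fin: "finite ?A" by (rule finite_monomials) (simp add: V)
    have "card ?A = card ?B + card ?C"
      unfolding un by (rule card_Un_disjoint) (use fin un v in \<open>auto intro: finite_subset\<close>)
    also have "card ?C = card {m. keys m \<subseteq> insert v V \<and> mdeg m = i}" by (rule card_monomials_containing) simp
    finally show ?thesis using Suc by (simp add: monomial_series_def)
  qed
qed

lemma monomial_series_mult:
  assumes "finite V" shows "monomial_series V * (1 - fps_X) ^ card V = 1"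
  using assms
proof (induction V rule: finite_induct)
  case empty
  show ?case
  proof (rule fps_ext)
    fix j
    have "{m :: 'a \<Rightarrow>\<^sub>0 nat. keys m \<subseteq> {} \<and> mdeg m = j} = (if j = 0 then {0} else {})" by auto
    then show "fps_nth (monomial_series ({} :: 'a set) * (1 - fps_X) ^ card ({} :: 'a set)) j = fps_nth 1 j"
      by (simp add: monomial_series_def)
  qed
next
  case (insert v V)
  have "monomial_series (insert v V) * (1 - fps_X) = monomial_series V"
    using monomial_series_insert[OF insert.hyps] by (simp add: algebra_simps)
  then have "monomial_series (insert v V) * (1 - fps_X) ^ card (insert v V) = monomial_series V * (1 - fps_X) ^ card V"
    using insert.hyps by (simp add: mult.assoc[symmetric])
  then show ?case using insert.IH by simp
qed

text \<open>A standard monomial either avoids x and is arbitrary in Y and Z, or contains x and then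
  avoids Y.\<close>

lemma star_hilbert_series:
  assumes V: "finite V" "V = insert x (Y \<union> Z)" "x \<notin> Y \<union> Z" "Y \<inter> Z = {}" and E: "E = (\<lambda>y. {x, y}) ` Y"
  shows "hilbert_series V (sqf_ideal V E :: ('v, 'k::field) mpoly set)
    = monomial_series (Y \<union> Z) + fps_X * monomial_series (insert x Z)"
proof (rule fps_ext)
  fix j
  have H: "hilbert_function V (sqf_ideal V E :: ('v, 'k) mpoly set) j = card (standard_monomials V E j)"
    by (rule hilbert_function_sqf_ideal[OF V(1)]) (auto simp: E)
  let ?B = "{m. keys m \<subseteq> Y \<union> Z \<and> mdeg m = j}" and ?C = "{m. keys m \<subseteq> insert x Z \<and> mdeg m = j \<and> x \<in> keys m}"
  have un: "standard_monomials V E j = ?B \<union> ?C"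
    unfolding standard_monomials_def E V(2) using V(3,4) by auto
  have fin: "finite ?B" "finite ?C"
    by (rule finite_subset[OF _ finite_monomials[OF V(1), of j]], use V(2) in auto)+
  have "card (standard_monomials V E j) = card ?B + card ?C"
    unfolding un by (rule card_Un_disjoint[OF fin]) (use V(3) in auto)
  \<comment> \<open>No monomial of degree 0 contains x, which matches the vanishing constant term of
    the series multiplied by \<open>fps_X\<close>.\<close>
  moreover have "card ?C = (case j of 0 \<Rightarrow> 0 | Suc i \<Rightarrow> card {m. keys m \<subseteq> insert x Z \<and> mdeg m = i})"
  proof (cases j)
    case 0
    then have C: "?C = {}" by (auto simp: mdeg_eq_0_iff)
    show ?thesis unfolding C using 0 by simp
  next
    case (Suc i)
    then show ?thesis using card_monomials_containing[of x "insert x Z" i] by simp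
  qed
  ultimately show "fps_nth (hilbert_series V (sqf_ideal V E :: ('v, 'k) mpoly set)) j
    = fps_nth (monomial_series (Y \<union> Z) + fps_X * monomial_series (insert x Z)) j"
    by (simp add: hilbert_series_def H monomial_series_def split: nat.split)
qed

lemma star_h_polynomial_degree:
  fixes x :: nat
  assumes V: "finite V" "V = insert x (Y \<union> Z)" "x \<notin> Y \<union> Z" "Y \<inter> Z = {}" and E: "E = (\<lambda>y. {x, y}) ` Y"
    and G: "simple_graph V E" and Y: "Y \<noteq> {}"
  shows "Polynomial.degree (h_polynomial V (edge_ideal V E :: (nat, 'k::field) mpoly set)) = card Y"
proof -
  let ?I = "edge_ideal V E :: (nat, 'k) mpoly set"
  have fin: "finite Y" "finite Z" using V by auto
  obtain k where k: "card Y = Suc k" using Y fin by (metis card_eq_0_iff not0_implies_Suc)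
  have "card V = Suc (card Y + card Z)" using V fin by (simp add: card_Un_disjoint)
  moreover have "krull_dim (poly_ring V Quot ?I) = card V - 1"
    by (rule krull_dim_star[OF G, of x]) (use V E Y in auto)
  ultimately have dim: "krull_dim (poly_ring V Quot ?I) = card Y + card Z" by simp
  \<comment> \<open>The denominators have exponents \<open>Suc k + card Z\<close> and
    \<open>Suc (card Z)\<close>; bringing both fractions over the first leaves the factor
    \<open>(1 - t) ^ k\<close> in the second.\<close>
  define h :: "int poly" where "h = 1 + [:0, 1:] * [:1, -1:] ^ k"
  have series: "hilbert_series V ?I = monomial_series (Y \<union> Z) + fps_X * monomial_series (insert x Z)"
    unfolding edge_ideal_eq_sqf_ideal[OF G] by (rule star_hilbert_series[OF V E])
  have YZ: "monomial_series (Y \<union> Z) * (1 - fps_X) ^ (card Y + card Z) = 1"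
    using monomial_series_mult[of "Y \<union> Z"] fin V(4) by (simp add: card_Un_disjoint)
  have "monomial_series (insert x Z) * (1 - fps_X) ^ Suc (card Z) = 1"
    using monomial_series_mult[of "insert x Z"] fin V(3) by simp
  moreover have "(1 - fps_X :: int fps) ^ (card Y + card Z) = (1 - fps_X) ^ Suc (card Z) * (1 - fps_X) ^ k"
    unfolding k by (simp add: power_add mult.commute mult.left_commute)
  ultimately have xZ: "monomial_series (insert x Z) * (1 - fps_X) ^ (card Y + card Z) = (1 - fps_X) ^ k"
    by (simp only: mult.assoc[symmetric] mult_1_left)
  have "hilbert_series V ?I * (1 - fps_X) ^ krull_dim (poly_ring V Quot ?I) = 1 + fps_X * (1 - fps_X) ^ k"
    unfolding dim series distrib_right YZ mult.assoc xZ ..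
  moreover have "fps_of_poly h = 1 + fps_X * (1 - fps_X) ^ k"
    unfolding h_def by (simp add: fps_of_poly_add fps_of_poly_mult fps_of_poly_power fps_of_poly_pCons)
  ultimately have "fps_of_poly h = hilbert_series V ?I * (1 - fps_X) ^ krull_dim (poly_ring V Quot ?I)" by simp
  then have "h_polynomial V ?I = h"
    unfolding h_polynomial_def using fps_of_poly_eq_iff by (metis (mono_tags, lifting) the_equality)
  moreover have "Polynomial.degree h = Suc k"
  proof -
    have "Polynomial.degree ([:0, 1:] * [:1, -1:] ^ k :: int poly) = Suc k"
      by (subst degree_mult_eq) (simp_all add: degree_power_eq)
    \<comment> \<open>The product has positive degree even for k = 0, so adding 1 cannot affect its
      leading term.\<close>
    then show ?thesis unfolding h_def by (subst degree_add_eq_right) simp_all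
  qed
  ultimately show ?thesis using k by simp
qed

section \<open>The two families of graphs\<close>

text \<open>In this graph r triangles share the vertex 0, and the vertices above 2 r are isolated.
  The triangles have 2 r + 1 vertices altogether, which is exactly what
  \<open>regularity_edge_ideal\<close> admits.\<close>

lemma friendship_graph:
  fixes r \<delta> :: nat
  assumes "r > 0" "\<delta> > 0"
  defines "V \<equiv> {..<2 * r + \<delta>}" and "M \<equiv> (\<lambda>i. {2 * i + 1, 2 * i + 2}) ` {..<r}"
  defines "E \<equiv> (\<lambda>y. {0, y}) ` {1..2 * r} \<union> M"
  shows "depth_quot V (edge_ideal V E :: (nat, 'k::field) mpoly set) = \<delta>"
    and "regularity V (edge_ideal V E :: (nat, 'k::field) mpoly set) = int r" and "simple_graph V E"
proof -
  define Z where "Z = {2 * r<..<2 * r + \<delta>}"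
  have E_cases: "(\<exists>y. e = {0, y} \<and> 1 \<le> y \<and> y \<le> 2 * r) \<or> (\<exists>i<r. e = {2 * i + 1, 2 * i + 2})" if "e \<in> E" for e
    using that by (auto simp: E_def M_def)
  have E_subset: "e \<subseteq> {..2 * r} \<and> card e = 2" if e: "e \<in> E" for e
    using E_cases[OF e]
  proof
    assume "\<exists>i<r. e = {2 * i + 1, 2 * i + 2}"
    then obtain i where "i < r" "e = {2 * i + 1, 2 * i + 2}" by blast
    then show ?thesis by simp
  qed auto
  show G: "simple_graph V E"
    unfolding simple_graph_def
  proof
    have "{..2 * r} \<subseteq> V" using assms(2) by (auto simp: V_def)
    then show "E \<subseteq> {e. e \<subseteq> V \<and> card e = 2}" using E_subset by blast
  qed (simp add: V_def)
  have "depth_quot V (edge_ideal V E :: (nat, 'k) mpoly set) = Suc (card Z)"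
  proof (rule cone_depth[OF G, of 0])
    show "0 \<in> V" "0 \<notin> Z" "Z \<subseteq> V" using assms(2) by (auto simp: V_def Z_def)
    show "e \<inter> Z = {}" if "e \<in> E" for e
      using E_subset[OF that] by (auto simp: Z_def)
    show "{0, y} \<in> E" if "y \<in> V - Z - {0}" for y
      using that by (auto simp: V_def Z_def E_def)
    have "1 \<in> V - Z - {0}" using assms(1) by (auto simp: V_def Z_def)
    then show "V - Z - {0} \<noteq> {}" by blast
  qed
  then show "depth_quot V (edge_ideal V E :: (nat, 'k) mpoly set) = \<delta>" using assms(2) by (simp add: Z_def)
  have UM: "\<Union>M = {1..2 * r}"
  proof
    show "\<Union>M \<subseteq> {1..2 * r}" by (auto simp: M_def)
    show "{1..2 * r} \<subseteq> \<Union>M"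
    proof
      fix y assume "y \<in> {1..2 * r}"
      \<comment> \<open>The pairs start at odd numbers, so the pair containing y has index
        \<open>(y - 1) div 2\<close>.\<close>
      then have "(y - 1) div 2 < r" "y \<in> {2 * ((y - 1) div 2) + 1, 2 * ((y - 1) div 2) + 2}" by auto
      then show "y \<in> \<Union>M" unfolding M_def by blast
    qed
  qed
  show "regularity V (edge_ideal V E :: (nat, 'k) mpoly set) = int r"
  proof (rule regularity_edge_ideal[OF G, of r M])
    have "\<Union>E \<subseteq> {..2 * r}" using E_subset by blast
    then show "card (\<Union>E) \<le> 2 * r + 1" using card_mono[of "{..2 * r}" "\<Union>E"] by simp
    show "M \<subseteq> E" by (simp add: E_def)
    \<comment> \<open>The minimum of a pair recovers its index.\<close>
    have "inj_on (\<lambda>i. {2 * i + 1, 2 * i + 2 :: nat}) {..<r}"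
      by (rule inj_on_inverseI[of _ "\<lambda>e. (Min e - 1) div 2"]) simp
    then show "card M = r" unfolding M_def by (simp add: card_image)
    show "card (\<Union>M) = 2 * r" unfolding UM by simp
    \<comment> \<open>The matching avoids 0 while every other edge contains it, so the matching is
      induced.\<close>
    show "e \<in> M" if "e \<in> E" "e \<subseteq> \<Union>M" for e
      using that unfolding UM by (auto simp: E_def)
  qed
qed

text \<open>The centre 0 plays two roles: it is adjacent to all leaves, which gives the depth, and
  it lies on every edge, which gives the Krull dimension and with it the normalisation of the
  h-polynomial.\<close>

lemma star_graph:
  fixes s \<delta> :: nat
  assumes "s > 0" "\<delta> > 0"
  defines "V \<equiv> {..<Suc s + (\<delta> - 1)}" and "E \<equiv> (\<lambda>y. {0, y}) ` {1..s}"
  shows "depth_quot V (edge_ideal V E :: (nat, 'k::field) mpoly set) = \<delta>"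
    and "Polynomial.degree (h_polynomial V (edge_ideal V E :: (nat, 'k::field) mpoly set)) = s"
    and "simple_graph V E"
proof -
  define Z where "Z = {s<..<s + \<delta>}"
  have VZ: "V = insert 0 ({1..s} \<union> Z)" using assms(2) by (auto simp: V_def Z_def)
  show G: "simple_graph V E"
    unfolding simple_graph_def
  proof
    show "E \<subseteq> {e. e \<subseteq> V \<and> card e = 2}"
    proof
      fix e assume "e \<in> E"
      then obtain y where y: "y \<in> {1..s}" "e = {0, y}" unfolding E_def by blast
      then show "e \<in> {e. e \<subseteq> V \<and> card e = 2}" unfolding V_def by auto
    qed
  qed (simp add: V_def)
  have "depth_quot V (edge_ideal V E :: (nat, 'k) mpoly set) = Suc (card Z)"
  proof (rule cone_depth[OF G, of 0])
    show "0 \<in> V" "0 \<notin> Z" "Z \<subseteq> V" unfolding VZ by (auto simp: Z_def)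
    show "e \<inter> Z = {}" if "e \<in> E" for e using that by (auto simp: Z_def E_def)
    show "{0, y} \<in> E" if "y \<in> V - Z - {0}" for y using that unfolding VZ by (auto simp: E_def)
    have "1 \<in> V - Z - {0}" using assms(1) unfolding VZ by (auto simp: Z_def)
    then show "V - Z - {0} \<noteq> {}" by blast
  qed
  then show "depth_quot V (edge_ideal V E :: (nat, 'k) mpoly set) = \<delta>" using assms(2) by (simp add: Z_def)
  have "Polynomial.degree (h_polynomial V (edge_ideal V E :: (nat, 'k) mpoly set)) = card {1..s}"
    by (rule star_h_polynomial_degree[OF _ VZ _ _ E_def[THEN meta_eq_to_obj_eq] G])
      (use assms(1) in \<open>auto simp: V_def Z_def\<close>)
  then show "Polynomial.degree (h_polynomial V (edge_ideal V E :: (nat, 'k) mpoly set)) = s" by simp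
qed

theorem theorem4p12:
  fixes \<delta> r s :: nat
  assumes "\<delta> > 0" and "r > 0" and "s > 0"
  shows
    "(\<exists>(V :: nat set) E. simple_graph V E \<and>
        depth_quot V (edge_ideal V E :: (nat, 'k::field) mpoly set) = \<delta> \<and>
        regularity V (edge_ideal V E :: (nat, 'k) mpoly set) = int r) \<and>
     (\<exists>(V :: nat set) E. simple_graph V E \<and>
        depth_quot V (edge_ideal V E :: (nat, 'k) mpoly set) = \<delta> \<and>
        Polynomial.degree (h_polynomial V (edge_ideal V E :: (nat, 'k) mpoly set)) = s)"
proof
  show "\<exists>(V :: nat set) E. simple_graph V E \<and>
      depth_quot V (edge_ideal V E :: (nat, 'k) mpoly set) = \<delta> \<and>
      regularity V (edge_ideal V E :: (nat, 'k) mpoly set) = int r"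
    by (rule exI, rule exI, intro conjI, rule friendship_graph(3)[OF assms(2,1)])
      (rule friendship_graph[OF assms(2,1)])+
  show "\<exists>(V :: nat set) E. simple_graph V E \<and>
      depth_quot V (edge_ideal V E :: (nat, 'k) mpoly set) = \<delta> \<and>
      Polynomial.degree (h_polynomial V (edge_ideal V E :: (nat, 'k) mpoly set)) = s"
    by (rule exI, rule exI, intro conjI, rule star_graph(3)[OF assms(3,1)])
      (rule star_graph[OF assms(3,1)])+
qed

end
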